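(* Let $f$ and $g$ be Möbius transformations such that $\mathrm{tr}(f)\leq \mathrm{tr}(g)$ and the semigroup $\langle f,g\rangle$ is nonelementary. Then $\langle f,g\rangle$ is semidiscrete and inverse free if and only if exactly one of the following holds: (i) $f$ and $g$ are parabolic, and $fg$ is not elliptic; (ii) $f$ is parabolic and $g$ is hyperbolic, and $f^ng$ is not elliptic for any positive integer $n$; (iii) $f$ and $g$ are hyperbolic, and either $C(f,g)<1$, or else $C(f,g)>1$ and $fg$ is not elliptic and either (a) $\mathrm{tr}[f,g]\geq \mathrm{tr}(g)^2-2$, or (b) $\mathrm{tr}[f,g]<\mathrm{tr}(g)^2-2$ and $\langle f,fg\rangle$ is semidiscrete and inverse free. Furthermore, if $\langle f,g\rangle$ is semidiscrete and inverse free, then either there is a closed interval that both $f$ and $g$ map strictly inside itself, or else $\langle f,g\rangle$ is contained in a Schottky group of rank two.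
   Context: $\mathbb{H}$ is the upper half-plane, $\overline{\mathbb{R}}=\mathbb{R}\cup\{\infty\}$, $\overline{\mathbb{H}}=\mathbb{H}\cup\overline{\mathbb{R}}$. "Möbius transformation" means $z\mapsto (az+b)/(cz+d)$ with $a,b,c,d\in\mathbb{R}$, $ad-bc>0$; these form the topological group $\mathcal{M}\cong\mathrm{PSL}(2,\mathbb{R})$ with identity $I$. A semigroup is a nonempty subset of $\mathcal{M}$ closed under composition; $\langle f,g\rangle$ denotes the semigroup (not the group) generated by $f$ and $g$, i.e. all finite compositions of copies of $f$ and $g$. A semigroup $S$ is semidiscrete if $I$ is not an accumulation point of $S$ in $\mathcal{M}$, and inverse free if $I\notin S$. $S$ is elementary if it has a finite orbit in its action on $\overline{\mathbb{H}}$ (some $x\in\overline{\mathbb{H}}$ has $\{h(x):h\in S\}$ finite), and nonelementary otherwise. If $f(z)=(az+b)/(cz+d)$ with $ad-bc=1$, then $\mathrm{tr}(f)=|a+d|$. The commutator is $[f,g]=fgf^{-1}g^{-1}$. For a hyperbolic $f$, $\alpha_f$ and $\beta_f$ are its attracting and repelling fixed points. For hyperbolic $f,g$, $$C(f,g)=\frac{(\alpha_f-\alpha_g)(\beta_f-\beta_g)}{(\alpha_f-\beta_g)(\beta_f-\alpha_g)},$$ with the usual conventions about $\infty$. A closed interval is a closed interval in the circle $\overline{\mathbb{R}}$ that is neither a singleton nor all of $\overline{\mathbb{R}}$; "$f$ maps $J$ strictly inside itself" means $f(J)\subset J$ and $f(J)\neq J$. A Schottky group of rank two is a group generated (as a group)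 by two Möbius transformations $f_1,f_2$ for which there are pairwise disjoint open intervals $A,B,C,D$ in $\overline{\mathbb{R}}$ such that $f_1$ maps the complement of $\overline{A}$ onto $B$ and $f_2$ maps the complement of $\overline{C}$ onto $D$. *)

theory Defs
  imports "HOL-Analysis.Analysis"
begin

section \<open>The extended plane\<close>

text \<open>Points of the Riemann sphere are \<open>Some z\<close> for complex \<open>z\<close>, together with
  \<open>None\<close>, the point at infinity.\<close>

abbreviation sphere_topology :: "complex option topology" where
  "sphere_topology \<equiv> Alexandroff_compactification euclidean"

definition upper_half_plane :: "complex option set" where
  "upper_half_plane = Some ` {z. Im z > 0}"

definition extended_reals :: "complex option set" where
  "extended_reals = insert None (Some ` \<real>)"

definition closed_half_plane :: "complex option set" where
  "closed_half_plane = upper_half_plane \<union> extended_reals"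

abbreviation circle_topology :: "complex option topology" where
  "circle_topology \<equiv> subtopology sphere_topology extended_reals"

definition closed_interval :: "complex option set \<Rightarrow> bool" where
  "closed_interval J \<longleftrightarrow> closedin circle_topology J \<and> connectedin circle_topology J \<and>
     J \<noteq> {} \<and> (\<forall>x. J \<noteq> {x}) \<and> J \<noteq> extended_reals"

definition open_interval :: "complex option set \<Rightarrow> bool" where
  "open_interval A \<longleftrightarrow> openin circle_topology A \<and> connectedin circle_topology A \<and>
     A \<noteq> {} \<and> A \<noteq> extended_reals"

section \<open>Moebius transformations\<close>

text \<open>A transformation is represented by the function it induces on the whole sphere; proportional
  matrices induce the same function.\<close>

definition moebius_of :: "real^2^2 \<Rightarrow> complex option \<Rightarrow> complex option" where
  "moebius_of A x =
     (let a = complex_of_real (A$1$1); b = complex_of_real (A$1$2);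
          c = complex_of_real (A$2$1); d = complex_of_real (A$2$2)
      in case x of
           None \<Rightarrow> if c = 0 then None else Some (a / c)
         | Some z \<Rightarrow> if c * z + d = 0 then None else Some ((a * z + b) / (c * z + d)))"

definition moebius_transformations :: "(complex option \<Rightarrow> complex option) set" where
  "moebius_transformations = moebius_of ` {A. det A > 0}"

definition SL2 :: "(real^2^2) set" where
  "SL2 = {A. det A = 1}"

text \<open>The topology of \<open>PSL(2,\<real>)\<close>, i.e. the quotient topology from \<open>SL(2,\<real>)\<close>;
  see \<open>quotient_map_moebius_of\<close> below.\<close>

definition moebius_topology :: "(complex option \<Rightarrow> complex option) topology" where
  "moebius_topology = topology (\<lambda>U. U \<subseteq> moebius_transformations \<and>
     openin (top_of_set SL2) {A \<in> SL2. moebius_of A \<in> U})"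

definition tr :: "(complex option \<Rightarrow> complex option) \<Rightarrow> real" where
  "tr f = (THE t. \<exists>A\<in>SL2. f = moebius_of A \<and> t = \<bar>trace A\<bar>)"

definition commutator :: "('a \<Rightarrow> 'a) \<Rightarrow> ('a \<Rightarrow> 'a) \<Rightarrow> 'a \<Rightarrow> 'a" where
  "commutator f g = f \<circ> g \<circ> inv f \<circ> inv g"

definition elliptic :: "(complex option \<Rightarrow> complex option) \<Rightarrow> bool" where
  "elliptic f \<longleftrightarrow> f \<in> moebius_transformations \<and> f \<noteq> id \<and> (\<exists>x\<in>upper_half_plane. f x = x)"

definition parabolic :: "(complex option \<Rightarrow> complex option) \<Rightarrow> bool" where
  "parabolic f \<longleftrightarrow> f \<in> moebius_transformations \<and> card {x \<in> extended_reals. f x = x} = 1"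

definition hyperbolic :: "(complex option \<Rightarrow> complex option) \<Rightarrow> bool" where
  "hyperbolic f \<longleftrightarrow> f \<in> moebius_transformations \<and> card {x \<in> extended_reals. f x = x} = 2"

definition attracting_fixpoint :: "(complex option \<Rightarrow> complex option) \<Rightarrow> complex option" where
  "attracting_fixpoint f = (THE p. p \<in> extended_reals \<and> f p = p \<and>
     (\<forall>x\<in>closed_half_plane. f x \<noteq> x \<longrightarrow>
        limitin sphere_topology (\<lambda>n. (f ^^ n) x) p sequentially))"

definition repelling_fixpoint :: "(complex option \<Rightarrow> complex option) \<Rightarrow> complex option" where
  "repelling_fixpoint f = attracting_fixpoint (inv f)"

text \<open>Difference of two points of the extended real line, as used in a cross-ratio. Each point occurs
  once in the numerator and once in the denominator of the cross-ratio, with the same sign, so the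
  two factors containing the point at infinity cancel and may both be replaced by \<open>1\<close>.\<close>

definition point_diff :: "complex option \<Rightarrow> complex option \<Rightarrow> real" where
  "point_diff x y =
     (if x = y then 0
      else case (x, y) of (Some z, Some w) \<Rightarrow> Re z - Re w | _ \<Rightarrow> 1)"

definition cross_ratio_C ::
  "(complex option \<Rightarrow> complex option) \<Rightarrow> (complex option \<Rightarrow> complex option) \<Rightarrow> ereal" where
  "cross_ratio_C f g =
     (let \<alpha>f = attracting_fixpoint f; \<beta>f = repelling_fixpoint f;
          \<alpha>g = attracting_fixpoint g; \<beta>g = repelling_fixpoint g;
          num = point_diff \<alpha>f \<alpha>g * point_diff \<beta>f \<beta>g;
          den = point_diff \<alpha>f \<beta>g * point_diff \<beta>f \<alpha>g
      in if den = 0 then \<infinity> else ereal (num / den))"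

section \<open>Semigroups\<close>

inductive_set generated_semigroup :: "('a \<Rightarrow> 'a) set \<Rightarrow> ('a \<Rightarrow> 'a) set"
  for F :: "('a \<Rightarrow> 'a) set" where
  incl: "f \<in> F \<Longrightarrow> f \<in> generated_semigroup F"
| comp: "f \<in> generated_semigroup F \<Longrightarrow> g \<in> generated_semigroup F \<Longrightarrow> f \<circ> g \<in> generated_semigroup F"

inductive_set generated_group :: "('a \<Rightarrow> 'a) set \<Rightarrow> ('a \<Rightarrow> 'a) set"
  for F :: "('a \<Rightarrow> 'a) set" where
  one: "id \<in> generated_group F"
| incl: "f \<in> F \<Longrightarrow> f \<in> generated_group F"
| inv: "f \<in> F \<Longrightarrow> inv f \<in> generated_group F"
| comp: "f \<in> generated_group F \<Longrightarrow> g \<in> generated_group F \<Longrightarrow> f \<circ> g \<in> generated_group F"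

definition semidiscrete :: "(complex option \<Rightarrow> complex option) set \<Rightarrow> bool" where
  "semidiscrete S \<longleftrightarrow> id \<notin> moebius_topology derived_set_of S"

definition inverse_free :: "(complex option \<Rightarrow> complex option) set \<Rightarrow> bool" where
  "inverse_free S \<longleftrightarrow> id \<notin> S"

definition elementary :: "(complex option \<Rightarrow> complex option) set \<Rightarrow> bool" where
  "elementary S \<longleftrightarrow> (\<exists>x\<in>closed_half_plane. finite {h x | h. h \<in> S})"

definition schottky_rank_two :: "(complex option \<Rightarrow> complex option) set \<Rightarrow> bool" where
  "schottky_rank_two G \<longleftrightarrow>
     (\<exists>f1\<in>moebius_transformations. \<exists>f2\<in>moebius_transformations.
        G = generated_group {f1, f2} \<and>
        (\<exists>A B C D. open_interval A \<and> open_interval B \<and> open_interval C \<and> open_interval D \<and>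
           A \<inter> B = {} \<and> A \<inter> C = {} \<and> A \<inter> D = {} \<and> B \<inter> C = {} \<and> B \<inter> D = {} \<and> C \<inter> D = {} \<and>
           f1 ` (extended_reals - circle_topology closure_of A) = B \<and>
           f2 ` (extended_reals - circle_topology closure_of C) = D))"

definition exactly_one_of :: "bool \<Rightarrow> bool \<Rightarrow> bool \<Rightarrow> bool" where
  "exactly_one_of P Q R \<longleftrightarrow>
     (P \<and> \<not> Q \<and> \<not> R) \<or> (\<not> P \<and> Q \<and> \<not> R) \<or> (\<not> P \<and> \<not> Q \<and> R)"

section \<open>Adequacy of the definitions by choice of a representing matrix\<close>

lemma moebius_of_scale:
  assumes "k \<noteq> 0"
  shows "moebius_of (k *\<^sub>R A) = moebius_of A"
proof
  fix x
  have e: "complex_of_real k * a * z + complex_of_real k * b = complex_of_real k * (a * z + b)"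
    for a b z by (simp add: algebra_simps)
  show "moebius_of (k *\<^sub>R A) x = moebius_of A x"
    using assms by (cases x) (simp_all add: moebius_of_def Let_def e)
qed

lemma moebius_transformations_SL2: "moebius_transformations = moebius_of ` SL2"
proof
  show "moebius_of ` SL2 \<subseteq> moebius_transformations"
    by (auto simp: moebius_transformations_def SL2_def)
  show "moebius_transformations \<subseteq> moebius_of ` SL2"
  proof
    fix f assume "f \<in> moebius_transformations"
    then obtain A where A: "det A > 0" "f = moebius_of A"
      by (auto simp: moebius_transformations_def)
    define k where "k = inverse (sqrt (det A))"
    have k: "k \<noteq> 0" using A by (simp add: k_def)
    have "det (k *\<^sub>R A) = k\<^sup>2 * det A"
      by (simp add: det_2 power2_eq_square algebra_simps)
    also have "\<dots> = 1" using A by (simp add: k_def power_inverse)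
    finally have "k *\<^sub>R A \<in> SL2" by (simp add: SL2_def)
    then show "f \<in> moebius_of ` SL2"
      using moebius_of_scale[OF k, of A] A(2) by (metis image_eqI)
  qed
qed

lemma openin_moebius_topology:
  "openin moebius_topology U \<longleftrightarrow> U \<subseteq> moebius_transformations \<and>
     openin (top_of_set SL2) {A \<in> SL2. moebius_of A \<in> U}"
proof -
  have "istopology (\<lambda>U. U \<subseteq> moebius_transformations \<and>
     openin (top_of_set SL2) {A \<in> SL2. moebius_of A \<in> U})"
    unfolding istopology_def
  proof (intro conjI allI impI)
    fix U V
    assume U: "U \<subseteq> moebius_transformations \<and> openin (top_of_set SL2) {A \<in> SL2. moebius_of A \<in> U}"
      and V: "V \<subseteq> moebius_transformations \<and> openin (top_of_set SL2) {A \<in> SL2. moebius_of A \<in> V}"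
    show "U \<inter> V \<subseteq> moebius_transformations" using U by blast
    have "{A \<in> SL2. moebius_of A \<in> U \<inter> V} =
        {A \<in> SL2. moebius_of A \<in> U} \<inter> {A \<in> SL2. moebius_of A \<in> V}" by blast
    then show "openin (top_of_set SL2) {A \<in> SL2. moebius_of A \<in> U \<inter> V}"
      using U V by (simp only: openin_Int)
  next
    fix K
    assume K: "\<forall>U\<in>K. U \<subseteq> moebius_transformations \<and>
      openin (top_of_set SL2) {A \<in> SL2. moebius_of A \<in> U}"
    then show "\<Union>K \<subseteq> moebius_transformations" by blast
    have "{A \<in> SL2. moebius_of A \<in> \<Union>K} = \<Union>((\<lambda>U. {A \<in> SL2. moebius_of A \<in> U}) ` K)" by blast
    then show "openin (top_of_set SL2) {A \<in> SL2. moebius_of A \<in> \<Union>K}"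
      using K by (auto intro!: openin_Union)
  qed
  then show ?thesis by (simp add: moebius_topology_def)
qed

lemma topspace_moebius_topology: "topspace moebius_topology = moebius_transformations"
proof -
  have "{A \<in> SL2. moebius_of A \<in> moebius_transformations} = SL2"
    by (auto simp: moebius_transformations_SL2)
  then have "openin moebius_topology moebius_transformations"
    by (simp add: openin_moebius_topology)
  then have "moebius_transformations \<subseteq> topspace moebius_topology" by (rule openin_subset)
  moreover have "topspace moebius_topology \<subseteq> moebius_transformations"
    using openin_topspace[of moebius_topology] unfolding openin_moebius_topology by (rule conjunct1)
  ultimately show ?thesis by (rule subset_antisym[rotated])
qed

lemma quotient_map_moebius_of: "quotient_map (top_of_set SL2) moebius_topology moebius_of"
  unfolding quotient_map_def topspace_moebius_topology openin_moebius_topology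
  by (auto simp: moebius_transformations_SL2)

lemma moebius_of_eq_imp:
  assumes A: "A \<in> SL2" and B: "B \<in> SL2" and eq: "moebius_of A = moebius_of B"
  shows "A = B \<or> A = - B"
proof -
  have all: "moebius_of A x = moebius_of B x" for x using eq by simp
  have dA: "A$1$1 * A$2$2 - A$1$2 * A$2$1 = 1" and dB: "B$1$1 * B$2$2 - B$1$2 * B$2$1 = 1"
    using A B by (simp_all add: SL2_def det_2)
  define p where "p = A$1$1 * B$2$2 - A$2$1 * B$1$2"
  \<comment> \<open>evaluate at \<open>\<infinity>\<close>, \<open>0\<close> and \<open>\<i>\<close>\<close>
  have 1: "A$1$1 * B$2$1 = B$1$1 * A$2$1"
  proof (cases "A$2$1 = 0 \<or> B$2$1 = 0")
    case True
    then show ?thesis using all[of None] by (auto simp: moebius_of_def Let_def split: if_splits)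
  next
    case False
    then have "complex_of_real (A$1$1 / A$2$1) = complex_of_real (B$1$1 / B$2$1)"
      using all[of None] by (simp add: moebius_of_def Let_def)
    then have "A$1$1 / A$2$1 = B$1$1 / B$2$1" by (simp only: of_real_eq_iff)
    then show ?thesis using False by (simp add: frac_eq_eq)
  qed
  have 2: "A$1$2 * B$2$2 = B$1$2 * A$2$2"
  proof (cases "A$2$2 = 0 \<or> B$2$2 = 0")
    case True
    then show ?thesis using all[of "Some 0"] by (auto simp: moebius_of_def Let_def split: if_splits)
  next
    case False
    then have "complex_of_real (A$1$2 / A$2$2) = complex_of_real (B$1$2 / B$2$2)"
      using all[of "Some 0"] by (simp add: moebius_of_def Let_def)
    then have "A$1$2 / A$2$2 = B$1$2 / B$2$2" by (simp only: of_real_eq_iff)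
    then show ?thesis using False by (simp add: frac_eq_eq)
  qed
  have nzA: "of_real (A$2$1) * \<i> + of_real (A$2$2) \<noteq> (0::complex)"
    using dA by (auto simp: complex_eq_iff)
  have nzB: "of_real (B$2$1) * \<i> + of_real (B$2$2) \<noteq> (0::complex)"
    using dB by (auto simp: complex_eq_iff)
  have "(of_real (A$1$1) * \<i> + of_real (A$1$2)) * (of_real (B$2$1) * \<i> + of_real (B$2$2)) =
        (of_real (B$1$1) * \<i> + of_real (B$1$2)) * (of_real (A$2$1) * \<i> + of_real (A$2$2))"
    using all[of "Some \<i>"] nzA nzB
    by (simp add: moebius_of_def Let_def frac_eq_eq)
  then have "Im ((of_real (A$1$1) * \<i> + of_real (A$1$2)) * (of_real (B$2$1) * \<i> + of_real (B$2$2))) =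
        Im ((of_real (B$1$1) * \<i> + of_real (B$1$2)) * (of_real (A$2$1) * \<i> + of_real (A$2$2)))"
    by (rule arg_cong)
  then have 3: "A$1$1 * B$2$2 + A$1$2 * B$2$1 = B$1$1 * A$2$2 + B$1$2 * A$2$1"
    by (simp add: algebra_simps)
  have "B$1$1 = (A$1$1 * A$2$2 - A$1$2 * A$2$1) * B$1$1" by (simp add: dA)
  also have "\<dots> = A$1$1 * (B$1$1 * A$2$2) - A$1$2 * (B$1$1 * A$2$1)" by (simp add: algebra_simps)
  also have "B$1$1 * A$2$2 = A$1$1 * B$2$2 + A$1$2 * B$2$1 - B$1$2 * A$2$1" using 3 by simp
  also have "A$1$1 * (A$1$1 * B$2$2 + A$1$2 * B$2$1 - B$1$2 * A$2$1) - A$1$2 * (B$1$1 * A$2$1) = p * A$1$1"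
    by (simp add: p_def algebra_simps flip: 1)
  finally have e11: "B$1$1 = p * A$1$1" .
  have "B$1$2 = (A$1$1 * A$2$2 - A$1$2 * A$2$1) * B$1$2" by (simp add: dA)
  also have "\<dots> = A$1$1 * (B$1$2 * A$2$2) - A$1$2 * A$2$1 * B$1$2" by (simp add: algebra_simps)
  also have "\<dots> = p * A$1$2" by (simp add: p_def algebra_simps flip: 2)
  finally have e12: "B$1$2 = p * A$1$2" .
  have "B$2$1 = (A$1$1 * A$2$2 - A$1$2 * A$2$1) * B$2$1" by (simp add: dA)
  also have "\<dots> = A$2$2 * (A$1$1 * B$2$1) - A$1$2 * A$2$1 * B$2$1" by (simp add: algebra_simps)
  also have "\<dots> = A$2$1 * (B$1$1 * A$2$2 - A$1$2 * B$2$1)" unfolding 1 by (simp add: algebra_simps)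
  also have "B$1$1 * A$2$2 - A$1$2 * B$2$1 = p" using 3 by (simp add: p_def algebra_simps)
  finally have e21: "B$2$1 = p * A$2$1" by simp
  have "B$2$2 = (A$1$1 * A$2$2 - A$1$2 * A$2$1) * B$2$2" by (simp add: dA)
  also have "\<dots> = A$1$1 * A$2$2 * B$2$2 - A$2$1 * (A$1$2 * B$2$2)" by (simp add: algebra_simps)
  also have "\<dots> = p * A$2$2" unfolding 2 by (simp add: p_def algebra_simps)
  finally have e22: "B$2$2 = p * A$2$2" .
  have "1 = p * p * (A$1$1 * A$2$2 - A$1$2 * A$2$1)"
    using dB unfolding e11 e12 e21 e22 by (simp add: algebra_simps)
  then have "p * p = 1" by (simp add: dA)
  then have "p = 1 \<or> p = -1" by (simp add: square_eq_1_iff)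
  then show ?thesis
    using e11 e12 e21 e22 by (force simp: vec_eq_iff forall_2)
qed

lemma tr_moebius_of:
  assumes "A \<in> SL2"
  shows "tr (moebius_of A) = \<bar>A$1$1 + A$2$2\<bar>"
  unfolding tr_def
proof (rule the_equality)
  show "\<exists>B\<in>SL2. moebius_of A = moebius_of B \<and> \<bar>A$1$1 + A$2$2\<bar> = \<bar>trace B\<bar>"
    using assms by (auto simp: trace_def sum_2)
next
  fix t assume "\<exists>B\<in>SL2. moebius_of A = moebius_of B \<and> t = \<bar>trace B\<bar>"
  then show "t = \<bar>A$1$1 + A$2$2\<bar>"
    using moebius_of_eq_imp[OF assms] by (fastforce simp: trace_def sum_2)
qed

end

theory Submission
  imports Defs
begin

text \<open>Lift \<open>f\<close> and \<open>g\<close> to matrices \<open>A\<close>, \<open>B\<close> in \<open>SL2\<close> with traces \<open>x, y \<ge> 2\<close> and put \<open>z = tr (A B)\<close>.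
  In a basis of dominant eigenvectors of \<open>A\<close> and \<open>B\<close> the off-diagonal entries \<open>k\<close>, \<open>k'\<close> have
  nonzero product. If \<open>k k' > 0\<close> (which for hyperbolic maps means \<open>C(f,g) < 1\<close>), the arc between
  the two eigendirections is mapped strictly inside itself by both maps, and this alone forces the
  semigroup to be semidiscrete and inverse free. If \<open>k k' < 0\<close> (\<open>C(f,g) > 1\<close>), then
  \<open>tr [A,B] > 2\<close> and \<open>2 z < x y\<close>. In this situation \<open>\<bar>z\<bar> < 2\<close> means that \<open>f g\<close> is elliptic;
  \<open>z \<le> -2\<close> yields explicit ping-pong intervals, bounded by the fixed points of the
  reflections in the factorisations \<open>A = R\<^sub>1 R\<^sub>2\<close>, \<open>B = R\<^sub>2 R\<^sub>3\<close>, where \<open>R\<^sub>2\<close> is proportional to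
  \<open>A B - B A\<close>; and for \<open>z \<ge> 2\<close> and \<open>x \<le> y\<close> the pair \<open>(A, A B)\<close> again satisfies both inequalities,
  while the larger trace drops by at least \<open>sqrt (tr [A,B] - 2)\<close>. The commutator trace is
  invariant, so after finitely many steps one reaches an elliptic element or a Schottky pair. The
  condition (a) turns out to be equivalent to \<open>z \<le> -2\<close> when \<open>f g\<close> is not elliptic.\<close>

section \<open>The real projective line\<close>

text \<open>The sign of \<open>z\<close> carries information only because both lifts are normalised
  to nonnegative trace: for the map \<open>f \<circ> g\<close> alone, \<open>z <= -2\<close> and
  \<open>z >= 2\<close> look the same. The reduction replaces (f, g) by (f, fg), but its outcome has
  to be carried back, and the semigroup generated by f and fg is in general smaller than the one
  generated by f and g. What is carried back is therefore a property of the generated group, which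
  such a move does not change: it is a Schottky group, discrete, and every word that equals the
  identity has exponent sums zero. This weak form of freeness already yields inverse freeness,
  because elements of the semigroup have words of positive total exponent. If f is parabolic, it
  keeps the smaller trace throughout, so the pairs visited are (f, f^n g); hence the products in
  (ii). For two hyperbolic maps the order of the traces can change, and (b) records a single move.
  Homogeneous coordinates remove the special role of infinity, and semidiscreteness is always
  witnessed by a neighbourhood of the identity prescribed by the images of finitely many points of
  the circle.\<close>

definition proj :: "complex \<times> complex \<Rightarrow> complex option" where
  "proj p = (if snd p = 0 then None else Some (fst p / snd p))"

definition rproj :: "real \<times> real \<Rightarrow> complex option" where
  "rproj v = proj (of_real (fst v), of_real (snd v))"

text \<open>The determinant with columns \<open>u\<close> and \<open>v\<close>: invariant under
  \<open>SL2\<close>, zero exactly when nonzero vectors span the same line, and with a sign that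
  records orientation.\<close>

definition cross :: "real \<times> real \<Rightarrow> real \<times> real \<Rightarrow> real" where
  "cross u v = fst u * snd v - snd u * fst v"

text \<open>Lets continuity and limits in the one-point compactification be proved for vectors, with
  no separate treatment of infinity.\<close>

lemma continuous_map_proj: "continuous_map (top_of_set (- {0})) sphere_topology proj"
  unfolding continuous_map_openin_preimage_eq
proof (intro conjI allI impI)
  show "proj \<in> topspace (top_of_set (- {0})) \<rightarrow> topspace sphere_topology"
    by (auto simp: proj_def)
next
  fix U assume U: "openin sphere_topology U"
  have chart: "open {p::complex \<times> complex. snd p \<noteq> 0 \<and> fst p / snd p \<in> V}" if V: "open V" for V
  proof -
    have "open {p::complex \<times> complex. snd p \<noteq> 0}"
      by (intro open_Collect_neq continuous_intros)
    moreover have "continuous_on {p::complex \<times> complex. snd p \<noteq> 0} (\<lambda>p. fst p / snd p)"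
      by (intro continuous_intros) auto
    ultimately have "open ((\<lambda>p. fst p / snd p) -` V \<inter> {p::complex \<times> complex. snd p \<noteq> 0})"
      using V continuous_on_open_vimage by blast
    then show ?thesis by (simp add: vimage_def Int_def conj_commute)
  qed
  consider V where "open V" "U = Some ` V"
    | C where "compact C" "U = insert None (Some ` (- C))"
    using U unfolding openin_Alexandroff_compactification
    by (auto simp: Compl_eq_Diff_UNIV)
  then show "openin (top_of_set (- {0})) (topspace (top_of_set (- {0})) \<inter> proj -` U)"
  proof cases
    case 1
    have "topspace (top_of_set (- {0})) \<inter> proj -` U =
        - {0} \<inter> {p. snd p \<noteq> 0 \<and> fst p / snd p \<in> V}"
      using 1 by (auto simp: proj_def split: if_splits)
    then show ?thesis using openin_open_Int[OF chart[OF 1(1)], of "- {0}"] by simp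
  next
    case 2
    obtain R where R: "\<And>z. z \<in> C \<Longrightarrow> norm z \<le> R" 
      using compact_imp_bounded[OF 2(1)] unfolding bounded_iff by blast
    \<comment> \<open>The vectors with \<open>snd p = 0\<close> lie outside the chart. This open
      cone contains them, as they are nonzero, and elsewhere on it the quotient has norm above
      \<open>R\<close> and so avoids \<open>C\<close>. The absolute value covers an empty
      \<open>C\<close>, where \<open>R\<close> may be negative.\<close>
    define W where "W = {p::complex \<times> complex. norm (fst p) > \<bar>R\<bar> * norm (snd p)}"
    have W: "open W" unfolding W_def by (intro open_Collect_less continuous_intros)
    have "topspace (top_of_set (- {0})) \<inter> proj -` U =
        - {0} \<inter> ({p. snd p \<noteq> 0 \<and> fst p / snd p \<in> - C} \<union> W)"
    proof (intro set_eqI iffI)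
      fix p :: "complex \<times> complex" assume "p \<in> topspace (top_of_set (- {0})) \<inter> proj -` U"
      then show "p \<in> - {0} \<inter> ({p. snd p \<noteq> 0 \<and> fst p / snd p \<in> - C} \<union> W)"
        using 2(2) by (cases p) (auto simp: proj_def W_def zero_prod_def split: if_splits)
    next
      fix p :: "complex \<times> complex"
      assume p: "p \<in> - {0} \<inter> ({p. snd p \<noteq> 0 \<and> fst p / snd p \<in> - C} \<union> W)"
      have "fst p / snd p \<notin> C" if "p \<in> W" "snd p \<noteq> 0"
      proof
        assume "fst p / snd p \<in> C"
        then have "norm (fst p) / norm (snd p) \<le> R" using R by (metis norm_divide)
        then have "norm (fst p) \<le> R * norm (snd p)" using that(2) by (simp add: divide_le_eq)
        also have "\<dots> \<le> \<bar>R\<bar> * norm (snd p)" by (intro mult_right_mono) auto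
        finally show False using that(1) by (simp add: W_def)
      qed
      then show "p \<in> topspace (top_of_set (- {0})) \<inter> proj -` U"
        using p 2(2) by (auto simp: proj_def)
    qed
    moreover have "open ({p. snd p \<noteq> 0 \<and> fst p / snd p \<in> - C} \<union> W)"
      using W chart[of "- C"] compact_imp_closed[OF 2(1)]
      by (intro open_Un) (simp_all only: open_Compl)
    ultimately show ?thesis by (simp only: openin_open_Int)
  qed
qed

lemma Hausdorff_sphere: "Hausdorff_space sphere_topology"
  by (simp add: Hausdorff_space_Alexandroff_compactification locally_compact_space_euclidean)

lemma Hausdorff_circle: "Hausdorff_space circle_topology"
  by (simp add: Hausdorff_space_subtopology Hausdorff_sphere)

lemma topspace_circle [simp]: "topspace circle_topology = extended_reals"
proof -
  have "x \<in> topspace sphere_topology" for x :: "complex option"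
    by (cases x) auto
  then show ?thesis by (simp only: topspace_subtopology) blast
qed

lemma rproj_in_extended_reals [simp]: "rproj v \<in> extended_reals"
  by (auto simp: rproj_def proj_def extended_reals_def simp flip: of_real_divide)

lemma continuous_map_rproj: "continuous_map (top_of_set (- {0})) circle_topology rproj"
proof -
  have "continuous_map (top_of_set (- {0})) (top_of_set (- {0}))
      (\<lambda>v::real\<times>real. (of_real (fst v) :: complex, of_real (snd v) :: complex))"
    by (auto simp: continuous_map_in_subtopology zero_prod_def prod_eq_iff intro!: continuous_intros)
  from continuous_map_compose[OF this continuous_map_proj]
  have "continuous_map (top_of_set (- {0})) sphere_topology rproj"
    by (simp add: o_def rproj_def[abs_def])
  then show ?thesis by (auto simp: continuous_map_in_subtopology)
qed

lemma rproj_surj: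
  assumes "x \<in> extended_reals" obtains v where "v \<noteq> 0" "x = rproj v"
proof (cases x)
  case None
  then have "x = rproj (1,0)" by (simp add: rproj_def proj_def)
  then show ?thesis using that[of "(1,0)"] by (simp add: zero_prod_def)
next
  case (Some z)
  then have "z \<in> \<real>" using assms by (auto simp: extended_reals_def)
  then have "x = rproj (Re z, 1)" using Some by (simp add: rproj_def proj_def complex_is_Real_iff complex_eq_iff)
  then show ?thesis using that[of "(Re z,1)"] by (simp add: zero_prod_def)
qed

lemma rproj_eq_iff:
  assumes "u \<noteq> 0" "v \<noteq> 0"
  shows "rproj u = rproj v \<longleftrightarrow> cross u v = 0"
proof -
  obtain a b c d where [simp]: "u = (a,b)" "v = (c,d)" by (metis surj_pair)
  show ?thesis
  proof (cases "b = 0 \<or> d = 0")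
    case True
    then show ?thesis using assms by (auto simp: rproj_def proj_def cross_def zero_prod_def)
  next
    case False
    then have "rproj u = rproj v \<longleftrightarrow> complex_of_real (a / b) = complex_of_real (c / d)"
      by (simp add: rproj_def proj_def)
    also have "\<dots> \<longleftrightarrow> a / b = c / d" by (simp only: of_real_eq_iff)
    also have "\<dots> \<longleftrightarrow> cross u v = 0" using False by (auto simp: cross_def field_simps)
    finally show ?thesis .
  qed
qed

text \<open>Cramer's rule without division. Its two coefficients are the factors in the definition
  of the arcs.\<close>

lemma cross_decompose:
  "cross u v *\<^sub>R w = cross w v *\<^sub>R u + cross u w *\<^sub>R v"
  by (simp add: cross_def prod_eq_iff algebra_simps)

lemma cross_add_left: "cross (u + v) w = cross u w + cross v w"
  and cross_add_right: "cross w (u + v) = cross w u + cross w v"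
  and cross_scale_left: "cross (r *\<^sub>R u) w = r * cross u w"
  and cross_scale_right: "cross w (r *\<^sub>R u) = r * cross w u"
  and cross_minus_left: "cross (- u) w = - cross u w"
  and cross_minus_right: "cross w (- u) = - cross w u"
  and cross_self: "cross u u = 0"
  and cross_swap: "cross v u = - cross u v"
  by (simp_all add: cross_def algebra_simps)

lemma cross_diff: "cross (u - v) w = cross u w - cross v w" "cross w (u - v) = cross w u - cross w v"
  by (simp_all add: cross_def algebra_simps)

lemmas cross_simps = cross_add_left cross_add_right cross_scale_left cross_scale_right
  cross_minus_left cross_minus_right cross_self

lemma cross_nz: "cross u v \<noteq> 0 \<Longrightarrow> u \<noteq> 0 \<and> v \<noteq> 0"
  by (auto simp: cross_def zero_prod_def)

text \<open>The defining product does not depend on the sign of \<open>w\<close>; the signs of \<open>u\<close> and \<open>v\<close> select one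
  of the two arcs between the corresponding lines.\<close>

definition open_arc :: "real \<times> real \<Rightarrow> real \<times> real \<Rightarrow> complex option set" where
  "open_arc u v = {rproj w | w. cross u w * cross w v > 0}"

definition closed_arc :: "real \<times> real \<Rightarrow> real \<times> real \<Rightarrow> complex option set" where
  "closed_arc u v = {rproj w | w. w \<noteq> 0 \<and> cross u w * cross w v \<ge> 0}"

lemma cross_sgn_cong:
  assumes "w \<noteq> 0" "w' \<noteq> 0" "cross w w' = 0"
  obtains r where "r \<noteq> 0" "w' = r *\<^sub>R w"
proof -
  obtain a b c d where [simp]: "w = (a,b)" "w' = (c,d)" by (metis surj_pair)
  show ?thesis
  proof (cases "a = 0")
    case True
    then have "b \<noteq> 0" "c = 0" using assms by (auto simp: cross_def zero_prod_def)
    then show ?thesis using that[of "d / b"] assms True by (auto simp: zero_prod_def)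
  next
    case False
    then have "d = c / a * b" using assms by (auto simp: cross_def field_simps)
    then show ?thesis using that[of "c / a"] assms False by (auto simp: zero_prod_def)
  qed
qed

text \<open>Another representative of the same point differs by a factor \<open>r\<close>, which
  enters the defining product as \<open>r\<^sup>2\<close>.\<close>

lemma rproj_in_arc_iff:
  assumes "w \<noteq> 0" shows "rproj w \<in> open_arc u v \<longleftrightarrow> cross u w * cross w v > 0"
proof
  assume "rproj w \<in> open_arc u v"
  then obtain w' where w': "rproj w = rproj w'" "cross u w' * cross w' v > 0"
    by (auto simp: open_arc_def)
  then have "w' \<noteq> 0" by (auto simp: cross_def zero_prod_def)
  then obtain r where r: "r \<noteq> 0" "w' = r *\<^sub>R w"
    using w'(1) assms rproj_eq_iff cross_sgn_cong by metis
  have "r\<^sup>2 * (cross u w * cross w v) > 0" using w'(2) r(2)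
    by (simp add: cross_simps power2_eq_square mult_ac)
  then show "cross u w * cross w v > 0" using r(1) by (simp add: zero_less_mult_iff)
qed (unfold open_arc_def, blast)

lemma rproj_in_closed_arc_iff:
  assumes "w \<noteq> 0" shows "rproj w \<in> closed_arc u v \<longleftrightarrow> cross u w * cross w v \<ge> 0"
proof
  assume "rproj w \<in> closed_arc u v"
  then obtain w' where w': "rproj w = rproj w'" "w' \<noteq> 0" "cross u w' * cross w' v \<ge> 0"
    by (auto simp: closed_arc_def)
  then obtain r where r: "r \<noteq> 0" "w' = r *\<^sub>R w"
    using w'(1) assms rproj_eq_iff cross_sgn_cong by metis
  have "r\<^sup>2 * (cross u w * cross w v) \<ge> 0" using w'(3) r(2)
    by (simp add: cross_simps power2_eq_square mult_ac)
  then show "cross u w * cross w v \<ge> 0" using r(1) by (simp add: zero_le_mult_iff)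
qed (unfold closed_arc_def, use assms in blast)

lemma arc_subset_extended_reals: "open_arc u v \<subseteq> extended_reals"
  and closed_arc_subset_extended_reals: "closed_arc u v \<subseteq> extended_reals"
  by (auto simp: open_arc_def closed_arc_def)

text \<open>Negating one end vector keeps the endpoint but reverses the sign of the defining
  product, and so selects the other arc.\<close>

lemma extended_reals_minus_closed_arc: "extended_reals - closed_arc u v = open_arc u (- v)"
proof (intro set_eqI iffI)
  fix x assume x: "x \<in> extended_reals - closed_arc u v"
  then obtain w where "w \<noteq> 0" "x = rproj w" using rproj_surj by blast
  then show "x \<in> open_arc u (- v)"
    using x by (auto simp: rproj_in_arc_iff rproj_in_closed_arc_iff cross_simps)
next
  fix x assume x: "x \<in> open_arc u (- v)"
  then obtain w where "w \<noteq> 0" "x = rproj w"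
    using rproj_surj arc_subset_extended_reals by blast
  then show "x \<in> extended_reals - closed_arc u v"
    using x by (auto simp: rproj_in_arc_iff rproj_in_closed_arc_iff cross_simps)
qed

lemma cross_segment:
  fixes u v :: "real \<times> real"
  shows "cross u ((1 - t) *\<^sub>R u + t *\<^sub>R v) = t * cross u v"
  and "cross ((1 - t) *\<^sub>R u + t *\<^sub>R v) v = (1 - t) * cross u v"
  by (simp_all add: cross_simps)

lemma segment_nonzero:
  assumes "cross u v \<noteq> 0" shows "(1 - t) *\<^sub>R u + t *\<^sub>R v \<noteq> 0"
proof
  assume "(1 - t) *\<^sub>R u + t *\<^sub>R v = 0"
  then have "t * cross u v = 0" "(1 - t) * cross u v = 0"
  using cross_segment[where u=u and v=v and t=t] by (auto simp: cross_def zero_prod_def)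
  then show False using assms by auto
qed

text \<open>By \<open>cross_decompose\<close> a representative of a point of the arc is a
  combination of \<open>u\<close> and \<open>v\<close> with coefficients of equal sign; rescaling
  makes it convex. Compactness, connectedness and closures are then inherited from
  intervals.\<close>

lemma arc_eq_image:
  assumes "cross u v \<noteq> 0"
  shows "open_arc u v = rproj ` (\<lambda>t. (1 - t) *\<^sub>R u + t *\<^sub>R v) ` {0<..<1}"
    and "closed_arc u v = rproj ` (\<lambda>t. (1 - t) *\<^sub>R u + t *\<^sub>R v) ` {0..1}"
proof -
  let ?D = "cross u v"
  have main: "\<exists>t. rproj w = rproj ((1 - t) *\<^sub>R u + t *\<^sub>R v) \<and> 0 \<le> t \<and> t \<le> 1 \<and>
      (cross u w * cross w v > 0 \<longrightarrow> 0 < t \<and> t < 1)"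
    if w: "w \<noteq> 0" "cross u w * cross w v \<ge> 0" for w
  proof -
    define s where "s = cross u w" define r where "r = cross w v"
    have sr: "s * r \<ge> 0" using w by (simp add: s_def r_def)
    have nz: "s \<noteq> 0 \<or> r \<noteq> 0"
    proof (rule ccontr)
      assume "\<not> (s \<noteq> 0 \<or> r \<noteq> 0)"
      then have "?D *\<^sub>R w = 0" using cross_decompose[of u v w] by (simp add: s_def r_def)
      then show False using assms w by simp
    qed
    then have "s + r \<noteq> 0" using sr by (auto simp: zero_le_mult_iff)
    define t where "t = s / (s + r)"
    have t: "0 \<le> t" "t \<le> 1" "s * r > 0 \<Longrightarrow> 0 < t \<and> t < 1"
      using sr nz \<open>s + r \<noteq> 0\<close>
      by (auto simp: t_def zero_le_mult_iff zero_less_mult_iff divide_simps)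
    have "(s + r) *\<^sub>R ((1 - t) *\<^sub>R u + t *\<^sub>R v) = r *\<^sub>R u + s *\<^sub>R v"
    proof -
      have "(s + r) * (1 - t) = r" "(s + r) * t = s"
        using \<open>s + r \<noteq> 0\<close> by (simp_all add: t_def field_simps)
      then show ?thesis by (simp add: scaleR_add_right)
    qed
    also have "\<dots> = ?D *\<^sub>R w" using cross_decompose[of u v w] by (simp add: s_def r_def)
    finally have "(s + r) * cross w ((1 - t) *\<^sub>R u + t *\<^sub>R v) = 0"
      by (metis cross_scale_right cross_self mult_zero_right)
    then have "cross w ((1 - t) *\<^sub>R u + t *\<^sub>R v) = 0" using \<open>s + r \<noteq> 0\<close> by simp
    then show ?thesis using t rproj_eq_iff[OF w(1) segment_nonzero[OF assms]]
      unfolding s_def r_def by blast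
  qed
  have pos: "cross u ((1 - t) *\<^sub>R u + t *\<^sub>R v) * cross ((1 - t) *\<^sub>R u + t *\<^sub>R v) v = (t * (1 - t)) * ?D\<^sup>2" for t
    unfolding cross_segment by (simp add: power2_eq_square mult_ac)
  show "open_arc u v = rproj ` (\<lambda>t. (1 - t) *\<^sub>R u + t *\<^sub>R v) ` {0<..<1}"
  proof (intro subset_antisym subsetI)
    fix x assume "x \<in> open_arc u v"
    then obtain w where w: "x = rproj w" "cross u w * cross w v > 0" by (auto simp: open_arc_def)
    then have "w \<noteq> 0" by (auto simp: cross_def zero_prod_def)
    then show "x \<in> rproj ` (\<lambda>t. (1 - t) *\<^sub>R u + t *\<^sub>R v) ` {0<..<1}"
      using main[of w] w by fastforce
  qed (use pos segment_nonzero[OF assms] assms in \<open>auto simp: rproj_in_arc_iff\<close>)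
  show "closed_arc u v = rproj ` (\<lambda>t. (1 - t) *\<^sub>R u + t *\<^sub>R v) ` {0..1}"
  proof (intro subset_antisym subsetI)
    fix x assume "x \<in> closed_arc u v"
    then obtain w where w: "x = rproj w" "w \<noteq> 0" "cross u w * cross w v \<ge> 0"
      by (auto simp: closed_arc_def)
    then show "x \<in> rproj ` (\<lambda>t. (1 - t) *\<^sub>R u + t *\<^sub>R v) ` {0..1}"
      using main[of w] by fastforce
  qed (use pos segment_nonzero[OF assms] assms in \<open>auto simp: rproj_in_closed_arc_iff\<close>)
qed

lemma continuous_map_segment:
  assumes "cross u v \<noteq> 0"
  shows "continuous_map euclidean circle_topology (\<lambda>t. rproj ((1 - t) *\<^sub>R u + t *\<^sub>R v))"
proof -
  have "continuous_map euclidean (top_of_set (- {0})) (\<lambda>t. (1 - t) *\<^sub>R u + t *\<^sub>R v)"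
    using segment_nonzero[OF assms]
    by (auto simp: continuous_map_in_subtopology intro!: continuous_intros)
  from continuous_map_compose[OF this continuous_map_rproj] show ?thesis by (simp add: o_def)
qed

lemma closedin_closed_arc:
  assumes "cross u v \<noteq> 0" shows "closedin circle_topology (closed_arc u v)"
  unfolding arc_eq_image(2)[OF assms] image_image
  by (intro compactin_imp_closedin[OF Hausdorff_circle] image_compactin[OF _ continuous_map_segment[OF assms]])
     (simp)

lemma openin_arc:
  assumes "cross u v \<noteq> 0" shows "openin circle_topology (open_arc u v)"
proof -
  have "open_arc u v = topspace circle_topology - closed_arc u (- v)"
    using extended_reals_minus_closed_arc[of u "- v"] by (simp only: topspace_circle minus_minus)
  then show ?thesis
    using openin_diff[OF openin_topspace closedin_closed_arc[of u "- v"]] assms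
    by (simp only: cross_simps neg_equal_0_iff_equal not_False_eq_True)
qed

lemma closure_of_arc:
  assumes "cross u v \<noteq> 0" shows "circle_topology closure_of (open_arc u v) = closed_arc u v"
proof
  show "circle_topology closure_of (open_arc u v) \<subseteq> closed_arc u v"
    using closedin_closed_arc[OF assms] arc_eq_image[OF assms]
    by (intro closure_of_minimal) auto
  have "(\<lambda>t. rproj ((1 - t) *\<^sub>R u + t *\<^sub>R v)) ` (euclidean closure_of {0<..<1::real})
     \<subseteq> circle_topology closure_of ((\<lambda>t. rproj ((1 - t) *\<^sub>R u + t *\<^sub>R v)) ` {0<..<1})"
    by (rule continuous_map_image_closure_subset[OF continuous_map_segment[OF assms]])
  then show "closed_arc u v \<subseteq> circle_topology closure_of (open_arc u v)"
    by (simp add: arc_eq_image[OF assms] image_image)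
qed

lemma endpoint_notin_arc: "u \<noteq> 0 \<Longrightarrow> rproj u \<notin> open_arc u v" "v \<noteq> 0 \<Longrightarrow> rproj v \<notin> open_arc u v"
  by (simp_all add: rproj_in_arc_iff cross_simps)

lemma open_interval_arc:
  assumes "cross u v \<noteq> 0" shows "open_interval (open_arc u v)"
proof -
  have "connectedin circle_topology (open_arc u v)"
    unfolding arc_eq_image(1)[OF assms] image_image
    by (intro connectedin_continuous_map_image[OF continuous_map_segment[OF assms]]) simp
  moreover have "open_arc u v \<noteq> {}" by (simp add: arc_eq_image[OF assms])
  moreover have "open_arc u v \<noteq> extended_reals"
    using endpoint_notin_arc(1) cross_nz[OF assms] rproj_in_extended_reals by metis
  ultimately show ?thesis using openin_arc[OF assms] by (simp add: open_interval_def)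
qed

lemma closed_interval_closed_arc:
  assumes "cross u v \<noteq> 0" shows "closed_interval (closed_arc u v)"
proof -
  have nz: "u \<noteq> 0" "v \<noteq> 0" using cross_nz[OF assms] by auto
  have "connectedin circle_topology (closed_arc u v)"
    unfolding arc_eq_image(2)[OF assms] image_image
    by (intro connectedin_continuous_map_image[OF continuous_map_segment[OF assms]]) simp
  moreover have uv: "rproj u \<in> closed_arc u v" "rproj v \<in> closed_arc u v" "rproj u \<noteq> rproj v"
    using nz assms by (auto simp: rproj_in_closed_arc_iff rproj_eq_iff cross_simps)
  moreover have "closed_arc u v \<noteq> extended_reals"
  proof -
    have "open_arc u (- v) \<noteq> {}" using assms by (simp add: arc_eq_image cross_simps)
    then show ?thesis using extended_reals_minus_closed_arc[of u v] by auto
  qed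
  ultimately show ?thesis using closedin_closed_arc[OF assms] unfolding closed_interval_def
    by (metis empty_iff singletonD)
qed

section \<open>Matrices acting on the sphere\<close>

definition app :: "real^2^2 \<Rightarrow> real \<times> real \<Rightarrow> real \<times> real" where
  "app A v = (A$1$1 * fst v + A$1$2 * snd v, A$2$1 * fst v + A$2$2 * snd v)"

text \<open>Complex coordinates alongside the real \<open>app\<close>, since composition,
  ellipticity and attraction involve non-real points too.\<close>

definition capp :: "real^2^2 \<Rightarrow> complex \<times> complex \<Rightarrow> complex \<times> complex" where
  "capp A p = (of_real (A$1$1) * fst p + of_real (A$1$2) * snd p,
               of_real (A$2$1) * fst p + of_real (A$2$2) * snd p)"

definition adj :: "real^2^2 \<Rightarrow> real^2^2" where
  "adj A = vector [vector [A$2$2, - A$1$2], vector [- A$2$1, A$1$1]]"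

lemma SL2_iff: "A \<in> SL2 \<longleftrightarrow> A$1$1 * A$2$2 - A$1$2 * A$2$1 = 1"
  by (simp add: SL2_def det_2)

lemma matrix2_eq_iff:
  "A = B \<longleftrightarrow> A$1$1 = B$1$1 \<and> A$1$2 = B$1$2 \<and> A$2$1 = B$2$1 \<and> A$2$2 = (B$2$2 :: real)"
  for A B :: "real^2^2"
  by (auto simp: vec_eq_iff forall_2)

lemma adj_nth [simp]:
  "adj A $ 1 $ 1 = A$2$2" "adj A $ 1 $ 2 = - A$1$2" "adj A $ 2 $ 1 = - A$2$1" "adj A $ 2 $ 2 = A$1$1"
  by (simp_all add: adj_def)

lemma mat_nth [simp]:
  "(mat k :: real^2^2) $ 1 $ 1 = k" "(mat k :: real^2^2) $ 1 $ 2 = 0"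
  "(mat k :: real^2^2) $ 2 $ 1 = 0" "(mat k :: real^2^2) $ 2 $ 2 = k"
  by (simp_all add: mat_def)

lemma mult_nth:
  "(A ** B) $ i $ j = A$i$1 * B$1$j + A$i$2 * B$2$j" for A B :: "real^2^2"
  by (simp add: matrix_matrix_mult_def sum_2)

lemma adj_SL2: "A \<in> SL2 \<Longrightarrow> adj A \<in> SL2"
  by (simp add: SL2_iff mult.commute)

lemma mult_SL2: "A \<in> SL2 \<Longrightarrow> B \<in> SL2 \<Longrightarrow> A ** B \<in> SL2"
  by (simp add: SL2_def det_mul)

lemma mult_adj: "A \<in> SL2 \<Longrightarrow> A ** adj A = mat 1" "A \<in> SL2 \<Longrightarrow> adj A ** A = mat 1"
  by (auto simp: matrix2_eq_iff mult_nth SL2_iff algebra_simps)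

lemma moebius_of_proj: "p \<noteq> 0 \<Longrightarrow> moebius_of A (proj p) = proj (capp A p)"
  by (cases p) (auto simp: moebius_of_def proj_def capp_def Let_def zero_prod_def divide_simps)

lemma proj_surj: obtains p where "p \<noteq> 0" "x = proj p"
proof (cases x)
  case None
  then show ?thesis using that[of "(1,0)"] by (simp add: proj_def zero_prod_def)
next
  case (Some z)
  then show ?thesis using that[of "(z,1)"] by (simp add: proj_def zero_prod_def)
qed

lemma capp_nonzero:
  assumes "A \<in> SL2" "p \<noteq> 0" shows "capp A p \<noteq> 0"
proof
  obtain z w where p: "p = (z, w)" by fastforce
  let ?a = "complex_of_real (A$1$1)" and ?b = "complex_of_real (A$1$2)"
    and ?c = "complex_of_real (A$2$1)" and ?d = "complex_of_real (A$2$2)"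
  assume "capp A p = 0"
  then have 0: "?a * z + ?b * w = 0" "?c * z + ?d * w = 0"
    by (auto simp: capp_def p zero_prod_def)
  have D: "?a * ?d - ?b * ?c = 1"
    using arg_cong[OF assms(1)[unfolded SL2_iff], of complex_of_real] by simp
  have "(?a * ?d - ?b * ?c) * z = ?d * (?a * z + ?b * w) - ?b * (?c * z + ?d * w)"
    "(?a * ?d - ?b * ?c) * w = ?a * (?c * z + ?d * w) - ?c * (?a * z + ?b * w)"
    by (simp_all add: algebra_simps)
  then show False using assms(2) unfolding D 0 by (simp add: p zero_prod_def)
qed

lemma capp_mult: "capp (A ** B) p = capp A (capp B p)"
  by (simp add: capp_def mult_nth algebra_simps)

lemma moebius_of_mult:
  assumes "B \<in> SL2" shows "moebius_of (A ** B) = moebius_of A \<circ> moebius_of B"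
proof
  fix x
  obtain p where "p \<noteq> 0" "x = proj p" by (rule proj_surj)
  then show "moebius_of (A ** B) x = (moebius_of A \<circ> moebius_of B) x"
    using capp_nonzero[OF assms] by (simp add: moebius_of_proj capp_mult)
qed

lemma moebius_of_mat_1: "moebius_of (mat 1) = id"
proof
  fix x
  obtain p where "p \<noteq> 0" "x = proj p" by (rule proj_surj)
  then show "moebius_of (mat 1) x = id x"
    by (simp add: moebius_of_proj capp_def)
qed

lemma mat_1_SL2 [simp]: "mat 1 \<in> SL2"
  by (simp add: SL2_def)

lemma moebius_of_adj:
  assumes "A \<in> SL2"
  shows "moebius_of A \<circ> moebius_of (adj A) = id" "moebius_of (adj A) \<circ> moebius_of A = id"
  using assms by (simp_all add: moebius_of_mult[symmetric] adj_SL2 mult_adj moebius_of_mat_1)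

lemma bij_moebius_of: "A \<in> SL2 \<Longrightarrow> bij (moebius_of A)"
  using moebius_of_adj o_bij by blast

lemma inv_moebius_of: "A \<in> SL2 \<Longrightarrow> inv (moebius_of A) = moebius_of (adj A)"
  using moebius_of_adj by (intro inv_unique_comp) auto

lemma moebius_of_minus: "moebius_of (- A) = moebius_of A"
  using moebius_of_scale[of "-1" A] by simp

text \<open>The lift is unique only up to sign. Nonnegative trace makes \<open>tr\<close> the trace
  itself and places parabolic maps at trace 2 instead of 2 or -2.\<close>

lemma moebius_lift:
  assumes "f \<in> moebius_transformations"
  obtains A where "A \<in> SL2" "f = moebius_of A" "A$1$1 + A$2$2 \<ge> 0"
proof -
  obtain A where A: "A \<in> SL2" "f = moebius_of A"
    using assms by (auto simp: moebius_transformations_SL2)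
  show ?thesis
  proof (cases "A$1$1 + A$2$2 \<ge> 0")
    case False
    then show ?thesis using A that[of "- A"] by (simp add: SL2_iff moebius_of_minus)
  qed (use A that in blast)
qed

lemma moebius_of_in [simp]: "A \<in> SL2 \<Longrightarrow> moebius_of A \<in> moebius_transformations"
  by (auto simp: moebius_transformations_SL2)

lemma moebius_of_rproj: "v \<noteq> 0 \<Longrightarrow> moebius_of A (rproj v) = rproj (app A v)"
  using moebius_of_proj[of "(of_real (fst v), of_real (snd v))" A]
  by (simp add: rproj_def app_def capp_def zero_prod_def prod_eq_iff)

lemma app_linear: "app A (u + v) = app A u + app A v" "app A (r *\<^sub>R v) = r *\<^sub>R app A v"
  "app A (- v) = - app A v"
  by (simp_all add: app_def algebra_simps prod_eq_iff)

lemma app_mult: "app (A ** B) v = app A (app B v)"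
  by (simp add: app_def mult_nth algebra_simps)

lemma app_mat_1 [simp]: "app (mat 1) v = v"
  by (simp add: app_def)

lemma cross_app:
  assumes "A \<in> SL2" shows "cross (app A u) (app A v) = cross u v"
proof -
  have "cross (app A u) (app A v) = (A$1$1 * A$2$2 - A$1$2 * A$2$1) * cross u v"
    by (simp add: cross_def app_def algebra_simps)
  then show ?thesis using assms by (simp add: SL2_iff)
qed

lemma app_adj: "A \<in> SL2 \<Longrightarrow> app A (app (adj A) v) = v" "A \<in> SL2 \<Longrightarrow> app (adj A) (app A v) = v"
  by (simp_all add: app_mult[symmetric] mult_adj)

lemma app_nonzero: "A \<in> SL2 \<Longrightarrow> v \<noteq> 0 \<Longrightarrow> app A v \<noteq> 0"
  using app_adj(2)[of A v] by (auto simp: app_def zero_prod_def)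

lemma moebius_of_image_arc:
  assumes "A \<in> SL2"
  shows "moebius_of A ` open_arc u v = open_arc (app A u) (app A v)"
    and "moebius_of A ` closed_arc u v = closed_arc (app A u) (app A v)"
proof -
  have *: "cross (app A u) w * cross w (app A v) = cross u (app (adj A) w) * cross (app (adj A) w) v" for w
    using cross_app[OF assms] app_adj(1)[OF assms] by metis
  show "moebius_of A ` open_arc u v = open_arc (app A u) (app A v)"
  proof (intro subset_antisym subsetI)
    fix x assume "x \<in> moebius_of A ` open_arc u v"
    then obtain w where w: "x = moebius_of A (rproj w)" "cross u w * cross w v > 0"
      by (auto simp: open_arc_def)
    then have "w \<noteq> 0" by (auto simp: cross_def zero_prod_def)
    then show "x \<in> open_arc (app A u) (app A v)"
      using w assms by (simp add: moebius_of_rproj rproj_in_arc_iff app_nonzero cross_app)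
  next
    fix x assume "x \<in> open_arc (app A u) (app A v)"
    then obtain w where w: "x = rproj w" "cross (app A u) w * cross w (app A v) > 0"
      by (auto simp: open_arc_def)
    then have nz: "w \<noteq> 0" by (auto simp: cross_def zero_prod_def)
    then have "app (adj A) w \<noteq> 0" using adj_SL2[OF assms] by (simp add: app_nonzero)
    then have "x = moebius_of A (rproj (app (adj A) w))" "rproj (app (adj A) w) \<in> open_arc u v"
      using w assms * by (simp_all add: moebius_of_rproj app_adj rproj_in_arc_iff)
    then show "x \<in> moebius_of A ` open_arc u v" by blast
  qed
  show "moebius_of A ` closed_arc u v = closed_arc (app A u) (app A v)"
  proof (intro subset_antisym subsetI)
    fix x assume "x \<in> moebius_of A ` closed_arc u v"
    then obtain w where w: "x = moebius_of A (rproj w)" "w \<noteq> 0" "cross u w * cross w v \<ge> 0"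
      by (auto simp: closed_arc_def)
    then show "x \<in> closed_arc (app A u) (app A v)"
      using w assms by (simp add: moebius_of_rproj rproj_in_closed_arc_iff app_nonzero cross_app)
  next
    fix x assume "x \<in> closed_arc (app A u) (app A v)"
    then obtain w where w: "x = rproj w" "w \<noteq> 0" "cross (app A u) w * cross w (app A v) \<ge> 0"
      by (auto simp: closed_arc_def)
    then have "app (adj A) w \<noteq> 0" using adj_SL2[OF assms] by (simp add: app_nonzero)
    then have "x = moebius_of A (rproj (app (adj A) w))" "rproj (app (adj A) w) \<in> closed_arc u v"
      using w assms * by (simp_all add: moebius_of_rproj app_adj rproj_in_closed_arc_iff)
    then show "x \<in> moebius_of A ` closed_arc u v" by blast
  qed
qed

lemma moebius_of_fixes_rproj:
  assumes "A \<in> SL2" "v \<noteq> 0"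
  shows "moebius_of A (rproj v) = rproj v \<longleftrightarrow> cross v (app A v) = 0"
  using assms rproj_eq_iff[of "app A v" v] cross_swap[of v "app A v"]
  by (auto simp: moebius_of_rproj app_nonzero)

text \<open>Evaluation at a point of the circle is continuous. All neighbourhoods of the identity
  used to prove semidiscreteness are finite intersections of such sets.\<close>

lemma openin_moebius_preimage:
  assumes "v \<noteq> 0" "openin circle_topology W"
  shows "openin moebius_topology {h \<in> moebius_transformations. h (rproj v) \<in> W}"
proof -
  have "continuous_on SL2 (\<lambda>A. app A v)"
    unfolding app_def by (intro continuous_intros)
  then have "continuous_map (top_of_set SL2) (top_of_set (- {0})) (\<lambda>A. app A v)"
    using app_nonzero assms(1) by (auto simp: continuous_map_in_subtopology)
  from continuous_map_compose[OF this continuous_map_rproj]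
  have "continuous_map (top_of_set SL2) circle_topology (\<lambda>A. rproj (app A v))"
    by (simp add: o_def)
  from openin_continuous_map_preimage[OF this assms(2)]
  have "openin (top_of_set SL2) {A \<in> SL2. rproj (app A v) \<in> W}" by simp
  moreover have "{A \<in> SL2. moebius_of A \<in> {h \<in> moebius_transformations. h (rproj v) \<in> W}} =
      {A \<in> SL2. rproj (app A v) \<in> W}"
    using assms(1) by (auto simp: moebius_of_rproj)
  ultimately show ?thesis unfolding openin_moebius_topology by auto
qed

section \<open>Eigenvectors and the classification by the trace\<close>

lemma app_kernel:
  assumes "det A = 0" obtains v where "v \<noteq> 0" "app A v = 0"
proof -
  have D: "A$1$1 * A$2$2 = A$1$2 * A$2$1" using assms by (simp add: det_2)
  consider "(- A$1$2, A$1$1) \<noteq> 0" | "(- A$2$2, A$2$1) \<noteq> 0"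
    | "A$1$2 = 0" "A$1$1 = 0" "A$2$1 = 0" "A$2$2 = 0"
    by (auto simp: zero_prod_def)
  then show ?thesis
  proof cases
    case 1
    moreover have "app A (- A$1$2, A$1$1) = 0" using D by (simp add: app_def zero_prod_def algebra_simps)
    ultimately show ?thesis by (rule that)
  next
    case 2
    moreover have "app A (- A$2$2, A$2$1) = 0" using D by (simp add: app_def zero_prod_def algebra_simps)
    ultimately show ?thesis by (rule that)
  next
    case 3 then show ?thesis using that[of "(1,0)"] by (simp add: app_def zero_prod_def)
  qed
qed

lemma eigenvector_exists:
  assumes "r\<^sup>2 - (A$1$1 + A$2$2) * r + det A = 0"
  obtains v where "v \<noteq> 0" "app A v = r *\<^sub>R v"
proof -
  have "det (A - mat r) = 0" using assms by (simp add: det_2 power2_eq_square algebra_simps)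
  then obtain v where "v \<noteq> 0" "app (A - mat r) v = 0" using app_kernel by blast
  moreover from this have "app A v = r *\<^sub>R v"
    by (simp add: app_def zero_prod_def algebra_simps prod_eq_iff)
  ultimately show ?thesis by (intro that)
qed

lemma dominant_eigenvector:
  assumes "A \<in> SL2" "A$1$1 + A$2$2 \<ge> 2"
  obtains e l where "e \<noteq> 0" "l \<ge> 1" "A$1$1 + A$2$2 = l + 1 / l" "app A e = l *\<^sub>R e"
proof -
  define t where "t = A$1$1 + A$2$2"
  define r where "r = sqrt (t\<^sup>2 - 4)"
  define l where "l = (t + r) / 2"
  have t: "t \<ge> 2" using assms by (simp add: t_def)
  then have "t\<^sup>2 \<ge> 2\<^sup>2" by (intro power_mono) auto
  then have r: "r \<ge> 0" "r\<^sup>2 = t\<^sup>2 - 4" by (auto simp: r_def)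
  then have "l \<ge> 1" using t by (simp add: l_def)
  have eq: "l\<^sup>2 - t * l + 1 = 0"
    using r(2) by (simp add: l_def field_simps power2_eq_square)
  then have "t = l + 1 / l" using \<open>l \<ge> 1\<close> by (simp add: field_simps power2_eq_square)
  moreover obtain e where "e \<noteq> 0" "app A e = l *\<^sub>R e"
    using eigenvector_exists[of l A] eq assms(1) by (auto simp: t_def SL2_def)
  ultimately show ?thesis using that \<open>l \<ge> 1\<close> by (simp add: t_def)
qed

lemma basis_decompose:
  assumes "cross u v \<noteq> 0"
  obtains r s where "w = r *\<^sub>R u + s *\<^sub>R v"
proof -
  have "w = (1 / cross u v) *\<^sub>R (cross u v *\<^sub>R w)" using assms by simp
  also have "\<dots> = (cross w v / cross u v) *\<^sub>R u + (cross u w / cross u v) *\<^sub>R v"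
    by (simp add: cross_decompose[of u v w] scaleR_add_right)
  finally show ?thesis using that by blast
qed

text \<open>\<open>A\<close> is triangular in the basis \<open>e\<close>, \<open>u\<close>, and
  determinant 1 fixes the other diagonal entry. Only \<open>k\<close> remains free; its sign tells
  through which of the two arcs \<open>u\<close> is pushed towards \<open>e\<close>.\<close>

lemma complement_eigenvector:
  assumes "A \<in> SL2" "app A e = l *\<^sub>R e" "l \<noteq> 0" "cross e u \<noteq> 0"
  obtains k where "app A u = (1 / l) *\<^sub>R u + k *\<^sub>R e"
proof -
  obtain k s where ks: "app A u = k *\<^sub>R e + s *\<^sub>R u" using basis_decompose[OF assms(4)] .
  have "cross e u = cross (app A e) (app A u)" using cross_app[OF assms(1)] by simp
  also have "\<dots> = l * s * cross e u" unfolding ks assms(2) by (simp add: cross_simps)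
  finally have "s = 1 / l" using assms(3,4) by (simp add: field_simps)
  then have "app A u = (1 / l) *\<^sub>R u + k *\<^sub>R e" using ks by (simp only: add.commute)
  then show ?thesis by (rule that)
qed

lemma tr_eq: "A \<in> SL2 \<Longrightarrow> A$1$1 + A$2$2 \<ge> 0 \<Longrightarrow> tr (moebius_of A) = A$1$1 + A$2$2"
  by (simp add: tr_moebius_of)

lemma exists_transversal: 
  assumes "e \<noteq> 0" obtains u where "cross e u \<noteq> 0"
proof
  have "(fst e)\<^sup>2 + (snd e)\<^sup>2 \<noteq> 0"
    using assms by (auto simp: prod_eq_iff)
  then show "cross e (- snd e, fst e) \<noteq> 0"
    by (simp add: cross_def power2_eq_square)
qed

lemma diff_inverse_pos: "l > 1 \<Longrightarrow> l - 1 / l > (0::real)"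
  using less_1_mult[of l l] by (simp add: field_simps)

text \<open>The quadratic form vanishing on fixed lines, split into linear factors:
  \<open>s = 0\<close> is the line of \<open>e\<close>, the other factor gives the second fixed
  point.\<close>

lemma cross_app_fixed_basis:
  assumes "app A e = l *\<^sub>R e" "app A u = (1 / l) *\<^sub>R u + k *\<^sub>R e"
  shows "cross (r *\<^sub>R e + s *\<^sub>R u) (app A (r *\<^sub>R e + s *\<^sub>R u)) =
    - s * cross e u * (r * (l - 1 / l) + s * k)"
  using cross_swap[of u e]
  by (simp add: app_linear assms cross_simps algebra_simps)

text \<open>The left side is the discriminant of the fixed point equation, so the trace alone
  decides whether fixed points are real.\<close>

lemma discriminant: "A \<in> SL2 \<Longrightarrow>
   (A$2$2 - A$1$1)\<^sup>2 + 4 * A$1$2 * A$2$1 = (A$1$1 + A$2$2)\<^sup>2 - 4"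
  by (simp add: SL2_iff power2_eq_square algebra_simps)

lemma no_real_fixpoint:
  assumes "A \<in> SL2" "\<bar>A$1$1 + A$2$2\<bar> < 2" "x \<in> extended_reals"
  shows "moebius_of A x \<noteq> x"
proof
  assume fx: "moebius_of A x = x"
  obtain v where v: "v \<noteq> 0" "x = rproj v" using assms(3) rproj_surj by blast
  obtain p q where pq: "v = (p, q)" by fastforce
  define m where "m = A$2$2 - A$1$1"
  define D where "D = 4 - (A$1$1 + A$2$2)\<^sup>2"
  have "(A$1$1 + A$2$2)\<^sup>2 < 2\<^sup>2"
    using assms(2) by (metis abs_ge_zero power2_abs power_strict_mono zero_less_numeral)
  then have D: "D > 0" by (simp add: D_def)
  have mD: "m\<^sup>2 + 4 * A$1$2 * A$2$1 = - D" using discriminant[OF assms(1)] by (simp add: m_def D_def)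
  have "cross v (app A v) = 0" using fx v moebius_of_fixes_rproj[OF assms(1) v(1)] by simp
  then have 0: "A$2$1 * p\<^sup>2 + m * p * q - A$1$2 * q\<^sup>2 = 0"
    by (simp add: cross_def app_def pq m_def power2_eq_square algebra_simps)
  \<comment> \<open>Completing the square after multiplying by four times the leading coefficient
    avoids a division, so that coefficient may still be zero here.\<close>
  have "4 * A$2$1 * (A$2$1 * p\<^sup>2 + m * p * q - A$1$2 * q\<^sup>2) =
     (2 * A$2$1 * p + m * q)\<^sup>2 - (m\<^sup>2 + 4 * A$1$2 * A$2$1) * q\<^sup>2"
    by (simp add: power2_eq_square algebra_simps)
  then have sum: "(2 * A$2$1 * p + m * q)\<^sup>2 + D * q\<^sup>2 = 0" unfolding 0 mD by simp
  moreover have "D * q\<^sup>2 \<ge> 0" using D by simp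
  ultimately have "D * q\<^sup>2 = 0" "(2 * A$2$1 * p + m * q)\<^sup>2 = 0"
    using zero_le_power2[of "2 * A$2$1 * p + m * q"] by linarith+
  then have "q = 0" "A$2$1 * p = 0" using D by auto
  then have "A$2$1 = 0" using v by (auto simp: pq zero_prod_def)
  then have "m\<^sup>2 = - D" using mD by simp
  then show False using D zero_le_power2[of m] by linarith
qed

lemma infinite_extended_reals: "infinite extended_reals"
proof -
  have "inj (\<lambda>n::nat. Some (of_nat n) :: complex option)" by (auto simp: inj_def)
  then have "infinite (range (\<lambda>n::nat. Some (of_nat n) :: complex option))"
    by (simp add: range_inj_infinite)
  then show ?thesis by (rule infinite_super[rotated]) (auto simp: extended_reals_def)
qed

lemma app_eq_self:
  assumes "\<And>v. app A v = v" shows "A = mat 1"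
proof -
  from assms[of "(1,0)"] assms[of "(0,1)"] show "A = mat 1"
    by (simp add: app_def matrix2_eq_iff)
qed

lemma fixpoints:
  assumes "A \<in> SL2" "app A e = l *\<^sub>R e" "l \<ge> 1" "cross e u \<noteq> 0"
    "app A u = (1 / l) *\<^sub>R u + k *\<^sub>R e"
  shows "l > 1 \<Longrightarrow> {x \<in> extended_reals. moebius_of A x = x} =
      {rproj e, rproj (k *\<^sub>R e - (l - 1 / l) *\<^sub>R u)}"
    and "l = 1 \<Longrightarrow> k \<noteq> 0 \<Longrightarrow> {x \<in> extended_reals. moebius_of A x = x} = {rproj e}"
proof -
  have e: "e \<noteq> 0" using cross_nz[OF assms(4)] by simp
  have fe: "moebius_of A (rproj e) = rproj e"
    by (simp add: moebius_of_fixes_rproj[OF assms(1) e] assms(2) cross_simps)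
  have fixcond: "s = 0 \<or> r * (l - 1 / l) + s * k = 0"
    if "moebius_of A x = x" "x = rproj (r *\<^sub>R e + s *\<^sub>R u)" "r *\<^sub>R e + s *\<^sub>R u \<noteq> 0" for x r s
    using that moebius_of_fixes_rproj[OF assms(1) that(3)]
      cross_app_fixed_basis[OF assms(2,5), of r s] assms(4) by auto
  have ex: "\<exists>r s. r *\<^sub>R e + s *\<^sub>R u \<noteq> 0 \<and> x = rproj (r *\<^sub>R e + s *\<^sub>R u)" if xE: "x \<in> extended_reals" for x
  proof -
    obtain w where "w \<noteq> 0" "x = rproj w" using xE by (rule rproj_surj)
    moreover obtain r s where "w = r *\<^sub>R e + s *\<^sub>R u" using basis_decompose[OF assms(4)] .
    ultimately show ?thesis by blast
  qed
  have eq_e: "rproj (r *\<^sub>R e + 0 *\<^sub>R u) = rproj e" if "r *\<^sub>R e + 0 *\<^sub>R u \<noteq> 0" for r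
    using rproj_eq_iff[OF that e] by (simp add: cross_simps)
  { assume l: "l > 1"
    then have l1: "l - 1 / l > 0" by (rule diff_inverse_pos)
    \<comment> \<open>The zero of the second factor in \<open>cross_app_fixed_basis\<close>; it
      spans the repelling eigenline.\<close>
    let ?w = "k *\<^sub>R e - (l - 1 / l) *\<^sub>R u"
    have "cross e ?w \<noteq> 0" using l1 assms(4) by (simp add: cross_diff cross_simps)
    then have w: "?w \<noteq> 0" using cross_nz by blast
    have "?w = k *\<^sub>R e + (- (l - 1 / l)) *\<^sub>R u" by (simp add: algebra_simps)
    then have "cross ?w (app A ?w) = 0"
      using cross_app_fixed_basis[OF assms(2,5), of k "- (l - 1 / l)"] by (simp add: algebra_simps)
    then have fw: "moebius_of A (rproj ?w) = rproj ?w"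
      using moebius_of_fixes_rproj[OF assms(1) w] by simp
    show "{x \<in> extended_reals. moebius_of A x = x} = {rproj e, rproj ?w}"
    proof (intro subset_antisym subsetI)
      fix x assume x: "x \<in> {x \<in> extended_reals. moebius_of A x = x}"
      then obtain r s where rs: "r *\<^sub>R e + s *\<^sub>R u \<noteq> 0" "x = rproj (r *\<^sub>R e + s *\<^sub>R u)"
        using ex by blast
      then consider "s = 0" | "r * (l - 1 / l) + s * k = 0" using fixcond x by auto
      then show "x \<in> {rproj e, rproj ?w}"
      proof cases
        case 1 then show ?thesis using rs eq_e by auto
      next
        case 2
        have "cross (r *\<^sub>R e + s *\<^sub>R u) ?w = - (r * (l - 1 / l) + s * k) * cross e u"
          using cross_swap[of u e]
          by (simp add: cross_diff cross_simps algebra_simps)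
        then show ?thesis using rproj_eq_iff[OF rs(1) w] rs(2) 2 by simp
      qed
    qed (use fe fw in auto) }
  { assume "l = 1" "k \<noteq> 0"
    then show "{x \<in> extended_reals. moebius_of A x = x} = {rproj e}"
      proof (intro subset_antisym subsetI)
        fix x assume x: "x \<in> {x \<in> extended_reals. moebius_of A x = x}"
        then obtain r s where rs: "r *\<^sub>R e + s *\<^sub>R u \<noteq> 0" "x = rproj (r *\<^sub>R e + s *\<^sub>R u)"
          using ex by blast
        then have "s = 0" using fixcond[of x r s] x \<open>l = 1\<close> \<open>k \<noteq> 0\<close> by auto
        then show "x \<in> {rproj e}" using rs eq_e by auto
      qed (use fe in auto) }
qed

lemma card_fixpoints:
  assumes "A \<in> SL2" "A$1$1 + A$2$2 \<ge> 0"
  shows "card {x \<in> extended_reals. moebius_of A x = x} =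
    (if A$1$1 + A$2$2 > 2 then 2 else if A$1$1 + A$2$2 = 2 \<and> A \<noteq> mat 1 then 1 else 0)"
proof (cases "A$1$1 + A$2$2 < 2")
  case True
  then have "{x \<in> extended_reals. moebius_of A x = x} = {}"
    using no_real_fixpoint[of A] assms by auto
  then show ?thesis unfolding \<open>_ = {}\<close> using True by simp
next
  case False
  then obtain e l where e: "e \<noteq> 0" "l \<ge> 1" "A$1$1 + A$2$2 = l + 1 / l" "app A e = l *\<^sub>R e"
    using dominant_eigenvector[OF assms(1)] by (metis not_less)
  obtain u where u: "cross e u \<noteq> 0" using exists_transversal[OF e(1)] .
  obtain k where k: "app A u = (1 / l) *\<^sub>R u + k *\<^sub>R e"
    using complement_eigenvector[OF assms(1) e(4) _ u] e(2) by (metis not_one_le_zero)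
  show ?thesis
  proof (cases "l = 1")
    case True
    show ?thesis
    proof (cases "k = 0")
      case True
      have "app A v = v" for v
      proof -
        obtain r s where v: "v = r *\<^sub>R e + s *\<^sub>R u" using basis_decompose[OF u] .
        show ?thesis using e(4) k True \<open>l = 1\<close> by (simp add: v app_linear)
      qed
      then have "A = mat 1" by (rule app_eq_self)
      \<comment> \<open>The identity fixes an infinite set, whose \<open>card\<close> is 0 by
        default; hence it belongs to the last branch of the formula.\<close>
      then show ?thesis using infinite_extended_reals by (simp add: moebius_of_mat_1)
    next
      case False
      then have "A \<noteq> mat 1" using k True cross_nz[OF u] by auto
      then show ?thesis unfolding fixpoints(2)[OF assms(1) e(4,2) u k True False] using True e(3) by simp
    qed
  next
    case False
    then have l: "l > 1" using e(2) by simp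
    then have l1: "l - 1 / l > 0" by (rule diff_inverse_pos)
    have "l + 1 / l - 2 = (l - 1)\<^sup>2 / l" using l by (simp add: power2_eq_square field_split_simps)
    also have "\<dots> > 0" using l by simp
    finally have t: "A$1$1 + A$2$2 > 2" using e(3) by simp
    let ?w = "k *\<^sub>R e - (l - 1 / l) *\<^sub>R u"
    have "cross e ?w \<noteq> 0" using l1 u by (simp add: cross_diff cross_simps)
    then have "rproj e \<noteq> rproj ?w" using rproj_eq_iff[OF e(1)] cross_nz[of e ?w] by simp
    then show ?thesis unfolding fixpoints(1)[OF assms(1) e(4,2) u k l] using t by (simp only: card_2_iff if_True) blast
  qed
qed

lemma parabolic_iff:
  assumes "A \<in> SL2" "A$1$1 + A$2$2 \<ge> 0"
  shows "parabolic (moebius_of A) \<longleftrightarrow> A$1$1 + A$2$2 = 2 \<and> A \<noteq> mat 1"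
  unfolding parabolic_def card_fixpoints[OF assms] using assms(1) by simp

lemma hyperbolic_iff:
  assumes "A \<in> SL2" "A$1$1 + A$2$2 \<ge> 0"
  shows "hyperbolic (moebius_of A) \<longleftrightarrow> A$1$1 + A$2$2 > 2"
  unfolding hyperbolic_def card_fixpoints[OF assms] using assms(1) by simp

text \<open>Real and imaginary part of the fixed point equation express \<open>A$2$2 - A$1$1\<close>
  and \<open>A$1$2\<close> through \<open>A$2$1\<close> and the fixed point, which turns the
  discriminant into minus a square. Conversely a negative discriminant gives the fixed point
  explicitly.\<close>

lemma elliptic_iff:
  assumes "A \<in> SL2"
  shows "elliptic (moebius_of A) \<longleftrightarrow> \<bar>A$1$1 + A$2$2\<bar> < 2"
proof
  assume "elliptic (moebius_of A)"
  then obtain z where nid: "moebius_of A \<noteq> id" and z: "Im z > 0" "moebius_of A (Some z) = Some z"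
    by (auto simp: elliptic_def upper_half_plane_def)
  define x where "x = Re z" define y where "y = Im z"
  have y: "y > 0" using z y_def by simp
  let ?a = "complex_of_real (A$1$1)" and ?b = "complex_of_real (A$1$2)"
    and ?c = "complex_of_real (A$2$1)" and ?d = "complex_of_real (A$2$2)"
  have "?c * z + ?d \<noteq> 0" "(?a * z + ?b) / (?c * z + ?d) = z"
    using z(2) by (auto simp: moebius_of_def Let_def split: if_splits)
  then have "?a * z + ?b = z * (?c * z + ?d)" by (simp add: divide_eq_eq)
  then have "Re (?a * z + ?b) = Re (z * (?c * z + ?d))" "Im (?a * z + ?b) = Im (z * (?c * z + ?d))"
    by simp_all
  then have re: "A$1$1 * x + A$1$2 = A$2$1 * (x\<^sup>2 - y\<^sup>2) + A$2$2 * x"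
    and "y * (A$2$2 - A$1$1 + 2 * A$2$1 * x) = 0"
    by (simp_all add: x_def y_def power2_eq_square algebra_simps)
  then have da: "A$2$2 - A$1$1 = - 2 * A$2$1 * x" using y by simp
  have b: "A$1$2 = - A$2$1 * (x\<^sup>2 + y\<^sup>2)"
  proof -
    have "A$1$2 = A$2$1 * (x\<^sup>2 - y\<^sup>2) + (A$2$2 - A$1$1) * x" using re by (simp add: algebra_simps)
    then show ?thesis unfolding da by (simp add: power2_eq_square algebra_simps)
  qed
  have "A$2$1 \<noteq> 0"
  proof
    assume c: "A$2$1 = 0"
    then have "A$1$1 = A$2$2" "A$1$2 = 0" using da b by auto
    then have "(A$1$1 - 1) * (A$1$1 + 1) = 0" using assms c by (simp add: SL2_iff algebra_simps)
    then have "A$1$1 = 1 \<or> A$1$1 = -1" by auto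
    then have "A = mat 1 \<or> A = - mat 1"
      using c \<open>A$1$1 = A$2$2\<close> \<open>A$1$2 = 0\<close> by (auto simp: matrix2_eq_iff)
    then show False using nid moebius_of_mat_1 moebius_of_minus by metis
  qed
  then have "(2 * A$2$1 * y)\<^sup>2 > 0" using y by simp
  moreover have "(A$1$1 + A$2$2)\<^sup>2 - 4 = - (2 * A$2$1 * y)\<^sup>2"
    unfolding discriminant[OF assms, symmetric] da b by (simp add: power2_eq_square algebra_simps)
  ultimately have "(A$1$1 + A$2$2)\<^sup>2 < 2\<^sup>2" unfolding power2_eq_square[of 2] by linarith
  then show "\<bar>A$1$1 + A$2$2\<bar> < 2" using power2_less_imp_less[of "\<bar>A$1$1 + A$2$2\<bar>" 2] by simp
next
  assume t: "\<bar>A$1$1 + A$2$2\<bar> < 2"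
  define D where "D = 4 - (A$1$1 + A$2$2)\<^sup>2"
  have "(A$1$1 + A$2$2)\<^sup>2 < 2\<^sup>2"
    using t by (metis abs_ge_zero power2_abs power_strict_mono zero_less_numeral)
  then have D: "D > 0" by (simp add: D_def)
  have disc: "(A$2$2 - A$1$1)\<^sup>2 + 4 * A$1$2 * A$2$1 = - D"
    using discriminant[OF assms] by (simp add: D_def)
  have c: "A$2$1 \<noteq> 0"
  proof
    assume "A$2$1 = 0"
    then show False using disc D zero_le_power2[of "A$2$2 - A$1$1"] by (simp del: zero_le_power2)
  qed
  \<comment> \<open>\<open>Complex x y\<close> is the root given by the quadratic formula; the
    absolute value selects the one in the upper half-plane.\<close>
  define y where "y = sqrt D / (2 * \<bar>A$2$1\<bar>)"
  have y: "y > 0" "(2 * A$2$1 * y)\<^sup>2 = D"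
    using D c by (auto simp: y_def power_mult_distrib power_divide)
  define x where "x = (A$1$1 - A$2$2) / (2 * A$2$1)"
  have x: "2 * A$2$1 * x = A$1$1 - A$2$2" using c by (simp add: x_def)
  define z where "z = Complex x y"
  let ?a = "complex_of_real (A$1$1)" and ?b = "complex_of_real (A$1$2)"
    and ?c = "complex_of_real (A$2$1)" and ?d = "complex_of_real (A$2$2)"
  have 4: "4 * A$2$1 * (A$2$1 * (x\<^sup>2 - y\<^sup>2) + (A$2$2 - A$1$1) * x - A$1$2) = 0"
  proof -
    have "4 * A$2$1 * (A$2$1 * (x\<^sup>2 - y\<^sup>2) + (A$2$2 - A$1$1) * x - A$1$2) =
      (2 * A$2$1 * x)\<^sup>2 - (2 * A$2$1 * y)\<^sup>2 + 2 * (A$2$2 - A$1$1) * (2 * A$2$1 * x) - 4 * A$1$2 * A$2$1"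
      by (simp add: power2_eq_square algebra_simps)
    also have "\<dots> = - ((A$2$2 - A$1$1)\<^sup>2 + 4 * A$1$2 * A$2$1) - D"
      unfolding x y by (simp add: power2_eq_square algebra_simps)
    finally show ?thesis using disc by simp
  qed
  have 5: "A$2$1 * (x\<^sup>2 - y\<^sup>2) + (A$2$2 - A$1$1) * x - A$1$2 = 0"
    using 4 c by (simp only: mult_eq_0_iff) simp
  have "z * (?c * z + ?d) = ?a * z + ?b"
  proof (rule complex_eqI)
    show "Re (z * (?c * z + ?d)) = Re (?a * z + ?b)"
      using 5 by (simp add: z_def power2_eq_square algebra_simps)
    have "Im (z * (?c * z + ?d)) - Im (?a * z + ?b) = y * (2 * A$2$1 * x + (A$2$2 - A$1$1))"
      by (simp add: z_def algebra_simps)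
    then show "Im (z * (?c * z + ?d)) = Im (?a * z + ?b)" unfolding x by simp
  qed
  moreover have "?c * z + ?d \<noteq> 0" using c y by (auto simp: z_def complex_eq_iff)
  ultimately have "moebius_of A (Some z) = Some z"
    by (simp add: moebius_of_def Let_def divide_eq_eq)
  moreover have "moebius_of A \<noteq> id"
    using no_real_fixpoint[OF assms t, of None] by (auto simp: extended_reals_def)
  moreover have "Some z \<in> upper_half_plane" using y by (simp add: upper_half_plane_def z_def)
  ultimately show "elliptic (moebius_of A)" using assms by (auto simp: elliptic_def)
qed

section \<open>Attracting fixed points\<close>

text \<open>The vector s e + t u with complex coefficients over a real eigenbasis: attraction must
  be checked at non-real points of the closed half-plane as well.\<close>

definition comb :: "complex \<Rightarrow> real \<times> real \<Rightarrow> complex \<Rightarrow> real \<times> real \<Rightarrow> complex \<times> complex" where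
  "comb s e t u = (s * of_real (fst e) + t * of_real (fst u), s * of_real (snd e) + t * of_real (snd u))"

lemma proj_comb_scale: "c \<noteq> 0 \<Longrightarrow> proj (comb (c * s) e (c * t) u) = proj (comb s e t u)"
proof -
  assume "c \<noteq> 0"
  moreover have "comb (c * s) e (c * t) u = (c * fst (comb s e t u), c * snd (comb s e t u))"
    by (simp add: comb_def algebra_simps)
  ultimately show ?thesis by (simp add: proj_def)
qed

lemma rproj_eq_comb: "rproj e = proj (comb 1 e 0 u)" "rproj u = proj (comb 0 e 1 u)"
  by (simp_all add: rproj_def comb_def)

lemma comb_eq_0_iff:
  assumes "cross e u \<noteq> 0" shows "comb s e t u = 0 \<longleftrightarrow> s = 0 \<and> t = 0"
proof
  assume 0: "comb s e t u = 0"
  have "s * of_real (cross e u) = fst (comb s e t u) * of_real (snd u) - snd (comb s e t u) * of_real (fst u)"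
    "t * of_real (cross e u) = snd (comb s e t u) * of_real (fst e) - fst (comb s e t u) * of_real (snd e)"
    by (simp_all add: comb_def cross_def algebra_simps)
  then show "s = 0 \<and> t = 0" using assms unfolding 0 by simp
qed (simp add: comb_def zero_prod_def)

lemma comb_exists:
  assumes "cross e u \<noteq> 0" obtains s t where "p = comb s e t u"
proof -
  obtain x y where p: "p = (x, y)" by fastforce
  let ?D = "complex_of_real (cross e u)"
  define s where "s = (x * of_real (snd u) - y * of_real (fst u)) / ?D"
  define t where "t = (y * of_real (fst e) - x * of_real (snd e)) / ?D"
  have D: "?D \<noteq> 0" using assms by simp
  have "comb s e t u = (x * ?D / ?D, y * ?D / ?D)"
    unfolding comb_def s_def t_def prod.inject times_divide_eq_left add_divide_distrib[symmetric]
    by (simp add: cross_def algebra_simps)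
  then have "p = comb s e t u" using D by (simp add: p)
  then show ?thesis by (rule that)
qed

lemma capp_comb:
  assumes "app A e = l *\<^sub>R e" "app A u = m *\<^sub>R u"
  shows "capp A (comb s e t u) = comb (s * of_real l) e (t * of_real m) u"
proof -
  have "A$1$1 * fst e + A$1$2 * snd e = l * fst e" "A$2$1 * fst e + A$2$2 * snd e = l * snd e"
    "A$1$1 * fst u + A$1$2 * snd u = m * fst u" "A$2$1 * fst u + A$2$2 * snd u = m * snd u"
    using assms by (simp_all add: app_def prod_eq_iff)
  note * = this[THEN arg_cong[where f = complex_of_real], unfolded of_real_add of_real_mult]
  have "capp A (comb s e t u) =
    (s * (of_real (A$1$1) * of_real (fst e) + of_real (A$1$2) * of_real (snd e)) +
     t * (of_real (A$1$1) * of_real (fst u) + of_real (A$1$2) * of_real (snd u)),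
     s * (of_real (A$2$1) * of_real (fst e) + of_real (A$2$2) * of_real (snd e)) +
     t * (of_real (A$2$1) * of_real (fst u) + of_real (A$2$2) * of_real (snd u)))"
    by (simp add: capp_def comb_def algebra_simps)
  then show ?thesis unfolding * by (simp add: comb_def mult.assoc)
qed

lemma tendsto_comb: "x \<longlonglongrightarrow> y \<Longrightarrow> (\<lambda>n. comb s e (x n) u) \<longlonglongrightarrow> comb s e y u"
  unfolding comb_def by (intro tendsto_intros)

lemma limitin_proj:
  assumes "q \<longlonglongrightarrow> q0" "\<And>n. q n \<noteq> 0" "q0 \<noteq> 0"
  shows "limitin sphere_topology (\<lambda>n. proj (q n)) (proj q0) sequentially"
proof -
  have "limitin (top_of_set (- {0})) q q0 sequentially"
    using assms by (simp add: limitin_subtopology)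
  from continuous_map_limit[OF continuous_map_proj this] show ?thesis
    by (simp add: o_def)
qed

text \<open>In eigencoordinates the n-th iterate sends [s : t] to [1 : (t/s) l^(-2n)], which tends
  to \<open>e\<close> whenever \<open>s\<close> is nonzero; \<open>s = 0\<close> is the other fixed
  point.\<close>

lemma attracting_fixpoint_eq:
  assumes A: "A \<in> SL2" and l: "l > 1" and e: "app A e = l *\<^sub>R e" and u: "app A u = (1 / l) *\<^sub>R u"
    and D: "cross e u \<noteq> 0"
  shows "attracting_fixpoint (moebius_of A) = rproj e"
proof -
  have nz: "e \<noteq> 0" "u \<noteq> 0" using cross_nz[OF D] by auto
  have iter: "(moebius_of A ^^ n) (proj (comb s e t u)) = proj (comb (s * of_real l ^ n) e (t * of_real (1 / l) ^ n) u)"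
    if "s \<noteq> 0" for s t n
  proof (induction n)
    case (Suc n)
    have "comb (s * of_real l ^ n) e (t * of_real (1 / l) ^ n) u \<noteq> 0"
      using that l by (simp add: comb_eq_0_iff[OF D])
    then show ?case
      using Suc by (simp add: moebius_of_proj capp_comb[OF e u] mult_ac)
  qed simp
  have lim: "limitin sphere_topology (\<lambda>n. (moebius_of A ^^ n) x) (rproj e) sequentially"
    if x: "moebius_of A x \<noteq> x" for x
  proof -
    obtain p where p: "p \<noteq> 0" "x = proj p" by (rule proj_surj)
    obtain s t where st: "p = comb s e t u" using comb_exists[OF D] .
    have s: "s \<noteq> 0"
    proof
      assume "s = 0"
      then have "moebius_of A x = proj (comb (of_real (1 / l) * s) e (of_real (1 / l) * t) u)"
        using p by (simp add: moebius_of_proj st capp_comb[OF e u] mult_ac)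
      also have "\<dots> = x" using l by (subst proj_comb_scale) (auto simp: p st)
      finally show False using x by simp
    qed
    define q where "q n = comb 1 e (t / s * of_real ((1 / l) ^ n * (1 / l) ^ n)) u" for n
    have eq: "(moebius_of A ^^ n) x = proj (q n)" for n
    proof -
      have "(moebius_of A ^^ n) x = proj (comb (s * of_real l ^ n) e (t * of_real (1 / l) ^ n) u)"
        using iter[OF s] by (simp add: p st)
      also have "\<dots> = proj (comb ((s * of_real l ^ n) * 1) e ((s * of_real l ^ n) * (t / s * of_real ((1 / l) ^ n * (1 / l) ^ n))) u)"
        using s l by (simp add: power_divide)
      also have "\<dots> = proj (q n)"
        unfolding q_def using s l by (subst proj_comb_scale) auto
      finally show ?thesis .
    qed
    have "(\<lambda>n. (1 / l) ^ n) \<longlonglongrightarrow> 0" using l by (intro LIMSEQ_realpow_zero) auto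
    then have "(\<lambda>n. (1 / l) ^ n * (1 / l) ^ n) \<longlonglongrightarrow> 0 * 0" by (intro tendsto_mult)
    then have "(\<lambda>n. complex_of_real ((1 / l) ^ n * (1 / l) ^ n)) \<longlonglongrightarrow> of_real (0 * 0)"
      by (intro tendsto_of_real)
    then have "(\<lambda>n. t / s * of_real ((1 / l) ^ n * (1 / l) ^ n)) \<longlonglongrightarrow> t / s * of_real (0 * 0)"
      by (intro tendsto_mult tendsto_const)
    then have "q \<longlonglongrightarrow> comb 1 e (t / s * of_real (0 * 0)) u"
      unfolding q_def by (rule tendsto_comb)
    then have "q \<longlonglongrightarrow> comb 1 e 0 u" by simp
    then have "limitin sphere_topology (\<lambda>n. proj (q n)) (proj (comb 1 e 0 u)) sequentially"
      by (rule limitin_proj) (simp_all add: q_def comb_eq_0_iff[OF D])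
    then show ?thesis by (simp add: eq rproj_eq_comb(1)[of e u])
  qed
  have fe: "moebius_of A (rproj e) = rproj e"
    by (simp add: moebius_of_fixes_rproj[OF A nz(1)] e cross_simps)
  show ?thesis unfolding attracting_fixpoint_def
  proof (rule the_equality)
    show "rproj e \<in> extended_reals \<and> moebius_of A (rproj e) = rproj e \<and>
      (\<forall>x\<in>closed_half_plane. moebius_of A x \<noteq> x \<longrightarrow>
        limitin sphere_topology (\<lambda>n. (moebius_of A ^^ n) x) (rproj e) sequentially)"
      using fe lim by simp
  next
    fix p assume p: "p \<in> extended_reals \<and> moebius_of A p = p \<and>
      (\<forall>x\<in>closed_half_plane. moebius_of A x \<noteq> x \<longrightarrow>
        limitin sphere_topology (\<lambda>n. (moebius_of A ^^ n) x) p sequentially)"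
    \<comment> \<open>For uniqueness one moved point suffices: its orbit converges both to the
      candidate \<open>p\<close> and to \<open>e\<close>.\<close>
    define x where "x = rproj (e + u)"
    have "cross e (e + u) \<noteq> 0" using D by (simp add: cross_simps)
    then have nz': "e + u \<noteq> 0" using cross_nz by blast
    have "cross (e + u) (app A (e + u)) = - (l - 1 / l) * cross e u"
      using cross_swap[of u e] by (simp add: app_linear e u cross_simps algebra_simps)
    also have "\<dots> \<noteq> 0" using D diff_inverse_pos[OF l] by simp
    finally have x: "moebius_of A x \<noteq> x" using moebius_of_fixes_rproj[OF A nz'] by (simp add: x_def)
    moreover have "x \<in> closed_half_plane" by (simp add: x_def closed_half_plane_def)
    ultimately have "limitin sphere_topology (\<lambda>n. (moebius_of A ^^ n) x) p sequentially" using p by blast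
    then show "p = rproj e"
      using limitin_Hausdorff_unique[OF _ lim[OF x] _ Hausdorff_sphere] by simp
  qed
qed

lemma repelling_fixpoint_eq:
  assumes A: "A \<in> SL2" and l: "l > 1" and e: "app A e = l *\<^sub>R e" and u: "app A u = (1 / l) *\<^sub>R u"
    and D: "cross e u \<noteq> 0"
  shows "repelling_fixpoint (moebius_of A) = rproj u"
proof -
  have "app (adj A) u = l *\<^sub>R u"
  proof -
    have "l *\<^sub>R u = l *\<^sub>R app (adj A) (app A u)" using app_adj[OF A] by simp
    then show ?thesis using l by (simp add: u app_linear)
  qed
  moreover have "app (adj A) e = (1 / l) *\<^sub>R e"
  proof -
    have "(1 / l) *\<^sub>R e = (1 / l) *\<^sub>R app (adj A) (app A e)" using app_adj[OF A] by simp
    then show ?thesis using l by (simp add: e app_linear)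
  qed
  ultimately show ?thesis
    using attracting_fixpoint_eq[OF adj_SL2[OF A] l, of u e] D cross_swap[of e u]
    by (simp add: repelling_fixpoint_def inv_moebius_of[OF A])
qed

text \<open>The conventions in \<open>point_diff\<close> amount to computing the cross-ratio with
  homogeneous coordinates.\<close>

lemma point_diff_rproj:
  assumes "p \<noteq> 0" "q \<noteq> 0"
  shows "point_diff (rproj p) (rproj q) = (cross p q * (if snd q = 0 then -1 else 1)) /
     ((if snd p = 0 then fst p else snd p) * (if snd q = 0 then fst q else snd q))"
proof (cases "cross p q = 0")
  case True
  then have "rproj p = rproj q" using rproj_eq_iff[OF assms] by simp
  then show ?thesis using True by (simp add: point_diff_def)
next
  case False
  obtain a b c d where [simp]: "p = (a, b)" "q = (c, d)" by fastforce
  have ne: "rproj p \<noteq> rproj q" using rproj_eq_iff[OF assms] False by simp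
  consider "b = 0" "d \<noteq> 0" "a \<noteq> 0" | "b \<noteq> 0" "d = 0" "c \<noteq> 0" | "b \<noteq> 0" "d \<noteq> 0"
    using assms False by (cases "b = 0"; cases "d = 0") (auto simp: cross_def zero_prod_def)
  then show ?thesis
  proof cases
    case 3
    then have "rproj p = Some (of_real (a / b))" "rproj q = Some (of_real (c / d))"
      by (simp_all add: rproj_def proj_def)
    then have "point_diff (rproj p) (rproj q) = a / b - c / d"
      using ne by (simp add: point_diff_def del: of_real_divide)
    also have "\<dots> = (a * d - b * c) / (b * d)" using 3 by (simp add: diff_frac_eq mult.commute)
    finally show ?thesis using 3 by (simp add: cross_def)
  qed (use ne in \<open>auto simp: point_diff_def rproj_def proj_def cross_def split: option.split\<close>)
qed

text \<open>Each of the four points occurs once above and once below, so its normalising factor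
  cancels. The signs caused by infinity are attached to second arguments, which are \<open>v\<close>
  and \<open>w\<close> both above and below.\<close>

lemma cross_ratio_homogeneous:
  assumes "u \<noteq> 0" "v \<noteq> 0" "w \<noteq> 0" "z \<noteq> 0"
    and "cross u w \<noteq> 0" "cross z v \<noteq> 0"
  shows "(point_diff (rproj u) (rproj v) * point_diff (rproj z) (rproj w)) /
     (point_diff (rproj u) (rproj w) * point_diff (rproj z) (rproj v)) =
     (cross u v * cross z w) / (cross u w * cross z v)"
    and "point_diff (rproj u) (rproj w) * point_diff (rproj z) (rproj v) \<noteq> 0"
proof -
  have n: "(if snd p = 0 then fst p else snd p) \<noteq> 0" if "p \<noteq> 0" for p :: "real \<times> real"
    using that by (auto simp: prod_eq_iff)
  have cancel: "((c1 * sv) / (nu * nv) * ((c2 * sw) / (nz * nw))) /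
      ((c3 * sw) / (nu * nw) * ((c4 * sv) / (nz * nv))) = (c1 * c2) / (c3 * c4)"
    if "nu \<noteq> 0" "nv \<noteq> 0" "nw \<noteq> 0" "nz \<noteq> 0" "sv \<noteq> 0" "sw \<noteq> 0"
    for c1 c2 c3 c4 sv sw nu nv nw nz :: real
    using that by simp
  show "(point_diff (rproj u) (rproj v) * point_diff (rproj z) (rproj w)) /
     (point_diff (rproj u) (rproj w) * point_diff (rproj z) (rproj v)) =
     (cross u v * cross z w) / (cross u w * cross z v)"
    unfolding point_diff_rproj[OF assms(1,2)] point_diff_rproj[OF assms(4,3)]
      point_diff_rproj[OF assms(1,3)] point_diff_rproj[OF assms(4,2)]
    by (rule cancel) (simp_all only: n assms not_False_eq_True, simp_all)
  show "point_diff (rproj u) (rproj w) * point_diff (rproj z) (rproj v) \<noteq> 0"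
    unfolding point_diff_rproj[OF assms(1,3)] point_diff_rproj[OF assms(4,2)]
    using n[OF assms(1)] n[OF assms(2)] n[OF assms(3)] n[OF assms(4)] assms(5,6) by simp
qed

section \<open>Semidiscreteness\<close>

lemma semidiscreteI:
  assumes "openin moebius_topology U" "id \<in> U" "\<And>h. h \<in> S \<Longrightarrow> h \<in> U \<Longrightarrow> h = id"
  shows "semidiscrete S"
  using assms by (auto simp: semidiscrete_def in_derived_set_of)

lemma generated_semigroup_power:
  assumes "h \<in> generated_semigroup F" shows "h ^^ Suc n \<in> generated_semigroup F"
proof (induction n)
  case (Suc n)
  then show ?case using generated_semigroup.comp[OF assms] by (simp only: funpow.simps)
qed (use assms in simp)

lemma generated_semigroup_mono:
  assumes "F \<subseteq> generated_semigroup F'" shows "generated_semigroup F \<subseteq> generated_semigroup F'"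
proof
  fix h assume "h \<in> generated_semigroup F"
  then show "h \<in> generated_semigroup F'"
    using assms by induction (auto intro: generated_semigroup.comp)
qed

lemma semidiscrete_subset: "S \<subseteq> T \<Longrightarrow> semidiscrete T \<Longrightarrow> semidiscrete S"
  using derived_set_of_mono unfolding semidiscrete_def by blast

text \<open>By compactness of the unit circle, the powers of a rotation return arbitrarily close to
  the identity.\<close>

lemma unit_complex_power_near_1:
  fixes z :: complex
  assumes "norm z = 1" "\<delta> > 0"
  obtains n where "norm (z ^ Suc n - 1) < \<delta>"
proof -
  have "compact (sphere (0::complex) 1)" by simp
  moreover have "\<forall>n. z ^ n \<in> sphere 0 1" using assms by (simp add: norm_power)
  ultimately have "\<exists>l\<in>sphere 0 1. \<exists>r. strict_mono r \<and> ((\<lambda>n. z ^ n) \<circ> r) \<longlonglongrightarrow> l"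
    unfolding compact_def by blast
  then obtain l r where r: "strict_mono r" "((\<lambda>n. z ^ n) \<circ> r) \<longlonglongrightarrow> l" by blast
  have "Cauchy ((\<lambda>n. z ^ n) \<circ> r)" using r(2) by (rule LIMSEQ_imp_Cauchy)
  then obtain N where N: "\<forall>m\<ge>N. \<forall>n\<ge>N. dist (z ^ r m) (z ^ r n) < \<delta>"
    using assms(2) unfolding Cauchy_def o_def by blast
  have lt: "r N < r (Suc N)" using r(1) by (simp add: strict_mono_Suc_iff)
  then obtain k where k: "r (Suc N) = r N + Suc k" using less_imp_Suc_add by fastforce
  have "norm (z ^ r (Suc N) - z ^ r N) < \<delta>" using N by (simp add: dist_norm)
  also have "z ^ r (Suc N) - z ^ r N = z ^ r N * (z ^ Suc k - 1)"
    by (simp add: k power_add algebra_simps)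
  finally have "norm (z ^ Suc k - 1) < \<delta>" using assms(1) by (simp add: norm_mult norm_power)
  then show ?thesis by (rule that)
qed

text \<open>\<open>A\<close> equals \<open>c\<close> times the identity plus \<open>s\<close> times
  a matrix with entries \<open>p\<close>, \<open>q\<close>, \<open>r\<close>, \<open>- p\<close>
  whose square is minus the identity. The matrices \<open>X z\<close> thus form a copy of the
  complex numbers in which \<open>A\<close> is the unit number c + is, and
  \<open>unit_complex_power_near_1\<close> applies.\<close>

lemma elliptic_power_near_id:
  assumes A: "A \<in> SL2" and t: "\<bar>A$1$1 + A$2$2\<bar> < 2"
    and U: "openin moebius_topology U" "id \<in> U"
  obtains n where "moebius_of A ^^ Suc n \<in> U"
proof -
  define c where "c = (A$1$1 + A$2$2) / 2"
  define s where "s = sqrt (1 - c\<^sup>2)"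
  have "\<bar>c\<bar> < 1" using t by (simp add: c_def)
  then have "c\<^sup>2 < 1" by (simp add: abs_square_less_1)
  then have s: "s > 0" "s\<^sup>2 = 1 - c\<^sup>2" by (simp_all add: s_def)
  define p where "p = (A$1$1 - c) / s"
  define q where "q = A$1$2 / s"
  define r where "r = A$2$1 / s"
  have sp: "s * p = A$1$1 - c" "s * q = A$1$2" "s * r = A$2$1" using s by (simp_all add: p_def q_def r_def)
  have "s\<^sup>2 * (p\<^sup>2 + q * r) = (s * p)\<^sup>2 + (s * q) * (s * r)" by (simp add: power2_eq_square algebra_simps)
  also have "\<dots> = c\<^sup>2 - (A$1$1 * A$2$2 - A$1$2 * A$2$1)"
    unfolding sp by (simp add: c_def power2_eq_square field_simps)
  also have "\<dots> = - s\<^sup>2" using A s by (simp add: SL2_iff)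
  finally have "s\<^sup>2 * (p\<^sup>2 + q * r + 1) = 0" by (simp add: algebra_simps)
  then have N: "p * p + q * r = -1" using s by (simp add: power2_eq_square)
  define X :: "complex \<Rightarrow> real^2^2" where
    "X z = vector [vector [Re z + Im z * p, Im z * q], vector [Im z * r, Re z - Im z * p]]" for z
  have X [simp]: "X z $ 1 $ 1 = Re z + Im z * p" "X z $ 1 $ 2 = Im z * q"
     "X z $ 2 $ 1 = Im z * r" "X z $ 2 $ 2 = Re z - Im z * p" for z
    by (simp_all add: X_def)
  have mult: "X z ** X w = X (z * w)" for z w
  proof -
    have "(X z ** X w) $ 1 $ 1 = Re z * Re w + (Re z * Im w + Im z * Re w) * p + Im z * Im w * (p * p + q * r)"
      "(X z ** X w) $ 2 $ 2 = Re z * Re w - (Re z * Im w + Im z * Re w) * p + Im z * Im w * (p * p + q * r)"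
      by (simp_all add: mult_nth algebra_simps)
    then show ?thesis unfolding N by (simp add: matrix2_eq_iff mult_nth algebra_simps)
  qed
  have X_SL2: "X z \<in> SL2" if "norm z = 1" for z
  proof -
    have "X z $ 1 $ 1 * X z $ 2 $ 2 - X z $ 1 $ 2 * X z $ 2 $ 1 = (Re z)\<^sup>2 - (Im z)\<^sup>2 * (p * p + q * r)"
      by (simp add: power2_eq_square algebra_simps)
    also have "\<dots> = (norm z)\<^sup>2" unfolding N by (simp add: cmod_power2)
    finally show ?thesis using that by (simp add: SL2_iff)
  qed
  define z where "z = Complex c s"
  have z: "norm z = 1" using s by (simp add: z_def cmod_def)
  have Xz: "X z = A"
    using sp by (simp add: matrix2_eq_iff z_def c_def field_simps)
  have pow: "moebius_of (X (z ^ n)) = moebius_of A ^^ n" for n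
  proof (induction n)
    case 0
    have "X 1 = mat 1" by (simp add: matrix2_eq_iff)
    then show ?case by (simp add: moebius_of_mat_1)
  next
    case (Suc n)
    have "X (z ^ Suc n) = A ** X (z ^ n)" by (simp add: mult[symmetric] Xz)
    then show ?case using Suc X_SL2[of "z ^ n"] z by (simp add: moebius_of_mult norm_power)
  qed
  have "openin (top_of_set SL2) {B \<in> SL2. moebius_of B \<in> U}"
    using U(1) by (simp add: openin_moebius_topology)
  then obtain W where W: "open W" "{B \<in> SL2. moebius_of B \<in> U} = SL2 \<inter> W"
    unfolding openin_open by blast
  have "X 1 = mat 1" by (simp add: matrix2_eq_iff)
  then have "X 1 \<in> SL2 \<inter> W" using W(2) U(2) moebius_of_mat_1 mat_1_SL2 by (metis (mono_tags, lifting) mem_Collect_eq)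
  then have "X 1 \<in> W" by simp
  have "X = (\<lambda>z. Re z *\<^sub>R X 1 + Im z *\<^sub>R X \<i>)"
    by (simp add: fun_eq_iff matrix2_eq_iff)
  moreover have "continuous_on UNIV (\<lambda>z. Re z *\<^sub>R X 1 + Im z *\<^sub>R X \<i>)"
    by (intro continuous_intros)
  ultimately have "continuous_on UNIV X" by (rule ssubst[where P = "continuous_on UNIV"])
  then have "open (X -` W)" by (rule open_vimage[OF W(1)])
  then obtain \<delta> where \<delta>: "\<delta> > 0" "\<forall>w. dist w 1 < \<delta> \<longrightarrow> w \<in> X -` W"
    using bspec[OF iffD1[OF open_dist], of "X -` W" 1] \<open>X 1 \<in> W\<close> by auto
  obtain n where "norm (z ^ Suc n - 1) < \<delta>" using unit_complex_power_near_1[OF z \<delta>(1)] .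
  then have "X (z ^ Suc n) \<in> W" using \<delta>(2) by (simp add: dist_norm)
  moreover have "X (z ^ Suc n) \<in> SL2" using X_SL2 z by (simp add: norm_power del: power_Suc)
  ultimately have "moebius_of (X (z ^ Suc n)) \<in> U" using W(2) by blast
  then show ?thesis using that by (simp only: pow)
qed

text \<open>Powers of an elliptic element come arbitrarily near to \<open>id\<close>; inverse
  freeness keeps them different from \<open>id\<close>, as an accumulation point requires.\<close>

lemma not_elliptic_if_semidiscrete_inverse_free:
  assumes "semidiscrete (generated_semigroup F)" "inverse_free (generated_semigroup F)"
    and h: "h \<in> generated_semigroup F"
  shows "\<not> elliptic h"
proof
  assume ell: "elliptic h"
  then obtain A where A: "A \<in> SL2" "h = moebius_of A"
    using moebius_lift unfolding elliptic_def by metis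
  then have t: "\<bar>A$1$1 + A$2$2\<bar> < 2" using ell elliptic_iff by blast
  have "id \<in> moebius_topology derived_set_of (generated_semigroup F)"
    unfolding in_derived_set_of
  proof (intro conjI allI impI)
    show "id \<in> topspace moebius_topology"
      using moebius_of_in[OF mat_1_SL2] by (simp add: topspace_moebius_topology moebius_of_mat_1)
    fix U assume "id \<in> U \<and> openin moebius_topology U"
    then obtain n where "h ^^ Suc n \<in> U" using elliptic_power_near_id[OF A(1) t] A(2) by blast
    moreover have "h ^^ Suc n \<in> generated_semigroup F" by (rule generated_semigroup_power[OF h])
    moreover then have "h ^^ Suc n \<noteq> id" using assms(2) unfolding inverse_free_def by metis
    ultimately show "\<exists>y. y \<noteq> id \<and> y \<in> generated_semigroup F \<and> y \<in> U" by blast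
  qed
  then show False using assms(1) by (simp add: semidiscrete_def)
qed

text \<open>The outermost letter of a word confines the image of \<open>J\<close> to that of
  \<open>f\<close> or of \<open>g\<close>. A map near the identity cannot carry a point outside such
  a closed image into it.\<close>

lemma semidiscrete_inverse_free_if_interval:
  assumes f: "f \<in> moebius_transformations" "f ` J \<subset> J" "closedin circle_topology (f ` J)"
    and g: "g \<in> moebius_transformations" "g ` J \<subset> J" "closedin circle_topology (g ` J)"
    and J: "J \<subseteq> extended_reals"
  shows "semidiscrete (generated_semigroup {f, g})" "inverse_free (generated_semigroup {f, g})"
proof -
  have sub: "h ` J \<subseteq> J \<and> (h ` J \<subseteq> f ` J \<or> h ` J \<subseteq> g ` J)" if "h \<in> generated_semigroup {f, g}" for h
    using that
  proof induction
    case (incl h) then show ?case using f(2) g(2) by auto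
  next
    case (comp h k)
    have "(h \<circ> k) ` J = h ` (k ` J)" by (rule image_comp[symmetric])
    also have "\<dots> \<subseteq> h ` J" using comp.IH(2) by (intro image_mono) simp
    finally show ?case using comp.IH(1) by blast
  qed
  \<comment> \<open>Two test points are taken because the two images together may cover
    \<open>J\<close>.\<close>
  obtain p where p: "p \<in> J" "p \<notin> f ` J" using f(2) by blast
  obtain q where q: "q \<in> J" "q \<notin> g ` J" using g(2) by blast
  have out: "h p \<in> f ` J \<or> h q \<in> g ` J" if "h \<in> generated_semigroup {f, g}" for h
    using sub[OF that] p q by blast
  have "id \<notin> generated_semigroup {f, g}" using out[of id] p q by auto
  then show "inverse_free (generated_semigroup {f, g})" by (simp add: inverse_free_def)
  have "p \<in> extended_reals" "q \<in> extended_reals" using p q J by auto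
  then obtain v w where v: "v \<noteq> 0" "p = rproj v" and w: "w \<noteq> 0" "q = rproj w"
    by (elim rproj_surj)
  have op: "openin circle_topology (extended_reals - f ` J)" "openin circle_topology (extended_reals - g ` J)"
    using openin_diff[OF openin_topspace f(3)] openin_diff[OF openin_topspace g(3)]
    by (simp_all only: topspace_circle)
  define U where "U = {h \<in> moebius_transformations. h (rproj v) \<in> extended_reals - f ` J} \<inter>
     {h \<in> moebius_transformations. h (rproj w) \<in> extended_reals - g ` J}"
  show "semidiscrete (generated_semigroup {f, g})"
  proof (rule semidiscreteI)
    show "openin moebius_topology U" unfolding U_def
      by (intro openin_Int openin_moebius_preimage v(1) w(1) op)
    show "id \<in> U"
      using p q J moebius_of_in[OF mat_1_SL2] unfolding U_def v(2)[symmetric] w(2)[symmetric] moebius_of_mat_1 by auto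
    fix h assume h: "h \<in> generated_semigroup {f, g}" "h \<in> U"
    have "h p \<notin> f ` J" "h q \<notin> g ` J" using h(2) unfolding U_def v(2) w(2) by blast+
    then show "h = id" using out[OF h(1)] by blast
  qed
qed

section \<open>Words in two generators and the ping-pong argument\<close>

text \<open>The letter \<open>(b, s)\<close> stands for the first (\<open>b\<close>) or second generator, or its inverse if \<open>\<not> s\<close>.\<close>

definition letter_map :: "('a \<Rightarrow> 'a) \<Rightarrow> ('a \<Rightarrow> 'a) \<Rightarrow> bool \<times> bool \<Rightarrow> 'a \<Rightarrow> 'a" where
  "letter_map f g x = (let h = if fst x then f else g in if snd x then h else inv h)"

definition flip :: "bool \<times> bool \<Rightarrow> bool \<times> bool" where
  "flip x = (fst x, \<not> snd x)"

fun word_map :: "('a \<Rightarrow> 'a) \<Rightarrow> ('a \<Rightarrow> 'a) \<Rightarrow> (bool \<times> bool) list \<Rightarrow> 'a \<Rightarrow> 'a" where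
  "word_map f g [] = id"
| "word_map f g (x # w) = letter_map f g x \<circ> word_map f g w"

abbreviation reduced :: "(bool \<times> bool) list \<Rightarrow> bool" where
  "reduced \<equiv> successively (\<lambda>x y. y \<noteq> flip x)"

text \<open>A coordinate of the word in the abelianised free group, hence unchanged by
  cancellation.\<close>

definition exponent_sum :: "bool \<Rightarrow> (bool \<times> bool) list \<Rightarrow> int" where
  "exponent_sum b w = (\<Sum>x\<leftarrow>w. if fst x = b then (if snd x then 1 else -1) else 0)"

lemma exponent_sum_simps [simp]:
  "exponent_sum b [] = 0"
  "exponent_sum b (x # w) = (if fst x = b then (if snd x then 1 else -1) else 0) + exponent_sum b w"
  "exponent_sum b (u @ w) = exponent_sum b u + exponent_sum b w"
  by (simp_all add: exponent_sum_def)

lemma word_map_append: "word_map f g (u @ w) = word_map f g u \<circ> word_map f g w"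
  by (induction u) (simp_all add: comp_assoc)

lemma letter_map_flip:
  assumes "bij f" "bij g" shows "letter_map f g x \<circ> letter_map f g (flip x) = id"
  using assms by (auto simp: letter_map_def flip_def Let_def bij_is_inj bij_is_surj surj_iff fun_eq_iff
      surj_f_inv_f)

lemma reduce_word:
  assumes "bij f" "bij g"
  obtains w' where "reduced w'" "word_map f g w' = word_map f g w" "\<And>b. exponent_sum b w' = exponent_sum b w"
proof -
  have cancel: "\<exists>u x v. w = u @ x # flip x # v" if "\<not> reduced w" for w :: "(bool \<times> bool) list"
    using that
  proof (induction w)
    case (Cons x w)
    show ?case
    proof (cases "reduced w")
      case True
      then obtain w' where "w = flip x # w'" using Cons.prems by (cases w) auto
      then have "x # w = [] @ x # flip x # w'" by simp
      then show ?thesis by blast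
    next
      case False
      then obtain u y v where "w = u @ y # flip y # v" using Cons.IH by blast
      then have "x # w = (x # u) @ y # flip y # v" by simp
      then show ?thesis by blast
    qed
  qed simp
  have "\<exists>w'. reduced w' \<and> word_map f g w' = word_map f g w \<and> (\<forall>b. exponent_sum b w' = exponent_sum b w)"
  proof (induction w rule: length_induct)
    case (1 w)
    show ?case
    proof (cases "reduced w")
      case False
      then obtain u x v where w: "w = u @ x # flip x # v" using cancel by blast
      have "word_map f g w = word_map f g u \<circ> (letter_map f g x \<circ> letter_map f g (flip x)) \<circ> word_map f g v"
        by (simp add: w word_map_append comp_assoc)
      then have "word_map f g w = word_map f g (u @ v)"
        by (simp add: letter_map_flip[OF assms] word_map_append)
      moreover have "exponent_sum b w = exponent_sum b (u @ v)" for b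
        by (simp add: w flip_def)
      moreover have "length (u @ v) < length w" by (simp add: w)
      ultimately show ?thesis using 1 by metis
    qed blast
  qed
  then show ?thesis using that by blast
qed

lemma generated_group_word:
  assumes "h \<in> generated_group {f, g}" obtains w where "h = word_map f g w"
proof -
  have "\<exists>w. h = word_map f g w"
    using assms
  proof induction
    case one
    have "id = word_map f g []" by simp
    then show ?case by blast
  next
    case (incl h)
    then have "h = word_map f g [(h = f, True)]" by (auto simp: letter_map_def Let_def)
    then show ?case by blast
  next
    case (inv h)
    then have "inv h = word_map f g [(h = f, False)]" by (auto simp: letter_map_def Let_def)
    then show ?case by blast
  next
    case (comp h k)
    then show ?case by (metis word_map_append)
  qed
  then show ?thesis using that by blast
qed

text \<open>Weaker than freeness, but enough to exclude \<open>id\<close> from the semigroup, and it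
  passes through a change of generators by a linear substitution in the exponent sums, with no
  reduced words to follow.\<close>

definition free_pair :: "('a \<Rightarrow> 'a) \<Rightarrow> ('a \<Rightarrow> 'a) \<Rightarrow> bool" where
  "free_pair f g \<longleftrightarrow> (\<forall>w b. word_map f g w = id \<longrightarrow> exponent_sum b w = 0)"

lemma ping_pong_word:
  assumes "\<And>x y. y \<noteq> flip x \<Longrightarrow> letter_map f g x ` X y \<subseteq> X x"
    and "reduced (x # w)" "y \<noteq> flip (last (x # w))"
  shows "word_map f g (x # w) ` X y \<subseteq> X x"
  using assms(2,3)
proof (induction w arbitrary: x)
  case Nil
  then show ?case using assms(1)[of y x] by simp
next
  case (Cons z w)
  have "word_map f g (x # z # w) ` X y = letter_map f g x ` (word_map f g (z # w) ` X y)"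
    by (simp only: word_map.simps(2)[of f g x] image_comp)
  also have "\<dots> \<subseteq> letter_map f g x ` X z" using Cons by (intro image_mono) simp
  also have "\<dots> \<subseteq> X x" using Cons.prems assms(1)[of z x] by simp
  finally show ?case .
qed

text \<open>A nonempty reduced word moves some base point out of its own set. So only
  \<open>id\<close> keeps every base point in place, which gives discreteness of the group as well
  as \<open>free_pair\<close>.\<close>

lemma ping_pong:
  assumes bij: "bij f" "bij g"
    and maps: "\<And>x y. y \<noteq> flip x \<Longrightarrow> letter_map f g x ` X y \<subseteq> X x"
    and disj: "\<And>x y. x \<noteq> y \<Longrightarrow> X x \<inter> X y = {}"
    and pt: "\<And>x. p x \<in> X x"
  shows "h \<in> generated_group {f, g} \<Longrightarrow> (\<And>x. h (p x) \<in> X x) \<Longrightarrow> h = id"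
    and "free_pair f g"
proof -
  have nil: "w = []" if red: "reduced w" and stay: "\<And>x. word_map f g w (p x) \<in> X x" for w
  proof (cases w)
    case (Cons x v)
    \<comment> \<open>There are four letters and two are excluded: the inverse of the last letter,
      to let the ping-pong start, and the first letter, to make the target set disjoint from the
      starting one.\<close>
    have "\<exists>y. y \<noteq> a \<and> y \<noteq> b" for a b :: "bool \<times> bool"
      by (cases a; cases b) (simp add: split_paired_Ex ex_bool_eq, blast)
    then obtain y where y: "y \<noteq> flip (last w)" "y \<noteq> x" by blast
    have "word_map f g w ` X y \<subseteq> X x"
      using ping_pong_word[of f g X, OF maps] red y Cons by blast
    then have "word_map f g w (p y) \<in> X x" using pt by blast
    then show ?thesis using stay[of y] disj[OF y(2)] by blast
  qed
  show "h = id" if h: "h \<in> generated_group {f, g}" "\<And>x. h (p x) \<in> X x"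
  proof -
    obtain w where "h = word_map f g w" using generated_group_word[OF h(1)] .
    moreover obtain w' where "reduced w'" "word_map f g w' = word_map f g w"
      using reduce_word[OF bij] by metis
    ultimately show ?thesis using nil[of w'] h(2) by simp
  qed
  show "free_pair f g"
    unfolding free_pair_def
  proof (intro allI impI)
    fix w b assume "word_map f g w = id"
    moreover obtain w' where "reduced w'" "word_map f g w' = word_map f g w"
      "\<And>b. exponent_sum b w' = exponent_sum b w"
      using reduce_word[OF bij] by metis
    ultimately show "exponent_sum b w = 0" using nil[of w'] pt by (metis exponent_sum_simps(1) id_apply)
  qed
qed

section \<open>Nielsen moves on pairs and on the groups they generate\<close>

lemma free_pair_nielsen:
  assumes "bij f" "bij g" "free_pair f (f \<circ> g)" shows "free_pair f g"
proof -
  \<comment> \<open>Rewrites words in f, g as words in f, fg: g becomes f^-1 (fg), and g^-1 becomes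
    (fg)^-1 f. The exponent sums change by an invertible linear map.\<close>
  define s where "s x = (if fst x then [x] else if snd x then [(True, False), x] else [x, (True, True)])"
    for x :: "bool \<times> bool"
  have id: "inv f \<circ> f = id" "f \<circ> inv f = id"
    using assms by (auto simp: fun_eq_iff bij_is_inj surj_f_inv_f bij_is_surj)
  have "word_map f (f \<circ> g) (s x) = letter_map f g x" for x
  proof -
    have "inv f \<circ> (f \<circ> g) = g" "inv g \<circ> inv f \<circ> f = inv g"
      using id(1) by (simp_all add: o_assoc[symmetric]) (simp add: o_assoc)
    then show ?thesis using assms by (auto simp: s_def letter_map_def Let_def o_inv_distrib)
  qed
  then have map: "word_map f (f \<circ> g) (concat (map s w)) = word_map f g w" for w
    by (induction w) (simp_all add: word_map_append)
  have e: "exponent_sum True (concat (map s w)) = exponent_sum True w - exponent_sum False w"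
    "exponent_sum False (concat (map s w)) = exponent_sum False w" for w
    by (induction w) (auto simp: s_def)
  show ?thesis unfolding free_pair_def
  proof (intro allI impI)
    fix w b assume "word_map f g w = id"
    then have "exponent_sum True (concat (map s w)) = 0" "exponent_sum False (concat (map s w)) = 0"
      using assms(3) map by (auto simp: free_pair_def)
    then show "exponent_sum b w = 0" using e by (cases b) auto
  qed
qed

lemma free_pair_swap:
  assumes "free_pair g f" shows "free_pair f g"
proof -
  define s where "s x = (\<not> fst x, snd x)" for x :: "bool \<times> bool"
  have map: "word_map g f (map s w) = word_map f g w" for w
    by (induction w) (auto simp: s_def letter_map_def Let_def)
  have e: "exponent_sum (\<not> b) (map s w) = exponent_sum b w" for b w
    by (induction w) (auto simp: s_def)
  show ?thesis using assms unfolding free_pair_def by (metis map e)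
qed

text \<open>A product of generators is given by a word of positive total exponent, while a word for
  \<open>id\<close> has total exponent zero.\<close>

lemma free_pair_inverse_free:
  assumes "free_pair f g" shows "inverse_free (generated_semigroup {f, g})"
proof -
  have "\<exists>w. h = word_map f g w \<and> exponent_sum True w + exponent_sum False w > 0"
    if "h \<in> generated_semigroup {f, g}" for h
    using that
  proof induction
    case (incl h)
    then have "h = word_map f g [(h = f, True)]" by (auto simp: letter_map_def Let_def)
    moreover have "exponent_sum True [(h = f, True)] + exponent_sum False [(h = f, True)] > 0" by auto
    ultimately show ?case by blast
  next
    case (comp h k)
    then obtain u v where "h = word_map f g u" "exponent_sum True u + exponent_sum False u > 0"
      "k = word_map f g v" "exponent_sum True v + exponent_sum False v > 0" by blast
    then have "h \<circ> k = word_map f g (u @ v) \<and> exponent_sum True (u @ v) + exponent_sum False (u @ v) > 0"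
      by (simp add: word_map_append)
    then show ?case by blast
  qed
  from this[of id] show ?thesis
    using assms unfolding inverse_free_def free_pair_def by (metis add_0 less_irrefl)
qed

lemma generated_group_mono:
  assumes "\<And>h. h \<in> F \<Longrightarrow> h \<in> generated_group F' \<and> inv h \<in> generated_group F'"
  shows "generated_group F \<subseteq> generated_group F'"
proof
  fix h assume "h \<in> generated_group F"
  then show "h \<in> generated_group F'"
    by induction (blast intro: generated_group.comp generated_group.one dest: assms)+
qed

lemma generated_semigroup_subset_group: "generated_semigroup F \<subseteq> generated_group F"
proof
  fix h assume "h \<in> generated_semigroup F"
  then show "h \<in> generated_group F"
    by induction (blast intro: generated_group.incl generated_group.comp)+
qed

lemma generated_group_nielsen:
  assumes "bij f" "bij g" shows "generated_group {f, f \<circ> g} = generated_group {f, g}"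
proof
  have id: "inv f \<circ> (f \<circ> g) = g" "inv (f \<circ> g) \<circ> f = inv g"
    using assms by (simp_all add: o_inv_distrib bij_is_inj fun_eq_iff)
  note intros = generated_group.incl generated_group.inv generated_group.comp
  have gen: "f \<in> generated_group F" "g \<in> generated_group F" "inv f \<in> generated_group F"
    "inv g \<in> generated_group F" "f \<circ> g \<in> generated_group F" "inv (f \<circ> g) \<in> generated_group F"
    if "F = {f, g} \<or> F = {f, f \<circ> g}" for F
  proof -
    show f: "f \<in> generated_group F" "inv f \<in> generated_group F" using that by (auto intro: intros)
    show g: "g \<in> generated_group F" "inv g \<in> generated_group F"
      using that f intros(3)[of "inv f" F "f \<circ> g"] intros(3)[of "inv (f \<circ> g)" F f]
      unfolding id by (auto intro: generated_group.incl generated_group.inv)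
    show "f \<circ> g \<in> generated_group F" using f g by (intro intros(3))
    show "inv (f \<circ> g) \<in> generated_group F"
      unfolding o_inv_distrib[OF assms] using f g by (intro intros(3))
  qed
  show "generated_group {f, f \<circ> g} \<subseteq> generated_group {f, g}"
    by (rule generated_group_mono) (use gen[of "{f, g}"] in auto)
  show "generated_group {f, g} \<subseteq> generated_group {f, f \<circ> g}"
    by (rule generated_group_mono) (use gen[of "{f, f \<circ> g}"] in auto)
qed

section \<open>Schottky pairs\<close>

text \<open>The properties to be carried back along Nielsen moves. Discreteness is required of the
  group since the semigroup of the reduced pair may be too small, whereas the two groups
  coincide.\<close>

definition schottky_pair :: "(complex option \<Rightarrow> complex option) \<Rightarrow> (complex option \<Rightarrow> complex option) \<Rightarrow> bool" where
  "schottky_pair f g \<longleftrightarrow> schottky_rank_two (generated_group {f, g}) \<and> free_pair f g \<and>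
     semidiscrete (generated_group {f, g})"

lemma schottky_pair_nielsen:
  "bij f \<Longrightarrow> bij g \<Longrightarrow> schottky_pair f (f \<circ> g) \<Longrightarrow> schottky_pair f g"
  using generated_group_nielsen free_pair_nielsen unfolding schottky_pair_def by metis

lemma schottky_pair_swap: "schottky_pair g f \<Longrightarrow> schottky_pair f g"
  using free_pair_swap unfolding schottky_pair_def by (metis insert_commute)

lemma schottky_pair_semigroup:
  assumes "schottky_pair f g"
  shows "semidiscrete (generated_semigroup {f, g})" "inverse_free (generated_semigroup {f, g})"
    "\<exists>G. schottky_rank_two G \<and> generated_semigroup {f, g} \<subseteq> G"
  using assms semidiscrete_subset[OF generated_semigroup_subset_group] free_pair_inverse_free
    generated_semigroup_subset_group unfolding schottky_pair_def by blast+

text \<open>An open set that misses an open arc misses its endpoints too. This permits ping-pong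
  arcs that touch, as parabolic generators require.\<close>

lemma open_disjoint_arc:
  assumes "openin circle_topology W" "W \<inter> open_arc u v = {}" "cross u v \<noteq> 0"
  shows "W \<subseteq> open_arc u (- v)"
proof -
  have "W \<inter> circle_topology closure_of (open_arc u v) = {}"
    using openin_Int_closure_of_eq_empty[OF assms(1)] assms(2) by blast
  then have "W \<inter> closed_arc u v = {}" by (simp only: closure_of_arc[OF assms(3)])
  moreover have "W \<subseteq> extended_reals" using openin_subset[OF assms(1)] by (simp only: topspace_circle)
  ultimately show ?thesis using extended_reals_minus_closed_arc[of u v] by blast
qed

text \<open>\<open>X x\<close> is the arc into which the letter \<open>x\<close> maps everything
  outside the closure of \<open>X (flip x)\<close>. The first generator sends the arc from
  \<open>u1\<close> to \<open>v1\<close>, the exterior of \<open>X (True, False)\<close>, onto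
  \<open>X (True, True)\<close>.\<close>

lemma schottky_pair_if_arcs:
  assumes A: "A \<in> SL2" and B: "B \<in> SL2"
    and uv: "cross u1 v1 \<noteq> 0" "cross u2 v2 \<noteq> 0"
    and X: "X (True, False) = open_arc u1 (- v1)" "X (True, True) = open_arc (app A u1) (app A v1)"
      "X (False, False) = open_arc u2 (- v2)" "X (False, True) = open_arc (app B u2) (app B v2)"
    and disj: "\<And>x y. x \<noteq> y \<Longrightarrow> X x \<inter> X y = {}"
  shows "schottky_pair (moebius_of A) (moebius_of B)"
proof -
  let ?f = "moebius_of A" and ?g = "moebius_of B"
  have bij: "bij ?f" "bij ?g" using A B by (simp_all add: bij_moebius_of)
  have uv': "cross u1 (- v1) \<noteq> 0" "cross u2 (- v2) \<noteq> 0"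
    "cross (app A u1) (app A v1) \<noteq> 0" "cross (app B u2) (app B v2) \<noteq> 0"
    using uv A B by (simp_all add: cross_simps cross_app)
  have Xop: "openin circle_topology (X x) \<and> open_interval (X x)" for x
  proof -
    have "x = (True, False) \<or> x = (True, True) \<or> x = (False, False) \<or> x = (False, True)"
      by (cases x) auto
    then show ?thesis using uv' openin_arc open_interval_arc X by metis
  qed
  have maps: "letter_map ?f ?g x ` X y \<subseteq> X x" if xy: "y \<noteq> flip x" for x y
  proof -
    have W: "openin circle_topology (X y)" "X y \<inter> X (flip x) = {}" using Xop disj xy by blast+
    consider "x = (True, True)" | "x = (True, False)" | "x = (False, True)" | "x = (False, False)"
      by (cases x) auto
    then show ?thesis
    proof cases
      case 1
      then have "X y \<subseteq> open_arc u1 v1"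
        using open_disjoint_arc[OF W(1), of u1 "- v1"] W(2) uv' by (simp add: flip_def X)
      then have "?f ` X y \<subseteq> ?f ` open_arc u1 v1" by (rule image_mono)
      then show ?thesis using 1 by (simp add: letter_map_def X moebius_of_image_arc[OF A])
    next
      case 2
      then have "X y \<subseteq> open_arc (app A u1) (- app A v1)"
        using open_disjoint_arc[OF W(1), of "app A u1" "app A v1"] W(2) uv' by (simp add: flip_def X)
      then have "moebius_of (adj A) ` X y \<subseteq> moebius_of (adj A) ` open_arc (app A u1) (- app A v1)"
        by (rule image_mono)
      then show ?thesis using 2 A
        by (simp add: letter_map_def X moebius_of_image_arc adj_SL2 app_linear app_adj inv_moebius_of)
    next
      case 3
      then have "X y \<subseteq> open_arc u2 v2"
        using open_disjoint_arc[OF W(1), of u2 "- v2"] W(2) uv' by (simp add: flip_def X)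
      then have "?g ` X y \<subseteq> ?g ` open_arc u2 v2" by (rule image_mono)
      then show ?thesis using 3 by (simp add: letter_map_def X moebius_of_image_arc[OF B])
    next
      case 4
      then have "X y \<subseteq> open_arc (app B u2) (- app B v2)"
        using open_disjoint_arc[OF W(1), of "app B u2" "app B v2"] W(2) uv' by (simp add: flip_def X)
      then have "moebius_of (adj B) ` X y \<subseteq> moebius_of (adj B) ` open_arc (app B u2) (- app B v2)"
        by (rule image_mono)
      then show ?thesis using 4 B
        by (simp add: letter_map_def X moebius_of_image_arc adj_SL2 app_linear app_adj inv_moebius_of)
    qed
  qed
  have "\<exists>v. v \<noteq> 0 \<and> rproj v \<in> X x" for x
  proof -
    have "X x \<noteq> {}" "X x \<subseteq> extended_reals"
      using Xop[of x] openin_subset[of circle_topology "X x"] by (auto simp: open_interval_def)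
    then obtain a where "a \<in> X x" "a \<in> extended_reals" by blast
    then show ?thesis by (elim rproj_surj) auto
  qed
  then obtain q where q: "\<And>x. q x \<noteq> 0" "\<And>x. rproj (q x) \<in> X x" by metis
  note pp = ping_pong[of ?f ?g X "\<lambda>x. rproj (q x)", OF bij maps disj q(2)]
  \<comment> \<open>The four base points of the ping-pong argument, one per letter, cut out the
    neighbourhood of \<open>id\<close>.\<close>
  define U where "U = (\<Inter>x. {h \<in> moebius_transformations. h (rproj (q x)) \<in> X x})"
  have "semidiscrete (generated_group {?f, ?g})"
  proof (rule semidiscreteI)
    show "openin moebius_topology U"
      unfolding U_def using Xop q openin_moebius_preimage by (intro openin_INT2) auto
    show "id \<in> U" using moebius_of_in[OF mat_1_SL2] q by (simp add: U_def moebius_of_mat_1)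
    show "h = id" if "h \<in> generated_group {?f, ?g}" "h \<in> U" for h
      using that pp(1)[of h] by (auto simp: U_def)
  qed
  moreover have "schottky_rank_two (generated_group {?f, ?g})"
    unfolding schottky_rank_two_def
  proof (rule bexI[of _ ?f], rule bexI[of _ ?g], intro conjI refl, rule exI[of _ "X (True, False)"],
      rule exI[of _ "X (True, True)"], rule exI[of _ "X (False, False)"], rule exI[of _ "X (False, True)"],
      intro conjI)
    show "?f ` (extended_reals - circle_topology closure_of X (True, False)) = X (True, True)"
      "?g ` (extended_reals - circle_topology closure_of X (False, False)) = X (False, True)"
      unfolding X closure_of_arc[OF uv'(1)] closure_of_arc[OF uv'(2)] extended_reals_minus_closed_arc
      using A B by (simp_all add: moebius_of_image_arc)
  qed (simp_all add: Xop disj A B)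
  ultimately show ?thesis using pp(2) by (simp add: schottky_pair_def)
qed

section \<open>Ping-pong arcs symmetric under a common reflection\<close>

text \<open>The last hypothesis places the line of (s, t) between those of (b, a+1) and (a+1, c). As
  bc < (a+1)^2, after a choice of sign both factors are negative and s, t are positive, that is
  b/(a+1) < s/t < (a+1)/c with the second bound void for c = 0. The conclusions do not depend on
  that sign.\<close>

lemma arc_position:
  fixes a b c s t :: real
  assumes "a \<ge> 1" "b \<ge> 0" "c \<ge> 0" "b * c = a\<^sup>2 - 1" "(b * t - (a + 1) * s) * (c * s - (a + 1) * t) > 0"
  shows "s * t > 0" "b * t\<^sup>2 < (a + 1) * (s * t)" "c * s\<^sup>2 < (a + 1) * (s * t)"
proof -
  have less: "b * c < (a + 1) * (a + 1)"
    using assms(1,4) by (simp add: power2_eq_square algebra_simps)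
  have nopos: "\<not> (b * t > (a + 1) * s \<and> c * s > (a + 1) * t \<and> s > 0)" for s t
  proof
    assume *: "b * t > (a + 1) * s \<and> c * s > (a + 1) * t \<and> s > 0"
    then have "b * t > 0" using assms(1) by (smt (verit) mult_pos_pos)
    then have "b > 0" using assms(2) by (metis less_eq_real_def mult_zero_left order_less_irrefl)
    have "(a + 1) * ((a + 1) * s) < (a + 1) * (b * t)" using * assms(1) by (intro mult_strict_left_mono) auto
    also have "\<dots> = b * ((a + 1) * t)" by simp
    also have "\<dots> < b * (c * s)" using * \<open>b > 0\<close> by (intro mult_strict_left_mono) auto
    finally have "(a + 1) * (a + 1) * s < b * c * s" by (simp add: mult.assoc)
    then show False using less * by (simp add: mult_less_cancel_right)
  qed
  have key: "s > 0 \<and> t > 0" if "b * t < (a + 1) * s" "c * s < (a + 1) * t" for s t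
  proof -
    have "s > 0"
    proof (rule ccontr)
      assume "\<not> s > 0"
      then have "(a + 1) * s \<le> 0" using assms(1) by (simp add: mult_nonneg_nonpos)
      then have "b * t < 0" using that by linarith
      then have t: "t < 0" using assms(2) by (simp add: mult_less_0_iff)
      then have "(a + 1) * t < 0" using assms(1) by (simp add: mult_pos_neg)
      then have "c * s < 0" using that by linarith
      then have "s < 0" using assms(3) by (simp add: mult_less_0_iff)
      then show False using nopos[where s = "- s" and t = "- t"] that by simp
    qed
    moreover have "(a + 1) * t > 0"
      using that(2) assms(3) \<open>s > 0\<close> by (smt (verit) mult_nonneg_nonneg)
    then have "t > 0" using assms(1) by (simp add: zero_less_mult_iff)
    ultimately show ?thesis by simp
  qed
  obtain s' t' where st: "(s' = s \<and> t' = t) \<or> (s' = - s \<and> t' = - t)"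
    "b * t' < (a + 1) * s'" "c * s' < (a + 1) * t'"
  proof (cases "b * t < (a + 1) * s")
    case True
    then show ?thesis using assms(5) that[of s t] by (auto simp: zero_less_mult_iff)
  next
    case False
    then show ?thesis using assms(5) that[of "- s" "- t"] by (auto simp: zero_less_mult_iff)
  qed
  have pos: "s' > 0" "t' > 0" using key[OF st(2,3)] by auto
  have eq: "s * t = s' * t'" "s\<^sup>2 = s' * s'" "t\<^sup>2 = t' * t'"
    using st(1) by (auto simp: power2_eq_square)
  show "s * t > 0" using pos eq by simp
  have "(b * t') * t' < ((a + 1) * s') * t'" using st pos by (intro mult_strict_right_mono)
  then show "b * t\<^sup>2 < (a + 1) * (s * t)" unfolding eq by (simp add: mult.assoc)
  have "(c * s') * s' < ((a + 1) * t') * s'" using st pos by (intro mult_strict_right_mono)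
  then show "c * s\<^sup>2 < (a + 1) * (s * t)" unfolding eq by (simp add: mult_ac)
qed

text \<open>The product has trace \<open>2 * a * p - b * r - c * q\<close>, so the last hypothesis
  says trace at most -2. Equal diagonal entries mean that the reflection fixing \<open>e1\<close>
  and negating \<open>e2\<close> conjugates both maps to their inverses. It exchanges positive and
  negative arcs, so the essential point is that the two arcs in the positive quadrant are
  disjoint.\<close>

lemma schottky_pair_normal_form:
  assumes AB: "A \<in> SL2" "B \<in> SL2" and D: "cross e1 e2 \<noteq> 0"
    and A: "app A e1 = a *\<^sub>R e1 + c *\<^sub>R e2" "app A e2 = b *\<^sub>R e1 + a *\<^sub>R e2"
    and B: "app B e1 = p *\<^sub>R e1 - r *\<^sub>R e2" "app B e2 = p *\<^sub>R e2 - q *\<^sub>R e1"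
    and a: "a \<ge> 1" "b \<ge> 0" "c \<ge> 0" "b * c = a\<^sup>2 - 1"
    and p: "p \<ge> 1" "q \<ge> 0" "r \<ge> 0" "q * r = p\<^sup>2 - 1"
    and z: "b * r + c * q \<ge> 2 * a * p + 2"
  shows "schottky_pair (moebius_of A) (moebius_of B)"
proof -
  \<comment> \<open>In the coordinates given by \<open>e1\<close> and \<open>e2\<close>, the arc \<open>P b c a\<close> lies in the positive quadrant, and
    \<open>N b c a\<close> is its mirror image; \<open>Q\<close> expresses membership in \<open>P\<close>.\<close>
  define P where "P b c a = open_arc (b *\<^sub>R e1 + (a + 1) *\<^sub>R e2) ((a + 1) *\<^sub>R e1 + c *\<^sub>R e2)" for a b c :: real
  define N where "N b c a = open_arc ((a + 1) *\<^sub>R e2 - b *\<^sub>R e1) (c *\<^sub>R e2 - (a + 1) *\<^sub>R e1)" for a b c :: real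
  define Q where "Q b c a s t \<longleftrightarrow> (b * t - (a + 1) * s) * (c * s - (a + 1) * t) > 0" for a b c s t :: real
  have D2: "0 < (cross e1 e2)\<^sup>2" using D by simp
  have inP: "\<exists>s t. x = rproj (s *\<^sub>R e1 + t *\<^sub>R e2) \<and> s *\<^sub>R e1 + t *\<^sub>R e2 \<noteq> 0" if "x \<in> extended_reals" for x
    using that by (elim rproj_surj) (metis basis_decompose[OF D])
  have memP: "rproj (s *\<^sub>R e1 + t *\<^sub>R e2) \<in> P b c a \<longleftrightarrow> Q b c a s t"
    if "s *\<^sub>R e1 + t *\<^sub>R e2 \<noteq> 0" for s t a b c
  proof -
    have "cross (b *\<^sub>R e1 + (a + 1) *\<^sub>R e2) (s *\<^sub>R e1 + t *\<^sub>R e2) = (b * t - (a + 1) * s) * cross e1 e2"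
      "cross (s *\<^sub>R e1 + t *\<^sub>R e2) ((a + 1) *\<^sub>R e1 + c *\<^sub>R e2) = (c * s - (a + 1) * t) * cross e1 e2"
      using cross_swap[of e1 e2] by (simp_all add: cross_simps algebra_simps)
    then have "cross (b *\<^sub>R e1 + (a + 1) *\<^sub>R e2) (s *\<^sub>R e1 + t *\<^sub>R e2) *
        cross (s *\<^sub>R e1 + t *\<^sub>R e2) ((a + 1) *\<^sub>R e1 + c *\<^sub>R e2) =
        ((b * t - (a + 1) * s) * (c * s - (a + 1) * t)) * (cross e1 e2)\<^sup>2"
      by (simp add: power2_eq_square)
    then show ?thesis using D2 unfolding P_def Q_def rproj_in_arc_iff[OF that]
      by (simp only: zero_less_mult_iff) auto
  qed
  have memN: "rproj (s *\<^sub>R e1 + t *\<^sub>R e2) \<in> N b c a \<longleftrightarrow> Q b c a (- s) t"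
    if "s *\<^sub>R e1 + t *\<^sub>R e2 \<noteq> 0" for s t a b c
  proof -
    have "cross ((a + 1) *\<^sub>R e2 - b *\<^sub>R e1) (s *\<^sub>R e1 + t *\<^sub>R e2) = - (b * t - (a + 1) * (- s)) * cross e1 e2"
      "cross (s *\<^sub>R e1 + t *\<^sub>R e2) (c *\<^sub>R e2 - (a + 1) *\<^sub>R e1) = - (c * (- s) - (a + 1) * t) * cross e1 e2"
      using cross_swap[of e1 e2] by (simp_all add: cross_simps cross_diff algebra_simps)
    then have "cross ((a + 1) *\<^sub>R e2 - b *\<^sub>R e1) (s *\<^sub>R e1 + t *\<^sub>R e2) *
        cross (s *\<^sub>R e1 + t *\<^sub>R e2) (c *\<^sub>R e2 - (a + 1) *\<^sub>R e1) =
        ((b * t - (a + 1) * (- s)) * (c * (- s) - (a + 1) * t)) * (cross e1 e2)\<^sup>2"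
      by (simp only: power2_eq_square) (simp add: algebra_simps)
    then show ?thesis using D2 unfolding N_def Q_def rproj_in_arc_iff[OF that]
      by (simp only: zero_less_mult_iff) auto
  qed
  \<comment> \<open>Equivalently, one of the two arcs ends no later than the other begins. If both
    inequalities failed, the product of the gaps would be positive; yet with the bound 2ap + 2 and
    bcqr = (a^2-1)(p^2-1) it is at most 0.\<close>
  have big: "c * q \<ge> (a + 1) * (p + 1) \<or> b * r \<ge> (a + 1) * (p + 1)"
  proof (rule ccontr)
    assume "\<not> ?thesis"
    then have "0 < ((a + 1) * (p + 1) - b * r) * ((a + 1) * (p + 1) - c * q)" by simp
    also have "\<dots> = (a + 1) * (p + 1) * ((a + 1) * (p + 1) - (b * r + c * q)) + (b * c) * (q * r)"
      by (simp add: algebra_simps)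
    also have "\<dots> \<le> (a + 1) * (p + 1) * ((a + 1) * (p + 1) - (2 * a * p + 2)) + (b * c) * (q * r)"
      using z a p by (intro add_right_mono mult_left_mono) auto
    also have "\<dots> = 0" unfolding a(4) p(4) by (simp add: power2_eq_square algebra_simps)
    finally show False by simp
  qed
  \<comment> \<open>A common point bounds the slope s/t from both arcs. Pairing a bound from one
    with the opposite bound from the other cancels the slope, and both pairings together contradict
    \<open>big\<close>.\<close>
  have disjQ: False if "Q b c a s t" "Q q r p s t" for s t
  proof -
    note 1 = arc_position[OF a that(1)[unfolded Q_def]]
    note 2 = arc_position[OF p that(2)[unfolded Q_def]]
    have st: "(s * t)\<^sup>2 > 0" using 1(1) by (rule zero_less_power)
    have "(c * s\<^sup>2) * (q * t\<^sup>2) < ((a + 1) * (s * t)) * ((p + 1) * (s * t))"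
      by (rule mult_strict_mono') (use 1(3) 2(2) a p in simp_all)
    then have "(c * q) * (s * t)\<^sup>2 < ((a + 1) * (p + 1)) * (s * t)\<^sup>2" by (simp add: power2_eq_square mult_ac)
    then have cq: "c * q < (a + 1) * (p + 1)" using st by (simp only: mult_less_cancel_right)
    have "(b * t\<^sup>2) * (r * s\<^sup>2) < ((a + 1) * (s * t)) * ((p + 1) * (s * t))"
      by (rule mult_strict_mono') (use 1(2) 2(3) a p in simp_all)
    then have "(b * r) * (s * t)\<^sup>2 < ((a + 1) * (p + 1)) * (s * t)\<^sup>2" by (simp add: power2_eq_square mult_ac)
    then have "b * r < (a + 1) * (p + 1)" using st by (simp only: mult_less_cancel_right)
    then show False using cq big by simp
  qed
  have sub: "P b c a \<subseteq> extended_reals" "N b c a \<subseteq> extended_reals" for a b c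
    by (simp_all add: P_def N_def arc_subset_extended_reals)
  have disjI: "S \<inter> T = {}" if S: "S \<subseteq> extended_reals"
    and ST: "\<And>s t. s *\<^sub>R e1 + t *\<^sub>R e2 \<noteq> 0 \<Longrightarrow> rproj (s *\<^sub>R e1 + t *\<^sub>R e2) \<in> S \<Longrightarrow>
      rproj (s *\<^sub>R e1 + t *\<^sub>R e2) \<in> T \<Longrightarrow> False" for S T
  proof -
    have "x \<notin> T" if "x \<in> S" for x
      using inP[of x] S that ST by blast
    then show ?thesis by blast
  qed
  have PP: "P b c a \<inter> P q r p = {}"
    by (rule disjI[OF sub(1)]) (metis memP disjQ)
  have NN: "N b c a \<inter> N q r p = {}"
    by (rule disjI[OF sub(2)]) (metis memN disjQ)
  have posQ: "s * t > 0" if "Q b c a s t \<or> Q q r p s t" for s t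
    using that arc_position(1)[OF a] arc_position(1)[OF p] unfolding Q_def by blast
  have sgn: "\<not> (Q b c a s t \<or> Q q r p s t) \<or> \<not> (Q b c a (- s) t \<or> Q q r p (- s) t)" for s t
    using posQ[of s t] posQ[of "- s" t] by auto
  have PN: "P b c a \<inter> N b c a = {}" "P b c a \<inter> N q r p = {}" "P q r p \<inter> N b c a = {}" "P q r p \<inter> N q r p = {}"
    by (rule disjI[OF sub(1)], metis memP memN sgn)+
  \<comment> \<open>The images under \<open>A\<close> of \<open>u1\<close> and \<open>v1\<close>,
    namely (b, a+1) and (a+1, c), are eigenvectors of A diag(1,-1), for -1 and 1. Written with a+1
    instead of a-1 they stay nonzero when a = 1.\<close>
  define u1 where "u1 = (a + 1) *\<^sub>R e2 - b *\<^sub>R e1"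
  define v1 where "v1 = (a + 1) *\<^sub>R e1 - c *\<^sub>R e2"
  define u2 where "u2 = q *\<^sub>R e1 + (p + 1) *\<^sub>R e2"
  define v2 where "v2 = - ((p + 1) *\<^sub>R e1 + r *\<^sub>R e2)"
  have app_diff: "app C (x - y) = app C x - app C y" for C x y
    using app_linear(1)[of C x "- y"] app_linear(3)[of C y] by simp
  have c1: "a * (a + 1) - b * c = a + 1" "p * (p + 1) - q * r = p + 1"
    unfolding a(4) p(4) by (simp_all add: power2_eq_square algebra_simps)
  have "app A u1 = ((a + 1) * b - b * a) *\<^sub>R e1 + (a * (a + 1) - b * c) *\<^sub>R e2"
    by (simp add: u1_def app_linear app_diff A algebra_simps)
  then have Au: "app A u1 = b *\<^sub>R e1 + (a + 1) *\<^sub>R e2" unfolding c1 by (simp add: algebra_simps)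
  have "app A v1 = (a * (a + 1) - b * c) *\<^sub>R e1 + ((a + 1) * c - c * a) *\<^sub>R e2"
    by (simp add: v1_def app_linear app_diff A algebra_simps)
  then have Av: "app A v1 = (a + 1) *\<^sub>R e1 + c *\<^sub>R e2" unfolding c1 by (simp add: algebra_simps)
  have "app B u2 = (q * p - (p + 1) * q) *\<^sub>R e1 + (p * (p + 1) - q * r) *\<^sub>R e2"
    by (simp add: u2_def app_linear app_diff B algebra_simps)
  then have Bu: "app B u2 = (p + 1) *\<^sub>R e2 - q *\<^sub>R e1" unfolding c1 by (simp add: algebra_simps)
  have "app B v2 = (- (p * (p + 1) - q * r)) *\<^sub>R e1 + ((p + 1) * r - r * p) *\<^sub>R e2"
    by (simp add: v2_def app_linear app_diff B algebra_simps)
  then have Bv: "app B v2 = r *\<^sub>R e2 - (p + 1) *\<^sub>R e1" unfolding c1 by (simp add: algebra_simps)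
  define X where "X x = (if fst x then if snd x then P b c a else N b c a
     else if snd x then N q r p else P q r p)" for x :: "bool \<times> bool"
  show ?thesis
  proof (rule schottky_pair_if_arcs[OF AB, where X = X])
    have "cross u1 v1 = (b * c - (a + 1)\<^sup>2) * cross e1 e2"
      using cross_swap[of e1 e2]
      by (simp add: u1_def v1_def cross_simps cross_diff power2_eq_square algebra_simps)
    also have "b * c - (a + 1)\<^sup>2 = - 2 * (a + 1)" unfolding a(4) by (simp add: power2_eq_square algebra_simps)
    finally show "cross u1 v1 \<noteq> 0" using D a(1) by simp
    have "cross u2 v2 = - (q * r - (p + 1)\<^sup>2) * cross e1 e2"
      using cross_swap[of e1 e2]
      by (simp add: u2_def v2_def cross_simps cross_diff power2_eq_square algebra_simps)
    also have "q * r - (p + 1)\<^sup>2 = - 2 * (p + 1)" unfolding p(4) by (simp add: power2_eq_square algebra_simps)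
    finally show "cross u2 v2 \<noteq> 0" using D p(1) by simp
    show "X (True, False) = open_arc u1 (- v1)" by (simp add: X_def N_def u1_def v1_def)
    show "X (True, True) = open_arc (app A u1) (app A v1)" unfolding Au Av by (simp add: X_def P_def)
    show "X (False, False) = open_arc u2 (- v2)" by (simp add: X_def P_def u2_def v2_def add.commute)
    show "X (False, True) = open_arc (app B u2) (app B v2)" unfolding Bu Bv by (simp add: X_def N_def)
    fix x y :: "bool \<times> bool" assume "x \<noteq> y"
    then show "X x \<inter> X y = {}"
      using PP NN PN by (cases x; cases y) (auto simp: X_def)
  qed
qed

section \<open>Trace identities and the reflection given by the Lie bracket\<close>

lemma trace_cross:
  "(A$1$1 + A$2$2) * cross u v = cross (app A u) v + cross u (app A v)"
  by (simp add: cross_def app_def algebra_simps)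

text \<open>The Fricke polynomial: the trace of the commutator of two \<open>SL2\<close> matrices in
  terms of the traces of both and of their product.\<close>

definition comm_trace :: "real \<Rightarrow> real \<Rightarrow> real \<Rightarrow> real" where
  "comm_trace x y z = x\<^sup>2 + y\<^sup>2 + z\<^sup>2 - x * y * z - 2"

text \<open>The bracket is traceless. If the commutator trace exceeds 2, it has two opposite real
  eigenvalues and is a multiple of a reflection.\<close>

lemma det_lie_bracket:
  assumes "A \<in> SL2" "B \<in> SL2"
  shows "det (A ** B - B ** A) =
    2 - comm_trace (A$1$1 + A$2$2) (B$1$1 + B$2$2) ((A ** B)$1$1 + (A ** B)$2$2)"
proof -
  let ?x = "A$1$1 + A$2$2" and ?y = "B$1$1 + B$2$2" and ?z = "(A ** B)$1$1 + (A ** B)$2$2"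
  let ?dA = "A$1$1 * A$2$2 - A$1$2 * A$2$1" and ?dB = "B$1$1 * B$2$2 - B$1$2 * B$2$1"
  have "det (A ** B - B ** A) = 4 * ?dA * ?dB - ?x\<^sup>2 * ?dB - ?y\<^sup>2 * ?dA - ?z\<^sup>2 + ?x * ?y * ?z"
    by (simp add: det_2 mult_nth power2_eq_square algebra_simps)
  then show ?thesis using assms by (simp add: SL2_iff comm_trace_def)
qed

text \<open>By Cayley-Hamilton \<open>adj A\<close> is the trace minus \<open>A\<close>, so these
  say that moving the bracket across \<open>A\<close> or \<open>B\<close> turns the matrix into its
  adjugate. Where the bracket is invertible, it conjugates both maps to their inverses.\<close>

lemma lie_bracket_anticommute:
  defines "M A B \<equiv> A ** B - B ** A"
  shows "app (M A B) (app A v) = (A$1$1 + A$2$2) *\<^sub>R app (M A B) v - app A (app (M A B) v)"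
    and "app (M A B) (app B v) = (B$1$1 + B$2$2) *\<^sub>R app (M A B) v - app B (app (M A B) v)"
  by (simp_all add: M_def app_def mult_nth prod_eq_iff algebra_simps)

text \<open>Comparing coefficients of \<open>e1\<close> in \<open>anti\<close> shows that the first
  diagonal entry is half the trace, hence so is the second.\<close>

lemma half_trace_form:
  assumes "C \<in> SL2" and D: "cross e1 e2 \<noteq> 0" and M: "app M e1 = m *\<^sub>R e1" "app M e2 = (- m) *\<^sub>R e2" "m \<noteq> 0"
    and anti: "\<And>v. app M (app C v) = (C$1$1 + C$2$2) *\<^sub>R app M v - app C (app M v)"
  obtains b c where "app C e1 = ((C$1$1 + C$2$2) / 2) *\<^sub>R e1 + c *\<^sub>R e2"
    "app C e2 = b *\<^sub>R e1 + ((C$1$1 + C$2$2) / 2) *\<^sub>R e2" "b * c = ((C$1$1 + C$2$2) / 2)\<^sup>2 - 1"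
proof -
  let ?t = "C$1$1 + C$2$2"
  obtain a c where 1: "app C e1 = a *\<^sub>R e1 + c *\<^sub>R e2" using basis_decompose[OF D] .
  obtain b d where 2: "app C e2 = b *\<^sub>R e1 + d *\<^sub>R e2" using basis_decompose[OF D] .
  have "(?t * m - m * a) * cross e1 e2 = cross (?t *\<^sub>R app M e1 - app C (app M e1)) e2"
    by (simp add: M 1 app_linear cross_simps cross_diff algebra_simps)
  also have "\<dots> = cross (app M (app C e1)) e2" by (simp only: anti)
  also have "\<dots> = (m * a) * cross e1 e2" by (simp add: M 1 app_linear cross_simps cross_diff)
  finally have "(m * ?t - m * (2 * a)) * cross e1 e2 = 0" by (simp add: algebra_simps)
  then have "m * ?t = m * (2 * a)" using D by simp
  then have a: "a = ?t / 2" using M(3) by (simp only: mult_cancel_left) auto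
  have "(a + d) * cross e1 e2 = cross (app C e1) e2 + cross e1 (app C e2)"
    by (simp add: 1 2 cross_simps algebra_simps)
  also have "\<dots> = ?t * cross e1 e2" by (simp only: trace_cross)
  finally have "a + d = ?t" using D by (simp only: mult_cancel_right) auto
  moreover have "d = t / 2" if "a + d = t" "a = t / 2" for t using that by simp
  ultimately have d: "d = ?t / 2" using a by blast
  have "(a * d - b * c) * cross e1 e2 = cross (app C e1) (app C e2)"
    using cross_swap[of e1 e2] by (simp add: 1 2 cross_simps algebra_simps)
  also have "\<dots> = 1 * cross e1 e2" using cross_app[OF assms(1)] by simp
  finally have "a * d - b * c = 1" using D by (simp only: mult_cancel_right) auto
  then have "b * c = (?t / 2)\<^sup>2 - 1" using a d by (simp add: power2_eq_square)
  then show ?thesis using that 1 2 a d by blast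
qed

lemma schottky_pair_negative_trace:
  assumes AB: "A \<in> SL2" "B \<in> SL2" and x: "A$1$1 + A$2$2 \<ge> 2" and y: "B$1$1 + B$2$2 \<ge> 2"
    and z: "(A ** B)$1$1 + (A ** B)$2$2 \<le> -2"
  shows "schottky_pair (moebius_of A) (moebius_of B)"
proof -
  define x' where "x' = A$1$1 + A$2$2"
  define y' where "y' = B$1$1 + B$2$2"
  define z' where "z' = (A ** B)$1$1 + (A ** B)$2$2"
  define M where "M = A ** B - B ** A"
  have xyz: "x' \<ge> 2" "y' \<ge> 2" "z' \<le> -2" using x y z by (simp_all add: x'_def y'_def z'_def)
  then have "x' * y' \<ge> 2 * 2" by (intro mult_mono) auto
  then have "(x' * y') * (- z') \<ge> 4 * 2" using xyz by (intro mult_mono) auto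
  moreover have "x'\<^sup>2 \<ge> 2\<^sup>2" "y'\<^sup>2 \<ge> 2\<^sup>2" using xyz power_mono[of 2 x' 2] power_mono[of 2 y' 2] by simp_all
  ultimately have "comm_trace x' y' z' > 2"
    unfolding comm_trace_def using zero_le_power2[of z']
    by (simp only: mult_minus_right power2_eq_square[of 2])
  then have det: "det M < 0" using det_lie_bracket[OF AB] by (simp add: M_def x'_def y'_def z'_def)
  define m where "m = sqrt (- det M)"
  have m: "m > 0" "m\<^sup>2 = - det M" using det by (simp_all add: m_def)
  have tr0: "M$1$1 + M$2$2 = 0" by (simp add: M_def mult_nth algebra_simps)
  obtain e1 where e1: "e1 \<noteq> 0" "app M e1 = m *\<^sub>R e1"
    using eigenvector_exists[of m M] m tr0 by auto
  obtain e2 where e2: "e2 \<noteq> 0" "app M e2 = (- m) *\<^sub>R e2"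
    using eigenvector_exists[of "- m" M] m tr0 by auto
  have D: "cross e1 e2 \<noteq> 0"
  proof
    assume "cross e1 e2 = 0"
    then obtain r where "e2 = r *\<^sub>R e1" using cross_sgn_cong e1 e2 by metis
    then have "m *\<^sub>R e2 = (- m) *\<^sub>R e2" using e1 e2 by (metis app_linear(2) scaleR_left_commute)
    then have "m = - m \<or> e2 = 0" by (simp only: scaleR_cancel_right)
    then show False using e2 m by simp
  qed
  have anti: "app M (app A v) = (A$1$1 + A$2$2) *\<^sub>R app M v - app A (app M v)"
    "app M (app B v) = (B$1$1 + B$2$2) *\<^sub>R app M v - app B (app M v)" for v
    unfolding M_def by (rule lie_bracket_anticommute)+
  obtain b c where A: "app A e1 = (x' / 2) *\<^sub>R e1 + c *\<^sub>R e2" "app A e2 = b *\<^sub>R e1 + (x' / 2) *\<^sub>R e2"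
    "b * c = (x' / 2)\<^sup>2 - 1"
    using half_trace_form[OF AB(1) D e1(2) e2(2) less_imp_neq[OF m(1), symmetric] anti(1)]
    unfolding x'_def by metis
  obtain q r where B: "app B e1 = (y' / 2) *\<^sub>R e1 + r *\<^sub>R e2" "app B e2 = q *\<^sub>R e1 + (y' / 2) *\<^sub>R e2"
    "q * r = (y' / 2)\<^sup>2 - 1"
    using half_trace_form[OF AB(2) D e1(2) e2(2) less_imp_neq[OF m(1), symmetric] anti(2)]
    unfolding y'_def by metis
  define a where "a = x' / 2"
  define p where "p = y' / 2"
  have a: "a \<ge> 1" "b * c = a\<^sup>2 - 1" and p: "p \<ge> 1" "q * r = p\<^sup>2 - 1"
    using A B xyz by (simp_all add: a_def p_def)
  have "z' * cross e1 e2 = cross (app (A ** B) e1) e2 + cross e1 (app (A ** B) e2)"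
    unfolding z'_def by (rule trace_cross)
  also have "\<dots> = (2 * a * p + b * r + c * q) * cross e1 e2"
    by (simp add: app_mult A B app_linear cross_simps a_def p_def algebra_simps)
  finally have z: "2 * a * p + b * r + c * q \<le> -2" using D xyz(3) by (simp only: mult_cancel_right) auto
  have "a\<^sup>2 \<ge> 1" "p\<^sup>2 \<ge> 1" using a p by simp_all
  then have bc: "b * c \<ge> 0" and qr: "q * r \<ge> 0" using a p by simp_all
  have "a * p \<ge> 0" using a p by simp
  then have "b * r < 0 \<or> c * q < 0" using z by linarith
  then consider "b \<ge> 0" "c \<ge> 0" "q \<le> 0" "r \<le> 0" | "b \<le> 0" "c \<le> 0" "q \<ge> 0" "r \<ge> 0"
    using bc qr by (auto simp: mult_less_0_iff zero_le_mult_iff)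
  then show ?thesis
  proof cases
    case 1
    show ?thesis
      by (rule schottky_pair_normal_form[OF AB D, where a = a and b = b and c = c and p = p and q = "- q" and r = "- r"])
         (use 1 a p z A B in \<open>simp_all add: a_def p_def\<close>)
  next
    case 2
    \<comment> \<open>Replacing \<open>e2\<close> by its negative flips all four off-diagonal signs
      and reduces this case to the previous normal form.\<close>
    have D': "cross e1 (- e2) \<noteq> 0" using D by (simp add: cross_simps)
    show ?thesis
      by (rule schottky_pair_normal_form[OF AB D', where a = a and b = "- b" and c = "- c" and p = p and q = q and r = r])
         (use 2 a p z A B in \<open>simp_all add: a_def p_def app_linear\<close>)
  qed
qed

section \<open>Nielsen moves in trace coordinates\<close>

abbreviation mtrace :: "real^2^2 \<Rightarrow> real" where
  "mtrace A \<equiv> A$1$1 + A$2$2"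

text \<open>Stated by traces alone, so that it can be followed through Nielsen moves without
  eigenvectors. The traces of AB and of AB^-1 add up to the product of the traces; the second
  inequality says that AB has the smaller one, a distinction which the commutator trace does not
  see.\<close>

definition antiparallel :: "real^2^2 \<Rightarrow> real^2^2 \<Rightarrow> bool" where
  "antiparallel A B \<longleftrightarrow> comm_trace (mtrace A) (mtrace B) (mtrace (A ** B)) > 2 \<and>
     2 * mtrace (A ** B) < mtrace A * mtrace B"

lemma mtrace_swap: "mtrace (B ** A) = mtrace (A ** B)"
  by (simp add: mult_nth algebra_simps)

lemma mtrace_nielsen:
  assumes "A \<in> SL2" shows "mtrace (A ** (A ** B)) = mtrace A * mtrace (A ** B) - mtrace B"
proof -
  have "mtrace (A ** (A ** B)) = mtrace A * mtrace (A ** B) - (A$1$1 * A$2$2 - A$1$2 * A$2$1) * mtrace B"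
    by (simp add: mult_nth algebra_simps)
  then show ?thesis using assms by (simp add: SL2_iff)
qed

text \<open>A Vieta jump: for fixed \<open>x\<close>, \<open>z\<close> and value, \<open>y\<close>
  and \<open>x * z - y\<close> are the two roots of one quadratic.\<close>

lemma comm_trace_nielsen: "comm_trace x z (x * z - y) = comm_trace x y z"
  by (simp add: comm_trace_def power2_eq_square algebra_simps)

lemma comm_trace_swap: "comm_trace y x z = comm_trace x y z"
  by (simp add: comm_trace_def algebra_simps)

lemma mtrace_commutator:
  assumes "A \<in> SL2" "B \<in> SL2"
  shows "mtrace (A ** B ** adj A ** adj B) = comm_trace (mtrace A) (mtrace B) (mtrace (A ** B))"
proof -
  let ?dA = "A$1$1 * A$2$2 - A$1$2 * A$2$1" and ?dB = "B$1$1 * B$2$2 - B$1$2 * B$2$1"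
  have "mtrace (A ** B ** adj A ** adj B) =
     (mtrace A)\<^sup>2 * ?dB + (mtrace B)\<^sup>2 * ?dA + (mtrace (A ** B))\<^sup>2
       - mtrace A * mtrace B * mtrace (A ** B) - 2 * ?dA * ?dB"
    by (simp add: mult_nth power2_eq_square algebra_simps)
  then show ?thesis using assms by (simp add: SL2_iff comm_trace_def)
qed

lemma tr_commutator:
  assumes "A \<in> SL2" "B \<in> SL2"
  shows "tr (commutator (moebius_of A) (moebius_of B)) =
    \<bar>comm_trace (mtrace A) (mtrace B) (mtrace (A ** B))\<bar>"
proof -
  have "commutator (moebius_of A) (moebius_of B) = moebius_of (A ** B ** adj A ** adj B)"
    using assms by (simp add: commutator_def inv_moebius_of moebius_of_mult adj_SL2 mult_SL2)
  then show ?thesis using assms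
    by (simp only: tr_moebius_of mult_SL2 adj_SL2 mtrace_commutator)
qed

section \<open>The trace-minimizing algorithm\<close>

text \<open>All estimates compare values of the quadratic polynomial
  \<open>t \<mapsto> t\<^sup>2 - x z t + x\<^sup>2 + z\<^sup>2 - 4\<close> (or its analogues) to the left of its vertex.\<close>

lemma trace_reduction:
  fixes x y z :: real
  assumes x: "2 \<le> x" and xy: "x \<le> y" and z: "2 \<le> z" and K: "comm_trace x y z > 2"
    and anti: "2 * z < x * y"
  shows "z < y" "comm_trace x y z - 2 \<le> (y - z)\<^sup>2" "2 * (x * z - y) < x * z"
proof -
  define K where "K = comm_trace x y z - 2"
  have K0: "K > 0" using K by (simp add: K_def)
  have sq: "x + 2 - y\<^sup>2 \<le> 0" if "x \<le> y" "2 \<le> y" for x y :: real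
  proof -
    have "2 * y \<le> y * y" using that by (intro mult_right_mono) auto
    then show ?thesis using that unfolding power2_eq_square by linarith
  qed
  show "z < y"
  proof (rule ccontr)
    assume "\<not> z < y"
    \<comment> \<open>The change of K, seen as a quadratic in its last variable, from y to z. If y
      <= z, both lie left of the vertex, so K is at most its value at y, which is the nonpositive
      product of the next line.\<close>
    then have "(z - y) * (z + y - x * y) \<le> 0" using anti by (intro mult_nonneg_nonpos) auto
    moreover have "(x - 2) * (x + 2 - y\<^sup>2) \<le> 0" using sq[of x y] x xy by (intro mult_nonneg_nonpos) auto
    moreover have "K = (z - y) * (z + y - x * y) + (x - 2) * (x + 2 - y\<^sup>2)"
      by (simp add: K_def comm_trace_def power2_eq_square algebra_simps)
    ultimately show False using K0 by linarith
  qed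
  then have zy: "z < y" .
  have "2 * y \<le> z * y" using z x xy by (intro mult_right_mono) auto
  then have "y * z - x - 2 \<ge> 0" using x xy unfolding mult.commute[of y z] by linarith
  then have "(x - 2) * (y * z - x - 2) \<ge> 0" using x by (intro mult_nonneg_nonneg) auto
  \<comment> \<open>The nonnegative last term turns the invariant into a lower bound for the drop of
    the trace; for x = 2 the drop is exactly the square root of K.\<close>
  moreover have "(y - z)\<^sup>2 = K + (x - 2) * (y * z - x - 2)"
    by (simp add: K_def comm_trace_def power2_eq_square algebra_simps)
  ultimately show "comm_trace x y z - 2 \<le> (y - z)\<^sup>2" unfolding K_def by linarith
  show "2 * (x * z - y) < x * z"
  proof (rule ccontr)
    assume "\<not> 2 * (x * z - y) < x * z"
    \<comment> \<open>Now K is viewed as a quadratic in y. If y were not beyond the vertex, then, y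
      being at least as large as x and z, K would be at most its value at the larger of the two,
      which is nonpositive.\<close>
    then have y: "2 * y \<le> x * z" by simp
    show False
    proof (cases "x \<le> z")
      case True
      then have "(y - z) * (y + z - x * z) \<le> 0" using y zy by (intro mult_nonneg_nonpos) auto
      moreover have "(x - 2) * (x + 2 - z\<^sup>2) \<le> 0" using sq[of x z] x z True by (intro mult_nonneg_nonpos) auto
      moreover have "K = (y - z) * (y + z - x * z) + (x - 2) * (x + 2 - z\<^sup>2)"
        by (simp add: K_def comm_trace_def power2_eq_square algebra_simps)
      ultimately show False using K0 by linarith
    next
      case False
      have "(y - x) * (y + x - x * z) \<le> 0" using y xy by (intro mult_nonneg_nonpos) auto
      moreover have "(z - 2) * (z + 2 - x\<^sup>2) \<le> 0" using sq[of z x] x z False by (intro mult_nonneg_nonpos) auto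
      moreover have "K = (y - x) * (y + x - x * z) + (z - 2) * (z + 2 - x\<^sup>2)"
        by (simp add: K_def comm_trace_def power2_eq_square algebra_simps)
      ultimately show False using K0 by linarith
    qed
  qed
qed

text \<open>Excludes condition (a) when \<open>z >= 2\<close>: left of the vertex the polynomial is
  largest at z = 2, where it differs from \<open>y\<^sup>2 - 2\<close> by 4 - 2xy + x^2, negative
  because 2 < x and x <= y.\<close>

lemma comm_trace_less:
  fixes x y z :: real
  assumes "2 < x" "x \<le> y" "2 \<le> z" "2 * z < x * y"
  shows "comm_trace x y z < y\<^sup>2 - 2"
proof -
  have "(z - 2) * (z + 2 - x * y) \<le> 0" using assms by (intro mult_nonneg_nonpos) auto
  moreover have "x * x \<le> x * y" using assms by (intro mult_left_mono) auto
  moreover have "2 * x < x * x" using assms by (intro mult_strict_right_mono) auto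
  moreover have "comm_trace x y z = y\<^sup>2 - 2 + (z - 2) * (z + 2 - x * y) + (4 - 2 * (x * y) + x * x)"
    by (simp add: comm_trace_def power2_eq_square algebra_simps)
  ultimately show ?thesis using assms(1) by linarith
qed

lemma antiparallel_nielsen:
  assumes "A \<in> SL2" "2 \<le> mtrace A" "mtrace A \<le> mtrace B" "2 \<le> mtrace (A ** B)" "antiparallel A B"
  shows "antiparallel A (A ** B)"
    and "comm_trace (mtrace A) (mtrace (A ** B)) (mtrace (A ** (A ** B))) =
      comm_trace (mtrace A) (mtrace B) (mtrace (A ** B))"
    and "sqrt (comm_trace (mtrace A) (mtrace B) (mtrace (A ** B)) - 2) \<le> mtrace B - mtrace (A ** B)"
proof -
  note red = trace_reduction[OF assms(2-4)]
  have anti: "comm_trace (mtrace A) (mtrace B) (mtrace (A ** B)) > 2"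
    "2 * mtrace (A ** B) < mtrace A * mtrace B"
    using assms(5) unfolding antiparallel_def by simp_all
  show *: "comm_trace (mtrace A) (mtrace (A ** B)) (mtrace (A ** (A ** B))) =
      comm_trace (mtrace A) (mtrace B) (mtrace (A ** B))"
    unfolding mtrace_nielsen[OF assms(1)] by (rule comm_trace_nielsen)
  show "antiparallel A (A ** B)"
    unfolding antiparallel_def * using anti(1) red(3)[OF anti]
    unfolding mtrace_nielsen[OF assms(1)] by (rule conjI)
  show "sqrt (comm_trace (mtrace A) (mtrace B) (mtrace (A ** B)) - 2) \<le> mtrace B - mtrace (A ** B)"
    by (rule real_le_lsqrt) (use red(1,2)[OF anti] anti(1) in auto)
qed

lemma antiparallel_swap: "antiparallel A B \<longleftrightarrow> antiparallel B A"
  by (simp add: antiparallel_def mtrace_swap[of B A] comm_trace_swap[of "mtrace A"] mult.commute)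

lemma schottky_pair_moebius_nielsen:
  "A \<in> SL2 \<Longrightarrow> B \<in> SL2 \<Longrightarrow> schottky_pair (moebius_of A) (moebius_of (A ** B)) \<Longrightarrow>
     schottky_pair (moebius_of A) (moebius_of B)"
  by (rule schottky_pair_nielsen) (simp_all add: bij_moebius_of moebius_of_mult)

lemma generated_semigroup_nielsen:
  "generated_semigroup {f, f \<circ> g} \<subseteq> generated_semigroup {f, g}"
  by (rule generated_semigroup_mono)
     (blast intro: generated_semigroup.incl generated_semigroup.comp)

text \<open>The commutator trace stays constant, so each move lowers the trace sum by the same
  positive amount at least, and both traces stay at least 2 as long as moves are made. An elliptic
  element of the smaller semigroup lies in the larger one; a Schottky pair is carried back by
  equality of the groups.\<close>

lemma antiparallel_dichotomy:
  assumes "A \<in> SL2" "B \<in> SL2" "2 \<le> mtrace A" "2 \<le> mtrace B" "antiparallel A B"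
  shows "(\<exists>h\<in>generated_semigroup {moebius_of A, moebius_of B}. elliptic h) \<or>
    schottky_pair (moebius_of A) (moebius_of B)"
proof -
  define K where "K = comm_trace (mtrace A) (mtrace B) (mtrace (A ** B))"
  define \<delta> where "\<delta> = sqrt (K - 2)"
  have \<delta>: "\<delta> > 0" using assms(5) by (simp add: \<delta>_def K_def antiparallel_def)
  let ?P = "\<lambda>A B. (\<exists>h\<in>generated_semigroup {moebius_of A, moebius_of B}. elliptic h) \<or>
    schottky_pair (moebius_of A) (moebius_of B)"
  \<comment> \<open>\<open>n\<close> bounds the number of moves left. For \<open>n = 0\<close> the
    trace sum would be below 4, contradicting both lower bounds.\<close>
  have ind: "?P A B"
    if "A \<in> SL2" "B \<in> SL2" "2 \<le> mtrace A" "2 \<le> mtrace B" "antiparallel A B"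
      "comm_trace (mtrace A) (mtrace B) (mtrace (A ** B)) = K"
      "mtrace A + mtrace B < 4 + real n * \<delta>" for n A B
    using that
  proof (induction n arbitrary: A B)
    case (Suc n)
    have step: "?P A B"
      if A: "A \<in> SL2" and B: "B \<in> SL2" and le: "2 \<le> mtrace A" "mtrace A \<le> mtrace B"
        and anti: "antiparallel A B"
        and K: "comm_trace (mtrace A) (mtrace B) (mtrace (A ** B)) = K"
        and less: "mtrace A + mtrace B < 4 + real (Suc n) * \<delta>" for A B
    proof -
      have S: "moebius_of A \<circ> moebius_of B \<in> generated_semigroup {moebius_of A, moebius_of B}"
        by (blast intro: generated_semigroup.incl generated_semigroup.comp)
      consider "mtrace (A ** B) \<le> -2" | "\<bar>mtrace (A ** B)\<bar> < 2" | "2 \<le> mtrace (A ** B)"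
        by linarith
      then show ?thesis
      proof cases
        case 1
        then show ?thesis using schottky_pair_negative_trace[OF A B] le by simp
      next
        case 2
        then have "elliptic (moebius_of A \<circ> moebius_of B)"
          using elliptic_iff[OF mult_SL2[OF A B]] by (simp add: moebius_of_mult[OF B])
        then show ?thesis using S by blast
      next
        case 3
        note niel = antiparallel_nielsen[OF A le 3 anti]
        have "\<delta> \<le> mtrace B - mtrace (A ** B)" using niel(3) by (simp only: K \<delta>_def)
        then have "mtrace A + mtrace (A ** B) < 4 + real n * \<delta>"
          using less by (simp add: algebra_simps)
        then have "?P A (A ** B)"
          using Suc.IH[OF A mult_SL2[OF A B] le(1) 3 niel(1)] niel(2) K by simp
        then show ?thesis
          using schottky_pair_moebius_nielsen[OF A B] generated_semigroup_nielsen
          by (auto simp: moebius_of_mult[OF B])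
      qed
    qed
    show ?case
    proof (cases "mtrace A \<le> mtrace B")
      case True
      then show ?thesis using step[of A B] Suc.prems by blast
    next
      case False
      then have "?P B A"
        using step[of B A] Suc.prems
        by (simp add: antiparallel_swap[of B A] mtrace_swap[of B A] comm_trace_swap[of "mtrace B"] add.commute)
      then show ?thesis using schottky_pair_swap by (metis insert_commute)
    qed
  qed simp
  obtain n where "(mtrace A + mtrace B - 4) / \<delta> < real n" using reals_Archimedean2 by blast
  then have "mtrace A + mtrace B < 4 + real n * \<delta>" using \<delta> by (simp add: field_simps)
  then show ?thesis using ind[of A B n] assms by (simp add: K_def)
qed

text \<open>Trace 2 is minimal, so the roles never switch and the only products tested for
  ellipticity are the powers of the first map times the second.\<close>

lemma antiparallel_parabolic:
  assumes "A \<in> SL2" "B \<in> SL2" "mtrace A = 2" "2 \<le> mtrace B" "antiparallel A B"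
    and "\<And>n. n > 0 \<Longrightarrow> \<not> elliptic ((moebius_of A ^^ n) \<circ> moebius_of B)"
  shows "schottky_pair (moebius_of A) (moebius_of B)"
proof -
  define K where "K = comm_trace (mtrace A) (mtrace B) (mtrace (A ** B))"
  define \<delta> where "\<delta> = sqrt (K - 2)"
  have \<delta>: "\<delta> > 0" using assms(5) by (simp add: \<delta>_def K_def antiparallel_def)
  have ind: "schottky_pair (moebius_of A) (moebius_of B)"
    if "B \<in> SL2" "2 \<le> mtrace B" "antiparallel A B"
      "comm_trace (mtrace A) (mtrace B) (mtrace (A ** B)) = K"
      "\<And>n. n > 0 \<Longrightarrow> \<not> elliptic ((moebius_of A ^^ n) \<circ> moebius_of B)"
      "mtrace B < 2 + real n * \<delta>" for n B
    using that
  proof (induction n arbitrary: B)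
    case (Suc n)
    note A = assms(1) and B = Suc.prems(1)
    have le: "2 \<le> mtrace A" "mtrace A \<le> mtrace B" using assms(3) Suc.prems(2) by simp_all
    have "\<not> elliptic (moebius_of (A ** B))"
      using Suc.prems(5)[of 1] by (simp add: moebius_of_mult[OF B] o_def)
    then have "2 \<le> \<bar>mtrace (A ** B)\<bar>" using elliptic_iff[OF mult_SL2[OF A B]] by simp
    then consider "mtrace (A ** B) \<le> -2" | "2 \<le> mtrace (A ** B)" by linarith
    then show ?case
    proof cases
      case 1
      then show ?thesis using schottky_pair_negative_trace[OF A B] le by simp
    next
      case 2
      note niel = antiparallel_nielsen[OF A le 2 Suc.prems(3)]
      have "\<delta> \<le> mtrace B - mtrace (A ** B)" using niel(3) by (simp only: Suc.prems(4) \<delta>_def)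
      then have less: "mtrace (A ** B) < 2 + real n * \<delta>"
        using Suc.prems(6) by (simp add: algebra_simps)
      have K: "comm_trace (mtrace A) (mtrace (A ** B)) (mtrace (A ** (A ** B))) = K"
        using niel(2) Suc.prems(4) by simp
      \<comment> \<open>For the new pair the i-th product is the product with exponent
        \<open>Suc i\<close> of the old pair, so the hypothesis passes on with a shift.\<close>
      have "\<not> elliptic ((moebius_of A ^^ i) \<circ> moebius_of (A ** B))" for i
        using Suc.prems(5)[of "Suc i"] by (simp add: moebius_of_mult[OF B] funpow_swap1 fun_eq_iff o_def)
      then show ?thesis
        using Suc.IH[OF mult_SL2[OF A B] 2 niel(1) K _ less] schottky_pair_moebius_nielsen[OF A B] by blast
    qed
  qed simp
  obtain n where "(mtrace B - 2) / \<delta> < real n" using reals_Archimedean2 by blast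
  then have "mtrace B < 2 + real n * \<delta>" using \<delta> by (simp add: field_simps)
  then show ?thesis using ind[of B n] assms by (simp add: K_def)
qed

section \<open>Parallel and antiparallel pairs\<close>

text \<open>A vanishing \<open>k\<close> or \<open>k'\<close>, or proportional \<open>e\<close> and
  \<open>u\<close>, would give a common fixed point. Rescaling \<open>e\<close> or \<open>u\<close>
  multiplies \<open>k\<close> and \<open>k'\<close> by reciprocal factors, so the sign of
  \<open>k * k'\<close> has invariant meaning.\<close>

lemma adapted_basis:
  assumes A: "A \<in> SL2" "mtrace A \<ge> 2" and B: "B \<in> SL2" "mtrace B \<ge> 2"
    and "\<not> (\<exists>x\<in>extended_reals. moebius_of A x = x \<and> moebius_of B x = x)"
  obtains e u l m k k' where "l \<ge> 1" "mtrace A = l + 1 / l" "m \<ge> 1" "mtrace B = m + 1 / m"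
    "cross e u \<noteq> 0" "app A e = l *\<^sub>R e" "app A u = (1 / l) *\<^sub>R u + k *\<^sub>R e"
    "app B u = m *\<^sub>R u" "app B e = (1 / m) *\<^sub>R e + k' *\<^sub>R u" "k \<noteq> 0" "k' \<noteq> 0"
proof -
  have nofix: False if "x \<in> extended_reals" "moebius_of A x = x" "moebius_of B x = x" for x
    using assms(5) that by blast
  obtain e l where e: "e \<noteq> 0" "l \<ge> 1" "mtrace A = l + 1 / l" "app A e = l *\<^sub>R e"
    using dominant_eigenvector[OF A] .
  obtain u m where u: "u \<noteq> 0" "m \<ge> 1" "mtrace B = m + 1 / m" "app B u = m *\<^sub>R u"
    using dominant_eigenvector[OF B] .
  have fe: "moebius_of A (rproj e) = rproj e"
    by (simp add: moebius_of_fixes_rproj[OF A(1) e(1)] e(4) cross_simps)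
  have fu: "moebius_of B (rproj u) = rproj u"
    by (simp add: moebius_of_fixes_rproj[OF B(1) u(1)] u(4) cross_simps)
  have D: "cross e u \<noteq> 0"
    using nofix[OF rproj_in_extended_reals fe] fu rproj_eq_iff[OF e(1) u(1)] by auto
  have D': "cross u e \<noteq> 0" using D cross_swap[of u e] by simp
  have l0: "l \<noteq> 0" "m \<noteq> 0" using e u by auto
  obtain k where k: "app A u = (1 / l) *\<^sub>R u + k *\<^sub>R e"
    using complement_eigenvector[OF A(1) e(4) l0(1) D] .
  obtain k' where k': "app B e = (1 / m) *\<^sub>R e + k' *\<^sub>R u"
    using complement_eigenvector[OF B(1) u(4) l0(2) D'] .
  have "k \<noteq> 0"
  proof
    assume "k = 0"
    then have "moebius_of A (rproj u) = rproj u"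
      by (simp add: moebius_of_fixes_rproj[OF A(1) u(1)] k cross_simps)
    then show False using nofix[OF rproj_in_extended_reals _ fu] by blast
  qed
  moreover have "k' \<noteq> 0"
  proof
    assume "k' = 0"
    then have "moebius_of B (rproj e) = rproj e"
      by (simp add: moebius_of_fixes_rproj[OF B(1) e(1)] k' cross_simps)
    then show False using nofix[OF rproj_in_extended_reals fe] by blast
  qed
  ultimately show ?thesis using that[OF e(2,3) u(2,3) D e(4) k u(4) k'] by blast
qed

text \<open>One endpoint is fixed and the other goes to a positive combination of both. In the
  defining product the image loses a multiple of the square of \<open>cross e w\<close>, and
  \<open>l = 1\<close> is no exception.\<close>

lemma closed_arc_mapped_strictly_inside:
  assumes A: "A \<in> SL2" and D: "cross e v \<noteq> 0" and l: "l > 0" and k: "k > 0"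
    and e: "app A e = l *\<^sub>R e" and v: "app A v = (1 / l) *\<^sub>R v + k *\<^sub>R e"
  shows "moebius_of A ` closed_arc e v \<subset> closed_arc e v"
    and "closedin circle_topology (moebius_of A ` closed_arc e v)"
proof -
  have im: "moebius_of A ` closed_arc e v = closed_arc (app A e) (app A v)"
    by (rule moebius_of_image_arc[OF A])
  have nz: "v \<noteq> 0" using cross_nz[OF D] by simp
  have eq: "cross (app A e) w * cross w (app A v) =
     cross e w * cross w v - l * k * (cross e w)\<^sup>2" for w
    using l cross_swap[of w e] by (simp add: e v cross_simps power2_eq_square algebra_simps)
  have "rproj w \<in> closed_arc e v" if "w \<noteq> 0" "cross (app A e) w * cross w (app A v) \<ge> 0" for w
  proof -
    have "l * k * (cross e w)\<^sup>2 \<ge> 0" using l k by simp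
    then have "cross e w * cross w v \<ge> 0" using that(2) eq[of w] by linarith
    then show ?thesis using that(1) by (simp add: rproj_in_closed_arc_iff)
  qed
  then have sub: "moebius_of A ` closed_arc e v \<subseteq> closed_arc e v"
    unfolding im closed_arc_def[of "app A e"] by blast
  have "- (l * k * (cross e v)\<^sup>2) < 0" using l k D by simp
  then have "rproj v \<notin> moebius_of A ` closed_arc e v"
    unfolding im rproj_in_closed_arc_iff[OF nz] eq by (simp add: cross_simps)
  moreover have "rproj v \<in> closed_arc e v"
    by (simp add: rproj_in_closed_arc_iff[OF nz] cross_simps)
  ultimately show "moebius_of A ` closed_arc e v \<subset> closed_arc e v" using sub by blast
  show "closedin circle_topology (moebius_of A ` closed_arc e v)"
    unfolding im using cross_app[OF A] D by (intro closedin_closed_arc) simp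
qed

lemma closed_arc_commute: "closed_arc u v = closed_arc v u"
proof -
  have "cross u w * cross w v = cross v w * cross w u" for w
    using cross_swap[of w u] cross_swap[of w v] by simp
  then show ?thesis by (simp add: closed_arc_def)
qed

lemma common_interval_if_parallel:
  assumes A: "A \<in> SL2" and B: "B \<in> SL2" and l: "l \<ge> 1" and m: "m \<ge> 1"
    and D: "cross e u \<noteq> 0"
    and e: "app A e = l *\<^sub>R e" "app A u = (1 / l) *\<^sub>R u + k *\<^sub>R e"
    and u: "app B u = m *\<^sub>R u" "app B e = (1 / m) *\<^sub>R e + k' *\<^sub>R u"
    and w: "k * k' > 0"
  obtains J where "closed_interval J" "J \<subseteq> extended_reals"
    "moebius_of A ` J \<subset> J" "closedin circle_topology (moebius_of A ` J)"
    "moebius_of B ` J \<subset> J" "closedin circle_topology (moebius_of B ` J)"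
proof -
  obtain v k1 k2 where v: "cross e v \<noteq> 0" "app A v = (1 / l) *\<^sub>R v + k1 *\<^sub>R e" "app B v = m *\<^sub>R v"
    "app B e = (1 / m) *\<^sub>R e + k2 *\<^sub>R v" "k1 > 0" "k2 > 0"
  proof (cases "k > 0")
    case True
    then have "k' > 0" using w by (simp add: zero_less_mult_iff)
    then show ?thesis using that[OF D e(2) u] True by blast
  next
    \<comment> \<open>Negating \<open>u\<close> changes the signs of both off-diagonal entries and
      passes to the complementary arc.\<close>
    case False
    then have neg: "- k > 0" "- k' > 0" using w by (auto simp: zero_less_mult_iff)
    have "cross e (- u) \<noteq> 0" using D by (simp add: cross_simps)
    moreover have "app A (- u) = (1 / l) *\<^sub>R (- u) + (- k) *\<^sub>R e" "app B (- u) = m *\<^sub>R (- u)"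
      "app B e = (1 / m) *\<^sub>R e + (- k') *\<^sub>R (- u)"
      using e u by (simp_all add: app_linear)
    ultimately show ?thesis using that neg by blast
  qed
  have D': "cross v e \<noteq> 0" using v(1) cross_swap[of v e] by simp
  have pos: "l > 0" "m > 0" using l m by auto
  note 1 = closed_arc_mapped_strictly_inside[OF A v(1) pos(1) v(5) e(1) v(2)]
  note 2 = closed_arc_mapped_strictly_inside[OF B D' pos(2) v(6) v(3,4), unfolded closed_arc_commute[of v]]
  show ?thesis
    using that[OF closed_interval_closed_arc[OF v(1)] closed_arc_subset_extended_reals 1 2] .
qed

text \<open>With w = kk' and P the product of the gaps l - 1/l and m - 1/m, the commutator trace
  minus 2 is w (w - P), and xy - 2z is P - 2w. Both are positive for w < 0, as P >= 0.\<close>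

lemma antiparallel_if_negative:
  assumes l: "l \<ge> 1" "mtrace A = l + 1 / l" and m: "m \<ge> 1" "mtrace B = m + 1 / m"
    and D: "cross e u \<noteq> 0"
    and e: "app A e = l *\<^sub>R e" "app A u = (1 / l) *\<^sub>R u + k *\<^sub>R e"
    and u: "app B u = m *\<^sub>R u" "app B e = (1 / m) *\<^sub>R e + k' *\<^sub>R u"
    and w: "k * k' < 0"
  shows "antiparallel A B"
proof -
  define L where "L = 1 / l" define M where "M = 1 / m"
  have lL: "l * L = 1" "m * M = 1" using l m by (simp_all add: L_def M_def)
  have L: "L \<le> 1" "M \<le> 1" using l m by (simp_all add: L_def M_def)
  have "mtrace (A ** B) * cross e u = cross (app (A ** B) e) u + cross e (app (A ** B) u)"
    by (rule trace_cross)
  also have "\<dots> = (l * M + m * L + k * k') * cross e u"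
    by (simp add: app_mult u app_linear e cross_simps L_def M_def algebra_simps)
  finally have z: "mtrace (A ** B) = l * M + m * L + k * k'" using D by (simp only: mult_cancel_right) auto
  have xy: "mtrace A = l + L" "mtrace B = m + M" using l m by (simp_all add: L_def M_def)
  have pos: "(l - L) * (m - M) \<ge> 0" using l m L by (intro mult_nonneg_nonneg) auto
  have "comm_trace (l + L) (m + M) (l * M + m * L + k * k') =
     (l\<^sup>2 + L\<^sup>2) * (1 - m * M) + (m\<^sup>2 + M\<^sup>2) * (1 - l * L) + 2 * (l * L) + 2 * (m * M) - 2 +
     k * k' * (k * k' - (l - L) * (m - M))"
    by (simp add: comm_trace_def power2_eq_square algebra_simps)
  then have "comm_trace (l + L) (m + M) (l * M + m * L + k * k') = 2 + k * k' * (k * k' - (l - L) * (m - M))"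
    unfolding lL by simp
  moreover have "k * k' * (k * k' - (l - L) * (m - M)) > 0"
    using w pos by (intro mult_neg_neg) auto
  moreover have "(l + L) * (m + M) - 2 * (l * M + m * L + k * k') = (l - L) * (m - M) - 2 * (k * k')"
    by (simp add: algebra_simps)
  ultimately show ?thesis using w pos unfolding antiparallel_def z xy by linarith
qed

text \<open>Converts the position of C relative to 1 into the sign of \<open>k * k'\<close>. Since
  neither factor is zero, the denominator is nonzero and the infinite value does not occur.\<close>

lemma cross_ratio_adapted:
  assumes A: "A \<in> SL2" and B: "B \<in> SL2" and l: "l > 1" and m: "m > 1"
    and D: "cross e u \<noteq> 0"
    and e: "app A e = l *\<^sub>R e" "app A u = (1 / l) *\<^sub>R u + k *\<^sub>R e"
    and u: "app B u = m *\<^sub>R u" "app B e = (1 / m) *\<^sub>R e + k' *\<^sub>R u"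
    and k: "k \<noteq> 0" "k' \<noteq> 0"
  shows "cross_ratio_C (moebius_of A) (moebius_of B) = ereal (1 - (l - 1 / l) * (m - 1 / m) / (k * k'))"
proof -
  \<comment> \<open>The eigenvectors for the repelling fixed points, as in
    \<open>fixpoints\<close>.\<close>
  define e2 where "e2 = k *\<^sub>R e - (l - 1 / l) *\<^sub>R u"
  define u2 where "u2 = k' *\<^sub>R u - (m - 1 / m) *\<^sub>R e"
  have swap: "cross u e = - cross e u" by (rule cross_swap)
  have pos: "l - 1 / l > 0" "m - 1 / m > 0" by (rule diff_inverse_pos[OF l], rule diff_inverse_pos[OF m])
  have "cross (k *\<^sub>R e - p *\<^sub>R u) (k' *\<^sub>R u - q *\<^sub>R e) = (k * k' - p * q) * cross e u" for p q
    by (simp add: cross_simps cross_diff swap algebra_simps)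
  then have c5: "cross e2 u2 = (k * k' - (l - 1 / l) * (m - 1 / m)) * cross e u"
    unfolding e2_def u2_def .
  have c: "cross e e2 = - (l - 1 / l) * cross e u" "cross u u2 = (m - 1 / m) * cross e u"
    "cross e u2 = k' * cross e u" "cross e2 u = k * cross e u"
    by (simp_all only: e2_def u2_def cross_simps cross_diff swap mult_zero_right mult_minus_right diff_0 diff_zero
        diff_minus_eq_add add_0 mult_minus_left minus_minus)
  have D2: "cross e e2 \<noteq> 0" "cross u u2 \<noteq> 0" unfolding c using D pos by simp_all
  have "app A e2 = (1 / l) *\<^sub>R e2"
  proof -
    have "app A e2 = (k * l - (l - 1 / l) * k) *\<^sub>R e - ((l - 1 / l) * (1 / l)) *\<^sub>R u"
      by (simp only: e2_def diff_conv_add_uminus app_linear e) (simp add: algebra_simps)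
    also have "k * l - (l - 1 / l) * k = (1 / l) * k" by (simp add: algebra_simps)
    finally show ?thesis by (simp add: e2_def algebra_simps)
  qed
  note fA = attracting_fixpoint_eq[OF A l e(1) this D2(1)] repelling_fixpoint_eq[OF A l e(1) this D2(1)]
  have "app B u2 = (1 / m) *\<^sub>R u2"
  proof -
    have "app B u2 = (k' * m - (m - 1 / m) * k') *\<^sub>R u - ((m - 1 / m) * (1 / m)) *\<^sub>R e"
      by (simp only: u2_def diff_conv_add_uminus app_linear u) (simp add: algebra_simps)
    also have "k' * m - (m - 1 / m) * k' = (1 / m) * k'" by (simp add: algebra_simps)
    finally show ?thesis by (simp add: u2_def algebra_simps)
  qed
  note fB = attracting_fixpoint_eq[OF B m u(1) this D2(2)] repelling_fixpoint_eq[OF B m u(1) this D2(2)]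
  have nz: "e \<noteq> 0" "u \<noteq> 0" "u2 \<noteq> 0" "e2 \<noteq> 0" using cross_nz[OF D2(1)] cross_nz[OF D2(2)] by auto
  have "cross e u2 \<noteq> 0" "cross e2 u \<noteq> 0" unfolding c using D k by simp_all
  note hom = cross_ratio_homogeneous[OF nz this]
  have "cross_ratio_C (moebius_of A) (moebius_of B) =
     ereal ((cross e u * cross e2 u2) / (cross e u2 * cross e2 u))"
    unfolding cross_ratio_C_def fA fB Let_def using hom by simp
  also have "(cross e u * cross e2 u2) / (cross e u2 * cross e2 u) =
     (k * k' - (l - 1 / l) * (m - 1 / m)) / (k * k')"
    unfolding c c5 using D k by (simp add: mult.commute)
  also have "\<dots> = 1 - (l - 1 / l) * (m - 1 / m) / (k * k')"
    using k by (simp add: diff_divide_distrib)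
  finally show ?thesis .
qed

lemma hyperbolic_eigenvalue: "l \<ge> 1 \<Longrightarrow> l + 1 / l > 2 \<Longrightarrow> l > (1::real)"
  by (cases "l = 1") auto

theorem theorem1p4:
  fixes f g :: "complex option \<Rightarrow> complex option"
  assumes "f \<in> moebius_transformations" and "g \<in> moebius_transformations"
    and "tr f \<le> tr g"
    and "\<not> elementary (generated_semigroup {f, g})"
  shows
    "(semidiscrete (generated_semigroup {f, g}) \<and> inverse_free (generated_semigroup {f, g}) \<longleftrightarrow>
       exactly_one_of
         (parabolic f \<and> parabolic g \<and> \<not> elliptic (f \<circ> g))
         (parabolic f \<and> hyperbolic g \<and> (\<forall>n::nat. n > 0 \<longrightarrow> \<not> elliptic ((f ^^ n) \<circ> g)))
         (hyperbolic f \<and> hyperbolic g \<and>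
           (cross_ratio_C f g < 1 \<or>
            (cross_ratio_C f g > 1 \<and> \<not> elliptic (f \<circ> g) \<and>
              (tr (commutator f g) \<ge> (tr g)\<^sup>2 - 2 \<or>
               (tr (commutator f g) < (tr g)\<^sup>2 - 2 \<and>
                semidiscrete (generated_semigroup {f, f \<circ> g}) \<and>
                inverse_free (generated_semigroup {f, f \<circ> g})))))))
     \<and>
     (semidiscrete (generated_semigroup {f, g}) \<and> inverse_free (generated_semigroup {f, g}) \<longrightarrow>
       (\<exists>J. closed_interval J \<and> f ` J \<subset> J \<and> g ` J \<subset> J) \<or>
       (\<exists>G. schottky_rank_two G \<and> generated_semigroup {f, g} \<subseteq> G))"
proof -
  let ?S = "generated_semigroup {f, g}"
  define SD where "SD \<longleftrightarrow> semidiscrete ?S \<and> inverse_free ?S"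
  define SD' where "SD' \<longleftrightarrow> semidiscrete (generated_semigroup {f, f \<circ> g}) \<and>
    inverse_free (generated_semigroup {f, f \<circ> g})"
  define T where "T \<longleftrightarrow> (\<exists>J. closed_interval J \<and> f ` J \<subset> J \<and> g ` J \<subset> J) \<or>
       (\<exists>G. schottky_rank_two G \<and> ?S \<subseteq> G)"
  define R1 where "R1 \<longleftrightarrow> \<not> elliptic (f \<circ> g)"
  define R2 where "R2 \<longleftrightarrow> (\<forall>n::nat. n > 0 \<longrightarrow> \<not> elliptic ((f ^^ n) \<circ> g))"
  define R3 where "R3 \<longleftrightarrow> cross_ratio_C f g < 1 \<or>
            (cross_ratio_C f g > 1 \<and> \<not> elliptic (f \<circ> g) \<and>
              (tr (commutator f g) \<ge> (tr g)\<^sup>2 - 2 \<or>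
               (tr (commutator f g) < (tr g)\<^sup>2 - 2 \<and> SD')))"
  obtain A where A: "A \<in> SL2" "f = moebius_of A" "mtrace A \<ge> 0" using moebius_lift[OF assms(1)] .
  obtain B where B: "B \<in> SL2" "g = moebius_of B" "mtrace B \<ge> 0" using moebius_lift[OF assms(2)] .
  have trf: "tr f = mtrace A" and trg: "tr g = mtrace B" using A B by (simp_all add: tr_eq)
  have xy: "mtrace A \<le> mtrace B" using assms(3) trf trg by simp
  have in_S: "f \<in> ?S" "g \<in> ?S" "f \<circ> g \<in> ?S"
    by (blast intro: generated_semigroup.incl generated_semigroup.comp)+
  have pow_S: "(f ^^ n) \<circ> g \<in> ?S" if "n > 0" for n
    using that generated_semigroup.comp[OF generated_semigroup_power[OF in_S(1), of "n - 1"] in_S(2)] by simp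
  have noell: "\<not> elliptic h" if SD "h \<in> ?S" for h
    using that not_elliptic_if_semidiscrete_inverse_free unfolding SD_def by blast
  have noid: "h \<noteq> id" if SD "h \<in> ?S" for h
    using that unfolding SD_def inverse_free_def by blast
  note types = parabolic_iff[OF A(1,3), folded A(2)] hyperbolic_iff[OF A(1,3), folded A(2)]
    parabolic_iff[OF B(1,3), folded B(2)] hyperbolic_iff[OF B(1,3), folded B(2)]
  have ell_iff: "elliptic f \<longleftrightarrow> \<bar>mtrace A\<bar> < 2" "elliptic g \<longleftrightarrow> \<bar>mtrace B\<bar> < 2"
    "elliptic (f \<circ> g) \<longleftrightarrow> \<bar>mtrace (A ** B)\<bar> < 2"
    using elliptic_iff[OF A(1)] elliptic_iff[OF B(1)] elliptic_iff[OF mult_SL2[OF A(1) B(1)]]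
    by (simp_all add: A(2) B(2) moebius_of_mult[OF B(1)])
  have SD'_if: "SD'" if "SD"
    using that generated_semigroup_nielsen[of f g] semidiscrete_subset
    unfolding SD_def SD'_def inverse_free_def by blast
  have main: "(SD \<longleftrightarrow> exactly_one_of (parabolic f \<and> parabolic g \<and> R1) (parabolic f \<and> hyperbolic g \<and> R2)
      (hyperbolic f \<and> hyperbolic g \<and> R3)) \<and> (SD \<longrightarrow> T)"
  proof (cases "2 \<le> mtrace A \<and> A \<noteq> mat 1 \<and> B \<noteq> mat 1")
    \<comment> \<open>Either \<open>f\<close> is elliptic or one of the generators is the identity.
      Then both sides of the equivalence are false.\<close>
    case False
    have "\<not> SD"
    proof
      assume SD
      then have "\<not> elliptic f" "f \<noteq> id" "g \<noteq> id" using noell noid in_S by blast+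
      then show False using False ell_iff(1) A B by (auto simp: moebius_of_mat_1)
    qed
    moreover have "\<not> (parabolic f \<or> hyperbolic f) \<or> \<not> (parabolic g \<or> hyperbolic g)"
      using False by (auto simp: types)
    ultimately show ?thesis unfolding exactly_one_of_def by blast
  next
    case True
    then have x: "2 \<le> mtrace A" and y: "2 \<le> mtrace B" using xy by auto
    have parhyp: "parabolic f \<longleftrightarrow> mtrace A = 2" "hyperbolic f \<longleftrightarrow> mtrace A > 2"
      "parabolic g \<longleftrightarrow> mtrace B = 2" "hyperbolic g \<longleftrightarrow> mtrace B > 2"
      using True by (simp_all add: types)
    \<comment> \<open>Once both maps are parabolic or hyperbolic, the traces select a single
      alternative, and exclusivity needs no further argument.\<close>
    have red: "exactly_one_of (parabolic f \<and> parabolic g \<and> R1) (parabolic f \<and> hyperbolic g \<and> R2)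
      (hyperbolic f \<and> hyperbolic g \<and> R3) \<longleftrightarrow>
      (if mtrace A > 2 then R3 else if mtrace B > 2 then R2 else R1)"
      using x y xy unfolding parhyp exactly_one_of_def by auto
    \<comment> \<open>Nonelementarity enters here: a common fixed point would have a one-element
      orbit.\<close>
    have nofix: "\<not> (\<exists>p\<in>extended_reals. moebius_of A p = p \<and> moebius_of B p = p)"
    proof
      assume "\<exists>p\<in>extended_reals. moebius_of A p = p \<and> moebius_of B p = p"
      then obtain p where p: "p \<in> extended_reals" "moebius_of A p = p" "moebius_of B p = p" by blast
      have "h p = p" if "h \<in> ?S" for h
        using that by induction (use p A B in auto)
      then have "{h p | h. h \<in> ?S} \<subseteq> {p}" by auto
      then have "finite {h p | h. h \<in> ?S}" using finite_subset by blast
      then show False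
        using assms(4) p(1) unfolding elementary_def closed_half_plane_def by blast
    qed
    obtain e u l m k k' where b: "l \<ge> 1" "mtrace A = l + 1 / l" "m \<ge> 1" "mtrace B = m + 1 / m"
      "cross e u \<noteq> 0" "app A e = l *\<^sub>R e" "app A u = (1 / l) *\<^sub>R u + k *\<^sub>R e"
      "app B u = m *\<^sub>R u" "app B e = (1 / m) *\<^sub>R e + k' *\<^sub>R u" "k \<noteq> 0" "k' \<noteq> 0"
      by (rule adapted_basis[OF A(1) x B(1) y nofix])
    have lm: "l > 1" "m > 1" if "mtrace A > 2"
      using that xy hyperbolic_eigenvalue[OF b(1)] hyperbolic_eigenvalue[OF b(3)] b(2,4) by auto
    have C: "cross_ratio_C f g = ereal (1 - (l - 1 / l) * (m - 1 / m) / (k * k'))" if "mtrace A > 2"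
      unfolding A(2) B(2) using cross_ratio_adapted[OF A(1) B(1) lm[OF that] b(5-11)] .
    have lmpos: "(l - 1 / l) * (m - 1 / m) > 0" if "mtrace A > 2"
      using lm[OF that] diff_inverse_pos by simp
    consider (par) "k * k' > 0" | (anti) "k * k' < 0" using b(10,11) by (metis linorder_neqE_linordered_idom mult_eq_0_iff)
    then show ?thesis
    proof cases
      case par
      obtain J where J: "closed_interval J" "J \<subseteq> extended_reals"
        "f ` J \<subset> J" "closedin circle_topology (f ` J)" "g ` J \<subset> J" "closedin circle_topology (g ` J)"
        unfolding A(2) B(2) by (rule common_interval_if_parallel[OF A(1) B(1) b(1,3,5-9) par])
      have SD: SD
        unfolding SD_def using semidiscrete_inverse_free_if_interval[OF assms(1) J(3,4) assms(2) J(5,6,2)] by simp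
      have R3 if "mtrace A > 2"
        unfolding R3_def C[OF that] using lmpos[OF that] par by simp
      moreover have R1 R2 unfolding R1_def R2_def using noell[OF SD] in_S pow_S by blast+
      moreover have T unfolding T_def using J by blast
      ultimately show ?thesis unfolding red using SD by simp
    next
      case anti
      have ap: "antiparallel A B" by (rule antiparallel_if_negative[OF b(1-9) anti])
      have SP: "SD \<and> T" if "schottky_pair f g"
        using schottky_pair_semigroup[OF that] unfolding SD_def T_def by blast
      \<comment> \<open>Semidiscrete and inverse free semigroups contain no elliptic elements, which
        leaves the Schottky branch of the dichotomy.\<close>
      have T: T if SD
        using antiparallel_dichotomy[OF A(1) B(1) x y ap] noell[OF that] SP unfolding A(2) B(2) by blast
      have neg: "schottky_pair f g" if "mtrace (A ** B) \<le> -2"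
        unfolding A(2) B(2) using schottky_pair_negative_trace[OF A(1) B(1) x y that] .
      \<comment> \<open>The move preserves \<open>antiparallel\<close>, so the dichotomy applies to
        the pair f, fg; \<open>SD'\<close> excludes its elliptic branch and the Schottky pair is
        carried back.\<close>
      have niel: "SD" if "mtrace (A ** B) \<ge> 2" SD'
      proof -
        have "\<not> elliptic h" if "h \<in> generated_semigroup {f, f \<circ> g}" for h
          using that \<open>SD'\<close> not_elliptic_if_semidiscrete_inverse_free unfolding SD'_def by blast
        then have "schottky_pair (moebius_of A) (moebius_of (A ** B))"
          using antiparallel_dichotomy[OF A(1) mult_SL2[OF A(1) B(1)] x that(1)
              antiparallel_nielsen(1)[OF A(1) x xy that(1) ap]]
          by (auto simp: A(2) B(2) moebius_of_mult[OF B(1)])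
        then show SD using schottky_pair_moebius_nielsen[OF A(1) B(1)] SP A(2) B(2) by blast
      qed
      have K: "comm_trace (mtrace A) (mtrace B) (mtrace (A ** B)) > 2"
        "2 * mtrace (A ** B) < mtrace A * mtrace B"
        using ap by (simp_all add: antiparallel_def)
      have "SD \<longleftrightarrow> (if mtrace A > 2 then R3 else if mtrace B > 2 then R2 else R1)"
      proof (cases "mtrace A > 2")
        case hyp: True
        have C1: "cross_ratio_C f g > 1" "\<not> cross_ratio_C f g < 1"
          unfolding C[OF hyp] using lmpos[OF hyp] anti
          by (auto simp: divide_less_0_iff zero_less_divide_iff not_less divide_nonneg_neg divide_le_0_iff)
        have SD if "\<not> elliptic (f \<circ> g)" and alt: "tr (commutator f g) \<ge> (tr g)\<^sup>2 - 2 \<or> SD'"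
        proof -
          have "\<not> \<bar>mtrace (A ** B)\<bar> < 2" using that(1) ell_iff(3) by simp
          then consider "mtrace (A ** B) \<le> -2" | "mtrace (A ** B) \<ge> 2" by linarith
          then show SD
          proof cases
            case 1 then show ?thesis using neg SP by blast
          next
            case 2
            have "tr (commutator f g) = comm_trace (mtrace A) (mtrace B) (mtrace (A ** B))"
              unfolding A(2) B(2) tr_commutator[OF A(1) B(1)] using K(1) by simp
            also have "\<dots> < (mtrace B)\<^sup>2 - 2"
              using comm_trace_less[OF hyp xy 2 K(2)] .
            finally have SD' using alt trg by simp
            then show SD using niel 2 by blast
          qed
        qed
        moreover have "\<not> elliptic (f \<circ> g)" if SD using noell[OF that] in_S by blast
        \<comment> \<open>From \<open>SD\<close> to \<open>R3\<close> no trace estimate enters: the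
          semigroup of f and fg is contained in that of f and g, so (b) holds whenever (a)
          fails.\<close>
        ultimately have "SD \<longleftrightarrow> R3" unfolding R3_def using C1 SD'_if by (meson not_le)
        then show ?thesis using hyp by simp
      next
        case False
        then have par: "mtrace A = 2" using x by simp
        show ?thesis
        proof (cases "mtrace B > 2")
          case True
          have "SD \<longleftrightarrow> R2"
          proof
            assume R2
            then have "schottky_pair f g"
              unfolding A(2) B(2) R2_def using antiparallel_parabolic[OF A(1) B(1) par y ap] by blast
            then show SD using SP by blast
          qed (use noell pow_S R2_def in blast)
          then show ?thesis using True False by simp
        next
          case False
          then have "mtrace B = 2" using y by simp
          have "SD \<longleftrightarrow> R1"
          proof
            assume R1
            then have "\<bar>mtrace (A ** B)\<bar> \<ge> 2" using ell_iff(3) unfolding R1_def by simp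
            \<comment> \<open>With both traces equal to 2 the inequality reads z < 2, so a product
              that is not elliptic has \<open>z <= -2\<close> at once and no reduction takes
              place.\<close>
            moreover have "2 * mtrace (A ** B) < 2 * 2" using K(2) unfolding par \<open>mtrace B = 2\<close> .
            moreover have "z \<le> -2" if "2 \<le> \<bar>z\<bar>" "2 * z < 2 * 2" for z :: real using that by simp
            ultimately have "mtrace (A ** B) \<le> -2" by blast
            then show SD using neg SP by blast
          qed (use noell in_S R1_def in blast)
          then show ?thesis using False \<open>\<not> mtrace A > 2\<close> by simp
        qed
      qed
      then show ?thesis unfolding red using T by simp
    qed
  qed
  then show ?thesis unfolding SD_def SD'_def T_def R1_def R2_def R3_def by blast
qed

end
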